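(* Let $\Omega\subset\mathbb{R}^n$ be a bounded domain with smooth boundary, let $f,h\in C^1(\mathbb{R})$, and let $a\in C^{1,1}_{loc}((0,+\infty))$ satisfy $a(t)>0$ and $a(t)+a'(t)t>0$ for every $t\in(0,+\infty)$. Let $u\in C^2(\overline{\Omega})$ be a stable weak solution (in the sense defined in the context) of $$\operatorname{div}(a(|\nabla u|)\nabla u)+f(u)=0\ \text{ in }\Omega,\qquad a(|\nabla u|)\,\partial_\nu u+h(u)=0\ \text{ on }\partial\Omega .$$ Then, for every $\varphi\in C^1(\overline{\Omega})$, $$\int_{\Omega\cap\{\nabla u\ne0\}}\Big[\lambda_1(|\nabla u|)\,\big|\nabla_T|\nabla u|\big|^2+a(|\nabla u|)|\nabla u|^2\sum_{j=1}^{n-1}k_j^2\Big]\varphi^2\,dx$$ $$+\int_{\partial\Omega}\Big(f(u)\,\partial_\nu u-a(|\nabla u|)\langle\nabla u,\partial_\nu\nabla u\rangle-h(u)\,\Delta u-h'(u)|\nabla u|^2\Big)\varphi^2\,d\sigma$$ $$\leq\int_\Omega|\nabla u|^2\,\langle A(\nabla u)\nabla\varphi,\nabla\varphi\rangle\,dx .$$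
   Context: Notation: $\nu$ is the external unit normal to $\partial\Omega$; $u_i=\partial_{x_i}u$; $\partial_\nu\nabla u=(\partial_\nu u_1,\ldots,\partial_\nu u_n)$; $\langle\cdot,\cdot\rangle$ is the Euclidean scalar product; $\sigma$ is surface measure on $\partial\Omega$. $\lambda_1(t)=a(t)+a'(t)t$ for $t>0$. For $\xi\in\mathbb{R}^n\setminus\{0\}$, $A(\xi)$ is the $n\times n$ matrix with entries $$A_{hk}(\xi)=\frac{a'(|\xi|)}{|\xi|}\xi_h\xi_k+a(|\xi|)\delta_{hk},\qquad 1\le h,k\le n.$$ When condition (A2) below holds, $A$ extends continuously to $\xi=0$ by $A(0)=a(0)\,\mathrm{Id}$, and this extension is used. For $x\in\Omega$ with $\nabla u(x)\neq0$, let $L_{u,x}=\{y: u(y)=u(x)\}$ be the level set of $u$ through $x$, which near $x$ is a $C^2$ hypersurface. $k_1,\ldots,k_{n-1}$ denote the principal curvatures of $L_{u,x}\cap\{\nabla u\ne0\}$ at $x$, and $\nabla_T$ denotes the tangential gradient along $L_{u,x}\cap\{\nabla u\neq0\}$, i.e. $\nabla_T g=\nabla g-\big\langle\nabla g,\tfrac{\nabla u}{|\nabla u|}\big\rangle\tfrac{\nabla u}{|\nabla u|}$. Weak solution: $u$ is a weak solution of the boundary value problem if $u\in C^1(\overline\Omega)$, $$\int_\Omega a(|\nabla u|)\langle\nabla u,\nabla\varphi\rangle\,dx+\int_{\partial\Omega}h(u)\varphi\,d\sigma-\int_\Omega f(u)\varphi\,dx=0\quad\text{for all }\varphi\in C^1(\overline\Omega),$$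 and at least one of the following holds: (A1) $\{x\in\overline\Omega:\nabla u(x)=0\}=\varnothing$; (A2) $a\in C^0([0,+\infty))$ and the map $t\mapsto t\,a(t)$ belongs to $C^1([0,+\infty))$. Stability: a weak solution $u$ is stable if $$\int_\Omega\langle A(\nabla u)\nabla\varphi,\nabla\varphi\rangle\,dx+\int_{\partial\Omega}h'(u)\varphi^2\,d\sigma-\int_\Omega f'(u)\varphi^2\,dx\ge0\quad\text{for all }\varphi\in C^1(\overline\Omega).$$ *)

theory Defs
  imports "HOL-Analysis.Analysis"
begin

text \<open>
  For an open set \<open>\<Omega>\<close>, \<open>pd \<Omega> i g\<close> is the \<open>i\<close>-th partial derivative of \<open>g\<close> in \<open>\<Omega>\<close>, and at the other
  points its limit from inside \<open>\<Omega>\<close>, that is, its continuous extension to the boundary. Only the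
  values of \<open>g\<close> in \<open>\<Omega>\<close> matter.
\<close>

definition pd :: "(real^'n) set \<Rightarrow> 'n \<Rightarrow> (real^'n \<Rightarrow> real) \<Rightarrow> real^'n \<Rightarrow> real" where
  "pd \<Omega> i g x =
     (if x \<in> \<Omega> then frechet_derivative g (at x) (axis i 1)
      else Lim (at x within \<Omega>) (\<lambda>y. frechet_derivative g (at y) (axis i 1)))"

definition grad :: "(real^'n) set \<Rightarrow> (real^'n \<Rightarrow> real) \<Rightarrow> real^'n \<Rightarrow> real^'n" where
  "grad \<Omega> g x = (\<chi> i. pd \<Omega> i g x)"

definition laplacian :: "(real^'n) set \<Rightarrow> (real^'n \<Rightarrow> real) \<Rightarrow> real^'n \<Rightarrow> real" where
  "laplacian \<Omega> g x = (\<Sum>i\<in>UNIV. pd \<Omega> i (pd \<Omega> i g) x)"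

text \<open>
  \<open>Ck_closure k \<Omega> g\<close>: all partial derivatives of \<open>g\<close> of order at most \<open>k\<close> exist in the open set \<open>\<Omega>\<close>
  and extend continuously to \<open>closure \<Omega>\<close>. No existence requirement on the limits in \<^const>\<open>pd\<close> is
  needed: continuity of \<open>pd \<Omega> i g\<close> on \<open>closure \<Omega>\<close> already forces the boundary values to be the limits
  from inside. \<open>Ck_closure k UNIV\<close> is the class \<open>C\<^sup>k\<close> on the whole space.
\<close>

primrec Ck_closure :: "nat \<Rightarrow> (real^'n) set \<Rightarrow> (real^'n \<Rightarrow> real) \<Rightarrow> bool" where
  "Ck_closure 0 \<Omega> g \<longleftrightarrow> continuous_on (closure \<Omega>) g"
| "Ck_closure (Suc k) \<Omega> g \<longleftrightarrow>
     continuous_on (closure \<Omega>) g \<and> g differentiable_on \<Omega> \<and> (\<forall>i. Ck_closure k \<Omega> (pd \<Omega> i g))"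

definition smooth_function :: "(real^'n \<Rightarrow> real) \<Rightarrow> bool" where
  "smooth_function g \<longleftrightarrow> (\<forall>k. Ck_closure k UNIV g)"

text \<open>A function of the \<open>n - 1\<close> coordinates other than the \<open>i\<close>-th one.\<close>

definition indep_coord :: "'n \<Rightarrow> (real^'n \<Rightarrow> real) \<Rightarrow> bool" where
  "indep_coord i g \<longleftrightarrow> (\<forall>x y. (\<forall>j. j \<noteq> i \<longrightarrow> x $ j = y $ j) \<longrightarrow> g x = g y)"

text \<open>
  Near each boundary point the domain is, up to relabelling and reorienting the coordinate axes, the
  part of space on one side of the graph of a smooth function; \<open>s\<close> selects the side.
\<close>

definition smooth_bounded_domain :: "(real^'n) set \<Rightarrow> bool" where
  "smooth_bounded_domain \<Omega> \<longleftrightarrow>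
     open \<Omega> \<and> connected \<Omega> \<and> \<Omega> \<noteq> {} \<and> bounded \<Omega> \<and>
     (\<forall>x\<^sub>0\<in>frontier \<Omega>. \<exists>r>0. \<exists>i g. \<exists>s\<in>{-1, 1}.
        smooth_function g \<and> indep_coord i g \<and>
        \<Omega> \<inter> ball x\<^sub>0 r = {x \<in> ball x\<^sub>0 r. 0 < s * (x $ i - g x)})"

text \<open>
  \<open>hyperplane_pt i y\<close> is the point of the hyperplane \<open>x $ i = 0\<close> whose other coordinates are given by
  \<open>y\<close>. The space of all such \<open>y\<close>, carrying the product measure over \<open>UNIV - {i}\<close>, is
  \<open>(n-1)\<close>-dimensional Lebesgue measure space (a point mass if \<open>n = 1\<close>).
\<close>

definition hyperplane_pt :: "'n \<Rightarrow> ('n \<Rightarrow> real) \<Rightarrow> real^'n" where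
  "hyperplane_pt i y = (\<chi> j. if j = i then 0 else y j)"

definition graph_pt :: "'n \<Rightarrow> (real^'n \<Rightarrow> real) \<Rightarrow> ('n \<Rightarrow> real) \<Rightarrow> real^'n" where
  "graph_pt i g y = hyperplane_pt i y + g (hyperplane_pt i y) *\<^sub>R axis i 1"

text \<open>
  The surface measure of a smooth closed hypersurface \<open>S\<close>, as a Borel measure on the ambient space
  concentrated on \<open>S\<close>: wherever \<open>S\<close> is the graph of a smooth \<open>g\<close>, its area element is
  \<open>sqrt (1 + |\<nabla>g|\<^sup>2) dy\<close>. As such graphs cover \<open>S\<close>, this determines the measure.
\<close>

definition surface_measure :: "(real^'n) set \<Rightarrow> (real^'n) measure \<Rightarrow> bool" where
  "surface_measure S \<sigma> \<longleftrightarrow>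
     sets \<sigma> = sets borel \<and> emeasure \<sigma> (- S) = 0 \<and>
     (\<forall>V i g. open V \<longrightarrow> smooth_function g \<longrightarrow> indep_coord i g \<longrightarrow>
        S \<inter> V = {x \<in> V. x $ i = g x} \<longrightarrow>
        (\<forall>B\<in>sets borel. B \<subseteq> S \<inter> V \<longrightarrow>
           emeasure \<sigma> B =
             (\<integral>\<^sup>+ y. indicator B (graph_pt i g y) *
                   ennreal (sqrt (1 + (norm (grad UNIV g (hyperplane_pt i y)))\<^sup>2))
                 \<partial>(Pi\<^sub>M (UNIV - {i}) (\<lambda>_. lborel)))))"

definition tangent_space :: "(real^'n) set \<Rightarrow> real^'n \<Rightarrow> (real^'n) set" where
  "tangent_space S x =
     {v. \<exists>\<gamma> \<epsilon>. 0 < \<epsilon> \<and> \<gamma> 0 = x \<and> (\<forall>t. \<bar>t\<bar> < \<epsilon> \<longrightarrow> \<gamma> t \<in> S) \<and>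
             (\<gamma> has_vector_derivative v) (at (0::real))}"

definition is_outer_normal :: "(real^'n) set \<Rightarrow> real^'n \<Rightarrow> real^'n \<Rightarrow> bool" where
  "is_outer_normal \<Omega> x v \<longleftrightarrow>
     norm v = 1 \<and> (\<forall>w\<in>tangent_space (frontier \<Omega>) x. v \<bullet> w = 0) \<and>
     (\<exists>\<epsilon>>0. \<forall>t. 0 < t \<and> t < \<epsilon> \<longrightarrow> x - t *\<^sub>R v \<in> \<Omega> \<and> x + t *\<^sub>R v \<notin> closure \<Omega>)"

definition outer_normal :: "(real^'n) set \<Rightarrow> real^'n \<Rightarrow> real^'n" where
  "outer_normal \<Omega> x = (THE v. is_outer_normal \<Omega> x v)"

definition normal_deriv :: "(real^'n) set \<Rightarrow> (real^'n \<Rightarrow> real) \<Rightarrow> real^'n \<Rightarrow> real" where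
  "normal_deriv \<Omega> g x = grad \<Omega> g x \<bullet> outer_normal \<Omega> x"

definition normal_deriv_grad :: "(real^'n) set \<Rightarrow> (real^'n \<Rightarrow> real) \<Rightarrow> real^'n \<Rightarrow> real^'n" where
  "normal_deriv_grad \<Omega> g x = (\<chi> i. normal_deriv \<Omega> (pd \<Omega> i g) x)"

definition regular_level_set :: "(real^'n) set \<Rightarrow> (real^'n \<Rightarrow> real) \<Rightarrow> real^'n \<Rightarrow> (real^'n) set" where
  "regular_level_set \<Omega> u x = {y \<in> \<Omega>. u y = u x \<and> grad \<Omega> u y \<noteq> 0}"

definition unit_normal_field_near :: "(real^'n) set \<Rightarrow> real^'n \<Rightarrow> (real^'n \<Rightarrow> real^'n) \<Rightarrow> bool" where
  "unit_normal_field_near S x N \<longleftrightarrow>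
     (\<exists>\<epsilon>>0. \<forall>y\<in>S \<inter> ball x \<epsilon>. norm (N y) = 1 \<and> (\<forall>w\<in>tangent_space S y. N y \<bullet> w = 0))"

text \<open>
  \<open>k 1, \<dots>, k (n-1)\<close> are the principal curvatures at \<open>x\<close> of the hypersurface \<open>S\<close>: the eigenvalues,
  with multiplicity, of the shape operator \<open>v \<mapsto> - dN(v)\<close> on the tangent space, listed along an
  orthonormal basis \<open>e\<close> of principal directions. The derivative \<open>W\<close> of \<open>N\<close> within \<open>S\<close> is determined
  on tangent vectors only. The choice of the unit normal field \<open>N\<close> leaves a common sign of the
  \<open>k j\<close> free.
\<close>

definition principal_curvatures :: "(real^'n) set \<Rightarrow> real^'n \<Rightarrow> (nat \<Rightarrow> real) \<Rightarrow> bool" where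
  "principal_curvatures S x k \<longleftrightarrow>
     (\<exists>N W e. unit_normal_field_near S x N \<and> (N has_derivative W) (at x within S) \<and>
        (\<forall>i\<in>{1..CARD('n) - 1}. e i \<in> tangent_space S x \<and> W (e i) = - k i *\<^sub>R e i) \<and>
        (\<forall>i\<in>{1..CARD('n) - 1}. \<forall>j\<in>{1..CARD('n) - 1}. e i \<bullet> e j = (if i = j then 1 else 0)))"

definition tangential_grad ::
    "(real^'n) set \<Rightarrow> (real^'n \<Rightarrow> real) \<Rightarrow> (real^'n \<Rightarrow> real) \<Rightarrow> real^'n \<Rightarrow> real^'n" where
  "tangential_grad \<Omega> u g x =
     (let N = grad \<Omega> u x /\<^sub>R norm (grad \<Omega> u x) in grad \<Omega> g x - (grad \<Omega> g x \<bullet> N) *\<^sub>R N)"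

definition C11_loc_pos :: "(real \<Rightarrow> real) \<Rightarrow> bool" where
  "C11_loc_pos a \<longleftrightarrow>
     a C1_differentiable_on {0<..} \<and>
     (\<forall>K. compact K \<and> K \<subseteq> {0<..} \<longrightarrow> (\<exists>L. L-lipschitz_on K (deriv a)))"

definition lambda1 :: "(real \<Rightarrow> real) \<Rightarrow> real \<Rightarrow> real" where
  "lambda1 a t = a t + deriv a t * t"

definition A_matrix :: "(real \<Rightarrow> real) \<Rightarrow> real^'n \<Rightarrow> real^'n^'n" where
  "A_matrix a \<xi> =
     (if \<xi> = 0 then a 0 *\<^sub>R mat 1
      else (\<chi> p q. deriv a (norm \<xi>) / norm \<xi> * \<xi> $ p * \<xi> $ q
                   + a (norm \<xi>) * (if p = q then 1 else 0)))"

definition cond_A1 :: "(real^'n) set \<Rightarrow> (real^'n \<Rightarrow> real) \<Rightarrow> bool" where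
  "cond_A1 \<Omega> u \<longleftrightarrow> {x \<in> closure \<Omega>. grad \<Omega> u x = 0} = {}"

definition cond_A2 :: "(real \<Rightarrow> real) \<Rightarrow> bool" where
  "cond_A2 a \<longleftrightarrow>
     continuous_on {0..} a \<and>
     (\<exists>D. continuous_on {0..} D \<and>
          (\<forall>t\<in>{0..}. ((\<lambda>t. t * a t) has_real_derivative D t) (at t within {0..})))"

definition weak_solution ::
    "(real^'n) set \<Rightarrow> (real^'n) measure \<Rightarrow> (real \<Rightarrow> real) \<Rightarrow> (real \<Rightarrow> real) \<Rightarrow> (real \<Rightarrow> real)
      \<Rightarrow> (real^'n \<Rightarrow> real) \<Rightarrow> bool" where
  "weak_solution \<Omega> \<sigma> a f h u \<longleftrightarrow>
     Ck_closure 1 \<Omega> u \<and>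
     (\<forall>\<phi>. Ck_closure 1 \<Omega> \<phi> \<longrightarrow>
        (LINT x:\<Omega>|lborel. a (norm (grad \<Omega> u x)) * (grad \<Omega> u x \<bullet> grad \<Omega> \<phi> x))
        + (LINT x:frontier \<Omega>|\<sigma>. h (u x) * \<phi> x)
        - (LINT x:\<Omega>|lborel. f (u x) * \<phi> x) = 0) \<and>
     (cond_A1 \<Omega> u \<or> cond_A2 a)"

definition stable_weak_solution ::
    "(real^'n) set \<Rightarrow> (real^'n) measure \<Rightarrow> (real \<Rightarrow> real) \<Rightarrow> (real \<Rightarrow> real) \<Rightarrow> (real \<Rightarrow> real)
      \<Rightarrow> (real^'n \<Rightarrow> real) \<Rightarrow> bool" where
  "stable_weak_solution \<Omega> \<sigma> a f h u \<longleftrightarrow>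
     weak_solution \<Omega> \<sigma> a f h u \<and>
     (\<forall>\<phi>. Ck_closure 1 \<Omega> \<phi> \<longrightarrow>
        (LINT x:\<Omega>|lborel. (A_matrix a (grad \<Omega> u x) *v grad \<Omega> \<phi> x) \<bullet> grad \<Omega> \<phi> x)
        + (LINT x:frontier \<Omega>|\<sigma>. deriv h (u x) * (\<phi> x)\<^sup>2)
        - (LINT x:\<Omega>|lborel. deriv f (u x) * (\<phi> x)\<^sup>2) \<ge> 0)"

end

theory Submission
  imports Defs
begin

text \<open>
  Write \<open>V = a(\<bar>\<nabla>u\<bar>) \<nabla>u\<close>, which is \<open>C\<^sup>1\<close> up to the boundary with \<open>\<partial>\<^sub>m V = A(\<nabla>u) \<nabla>u\<^sub>m\<close>. Differentiating the
  equation in direction \<open>e\<^sub>m\<close>, testing with \<open>\<phi>\<^sup>2 u\<^sub>m\<close> and summing over \<open>m\<close> gives an identity for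
  \<open>\<integral> \<Sum>\<^sub>m \<langle>A \<nabla>u\<^sub>m, \<nabla>(\<phi>\<^sup>2 u\<^sub>m)\<rangle> - f'(u) \<bar>\<nabla>u\<bar>\<^sup>2 \<phi>\<^sup>2\<close>; its boundary terms containing \<open>\<nabla>\<phi>\<close> cancel because
  \<open>V \<sqdot> \<nu> = - h(u)\<close>. Subtracting it from the stability inequality with test function \<open>\<phi> \<bar>\<nabla>u\<bar>\<close> leaves
  \<open>\<Sum>\<^sub>m \<langle>A \<nabla>u\<^sub>m, \<nabla>u\<^sub>m\<rangle> - \<langle>A \<nabla>\<bar>\<nabla>u\<bar>, \<nabla>\<bar>\<nabla>u\<bar>\<rangle>\<close>, which in an orthonormal frame of principal directions and the
  normal of the level set is \<open>\<lambda>\<^sub>1 \<bar>\<nabla>\<^sub>T\<bar>\<nabla>u\<bar>\<bar>\<^sup>2 + a \<bar>\<nabla>u\<bar>\<^sup>2 \<Sum> k\<^sub>j\<^sup>2\<close>.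

  As \<open>u\<close> is only \<open>C\<^sup>2\<close>, the equation is differentiated in weak form, by testing with difference quotients
  in directions \<open>w\<close> that point into \<open>\<Omega>\<close>. The points of \<open>\<Omega>\<close> that leave it under the shift by \<open>- t w\<close>
  form a layer along the graph of the boundary, and \<open>1 / t\<close> times the integral over this layer tends to
  a surface integral. This limit also yields the divergence theorem and needs neither mollification nor a
  flattening of the boundary.
\<close>

subsection \<open>Functions with a continuous gradient up to the boundary\<close>

text \<open>Three obstacles shape the argument. A test function is given only on the closure of
  \<open>\<Omega>\<close>, so its translate by \<open>t w\<close> makes sense only if
  \<open>w\<close> points inward. Near the boundary a coordinate direction need not do so, hence the
  charts, the splitting of each coordinate direction and, finally, a partition of unity. Secondly,
  the flux is known to be differentiable at a vanishing gradient only under (A2); but a critical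
  point in the closure excludes (A1), so (A2) is available exactly where it is used. Thirdly,
  \<open>\<bar>\<nabla>u\<bar>\<close> need not be differentiable on the critical set: the test
  function for stability is regularised, and the quadratic form in
  \<open>\<nabla>\<bar>\<nabla>u\<bar>\<close> is written as a quotient that is 0 there by the
  convention on division. The difference of the two quadratic forms is then nonnegative on all of
  \<open>\<Omega>\<close>, and restricting its integral to \<open>\<nabla>u \<noteq> 0\<close> can
  only decrease it, which is the direction required. The boundary condition is recovered from the
  weak form, almost everywhere on the boundary.\<close>

definition C1_closure :: "(real^'n) set \<Rightarrow> (real^'n \<Rightarrow> real) \<Rightarrow> (real^'n \<Rightarrow> real^'n) \<Rightarrow> bool" where
  "C1_closure \<Omega> g G \<longleftrightarrow> continuous_on (closure \<Omega>) g \<and> continuous_on (closure \<Omega>) G \<and>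
     (\<forall>x\<in>\<Omega>. (g has_derivative (\<lambda>v. G x \<bullet> v)) (at x))"

lemma C1_closureD:
  assumes "C1_closure \<Omega> g G"
  shows "continuous_on (closure \<Omega>) g" "continuous_on (closure \<Omega>) G"
    "\<And>x. x \<in> \<Omega> \<Longrightarrow> (g has_derivative (\<lambda>v. G x \<bullet> v)) (at x)"
  using assms by (auto simp: C1_closure_def)

lemma linear_inner_axis:
  fixes L :: "real^'n \<Rightarrow> real"
  assumes "linear L"
  shows "L v = (\<chi> i. L (axis i 1)) \<bullet> v"
proof -
  interpret linear L by fact
  have "L v = L (\<Sum>i\<in>UNIV. v $ i *\<^sub>R axis i 1)"
    using basis_expansion[of v] by (simp add: scalar_mult_eq_scaleR)
  also have "\<dots> = (\<Sum>i\<in>UNIV. v $ i * L (axis i 1))"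
    by (simp add: sum scaleR)
  finally show ?thesis by (simp add: inner_vec_def mult.commute)
qed

lemma grad_in:
  assumes "(g has_derivative (\<lambda>v. G \<bullet> v)) (at x)" "x \<in> \<Omega>"
  shows "grad \<Omega> g x = G"
proof -
  have "frechet_derivative g (at x) = (\<lambda>v. G \<bullet> v)"
    using frechet_derivative_at[OF assms(1)] by simp
  then show ?thesis
    using assms(2) by (simp add: grad_def pd_def vec_eq_iff inner_axis)
qed

lemma differentiable_grad:
  assumes "g differentiable (at x)" "x \<in> \<Omega>"
  shows "(g has_derivative (\<lambda>v. grad \<Omega> g x \<bullet> v)) (at x)"
proof -
  have d: "(g has_derivative frechet_derivative g (at x)) (at x)"
    using assms(1) frechet_derivative_works by blast
  have "frechet_derivative g (at x) v = grad \<Omega> g x \<bullet> v" for v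
    using linear_inner_axis[OF has_derivative_linear[OF d], of v] assms(2)
    by (simp add: grad_def pd_def)
  then have "frechet_derivative g (at x) = (\<lambda>v. grad \<Omega> g x \<bullet> v)" by (rule ext)
  then show ?thesis using d by simp
qed

lemma closure_trivial_limit:
  fixes \<Omega> :: "(real^'n) set"
  assumes "x \<in> closure \<Omega>" "x \<notin> \<Omega>"
  shows "at x within \<Omega> \<noteq> bot"
  using assms by (metis closure_def Un_iff mem_Collect_eq trivial_limit_within)

text \<open>Continuity of \<open>G\<close> up to the boundary forces the limit in \<open>pd\<close>,
  so a gradient computed by product and chain rules may be exchanged for \<open>grad\<close> on the
  whole closure. This is why \<open>C1_closure\<close> carries the gradient as an argument.\<close>

lemma C1_closure_grad_eq:
  assumes "C1_closure \<Omega> g G" "x \<in> closure \<Omega>"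
  shows "grad \<Omega> g x = G x"
proof (cases "x \<in> \<Omega>")
  case True then show ?thesis using grad_in C1_closureD(3)[OF assms(1)] by blast
next
  case False
  have "((\<lambda>y. G y) \<longlongrightarrow> G x) (at x within \<Omega>)"
    using C1_closureD(2)[OF assms(1)] assms(2) closure_subset
    by (meson continuous_on_def tendsto_within_subset)
  then have lim: "((\<lambda>y. G y $ i) \<longlongrightarrow> G x $ i) (at x within \<Omega>)" for i
    by (rule tendsto_vec_nth)
  have "((\<lambda>y. frechet_derivative g (at y) (axis i 1)) \<longlongrightarrow> G x $ i) (at x within \<Omega>)" for i
  proof (rule Lim_transform_eventually[OF lim])
    show "\<forall>\<^sub>F y in at x within \<Omega>. G y $ i = frechet_derivative g (at y) (axis i 1)"
      unfolding eventually_at_filter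
      by (rule always_eventually)
        (auto simp: frechet_derivative_at[OF C1_closureD(3)[OF assms(1)], symmetric] inner_axis)
  qed
  from tendsto_Lim[OF closure_trivial_limit[OF assms(2) False] this]
  show ?thesis using False by (simp add: grad_def pd_def vec_eq_iff)
qed

lemma continuous_on_grad_iff:
  "continuous_on S (grad \<Omega> g) \<longleftrightarrow> (\<forall>i. continuous_on S (pd \<Omega> i g))"
proof
  assume "continuous_on S (grad \<Omega> g)"
  then have "continuous_on S (\<lambda>x. grad \<Omega> g x $ i)" for i
    by (intro continuous_intros)
  then show "\<forall>i. continuous_on S (pd \<Omega> i g)"
    by (simp add: grad_def)
next
  assume "\<forall>i. continuous_on S (pd \<Omega> i g)"
  then show "continuous_on S (grad \<Omega> g)"
    unfolding grad_def[abs_def] by (intro continuous_on_vec_lambda) auto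
qed

lemma Ck_closure_1:
  fixes g :: "real^'n \<Rightarrow> real"
  assumes "open \<Omega>"
  shows "Ck_closure 1 \<Omega> g \<longleftrightarrow> C1_closure \<Omega> g (grad \<Omega> g)"
proof -
  have "g differentiable_on \<Omega> \<longleftrightarrow> (\<forall>x\<in>\<Omega>. (g has_derivative (\<lambda>v. grad \<Omega> g x \<bullet> v)) (at x))"
    unfolding differentiable_on_eq_differentiable_at[OF assms]
    using differentiable_grad differentiableI by blast
  then show ?thesis
    by (simp only: One_nat_def Ck_closure.simps C1_closure_def continuous_on_grad_iff conj_ac)
qed

lemma C1_closure_cong:
  assumes "C1_closure \<Omega> g G" "\<And>x. x \<in> closure \<Omega> \<Longrightarrow> g' x = g x" "\<And>x. x \<in> closure \<Omega> \<Longrightarrow> G' x = G x"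
    "open \<Omega>"
  shows "C1_closure \<Omega> g' G'"
  unfolding C1_closure_def
proof (intro conjI ballI)
  show "continuous_on (closure \<Omega>) g'" "continuous_on (closure \<Omega>) G'"
    using C1_closureD[OF assms(1)] assms(2,3) by (auto cong: continuous_on_cong)
  fix x assume x: "x \<in> \<Omega>"
  then have "G' x = G x" using assms(3) closure_subset by blast
  then have "(g has_derivative (\<lambda>v. G' x \<bullet> v)) (at x)" using C1_closureD(3)[OF assms(1) x] by simp
  then show "(g' has_derivative (\<lambda>v. G' x \<bullet> v)) (at x)"
    by (rule has_derivative_transform_within_open[OF _ assms(4) x])
      (use assms(2) closure_subset in fastforce)
qed

text \<open>Converts functions built by the calculus rules for \<open>C1_closure\<close> into
  admissible test functions of the weak formulation and of stability.\<close>

lemma C1_closure_imp_Ck: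
  assumes "open \<Omega>" "C1_closure \<Omega> g G"
  shows "Ck_closure 1 \<Omega> g"
  unfolding Ck_closure_1[OF assms(1)]
  by (rule C1_closure_cong[OF assms(2)]) (use assms C1_closure_grad_eq in auto)

lemma Ck_closure_2:
  assumes "open \<Omega>"
  shows "Ck_closure 2 \<Omega> g \<longleftrightarrow> C1_closure \<Omega> g (grad \<Omega> g) \<and> (\<forall>i. C1_closure \<Omega> (pd \<Omega> i g) (grad \<Omega> (pd \<Omega> i g)))"
proof -
  have "Ck_closure 2 \<Omega> g \<longleftrightarrow> continuous_on (closure \<Omega>) g \<and> g differentiable_on \<Omega> \<and> (\<forall>i. Ck_closure 1 \<Omega> (pd \<Omega> i g))"
    by (simp add: numeral_2_eq_2)
  also have "\<dots> \<longleftrightarrow> Ck_closure 1 \<Omega> g \<and> (\<forall>i. Ck_closure 1 \<Omega> (pd \<Omega> i g))" by auto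
  finally show ?thesis by (simp only: Ck_closure_1[OF assms])
qed

lemma C1_closure_const: "C1_closure \<Omega> (\<lambda>x. c) (\<lambda>x. 0)"
  by (auto simp: C1_closure_def)

lemma C1_closure_add:
  assumes "C1_closure \<Omega> g G" "C1_closure \<Omega> g' G'"
  shows "C1_closure \<Omega> (\<lambda>x. g x + g' x) (\<lambda>x. G x + G' x)"
  using assms unfolding C1_closure_def
  by (auto intro!: continuous_intros derivative_eq_intros simp: inner_add_left)

lemma C1_closure_mult:
  assumes "C1_closure \<Omega> g G" "C1_closure \<Omega> g' G'"
  shows "C1_closure \<Omega> (\<lambda>x. g x * g' x) (\<lambda>x. g x *\<^sub>R G' x + g' x *\<^sub>R G x)"
  using assms unfolding C1_closure_def
  by (auto intro!: continuous_intros derivative_eq_intros simp: inner_add_left)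

lemma C1_closure_sum:
  assumes "finite I" "\<And>i. i \<in> I \<Longrightarrow> C1_closure \<Omega> (g i) (G i)"
  shows "C1_closure \<Omega> (\<lambda>x. \<Sum>i\<in>I. g i x) (\<lambda>x. \<Sum>i\<in>I. G i x)"
  using assms by (induction I rule: finite_induct) (auto intro!: C1_closure_const C1_closure_add)

text \<open>Regularity of \<open>F\<close> is demanded only at the values that \<open>g\<close>
  attains on the closure, so that \<open>sqrt\<close> and \<open>inverse\<close> can be applied to
  positive functions.\<close>

lemma C1_closure_compose:
  assumes "C1_closure \<Omega> g G"
    and F: "\<And>x. x \<in> closure \<Omega> \<Longrightarrow> (F has_real_derivative F' (g x)) (at (g x))"
    and F': "continuous_on (g ` closure \<Omega>) F'"
  shows "C1_closure \<Omega> (\<lambda>x. F (g x)) (\<lambda>x. F' (g x) *\<^sub>R G x)"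
  unfolding C1_closure_def
proof (intro conjI ballI)
  have "continuous_on (g ` closure \<Omega>) F"
    by (rule continuous_at_imp_continuous_on) (use F DERIV_isCont in blast)
  then show "continuous_on (closure \<Omega>) (\<lambda>x. F (g x))"
    by (rule continuous_on_compose2) (use C1_closureD[OF assms(1)] in auto)
  have "continuous_on (closure \<Omega>) (\<lambda>x. F' (g x))"
    by (rule continuous_on_compose2[OF F']) (use C1_closureD[OF assms(1)] in auto)
  then show "continuous_on (closure \<Omega>) (\<lambda>x. F' (g x) *\<^sub>R G x)"
    using C1_closureD[OF assms(1)] by (intro continuous_intros)
  fix x assume x: "x \<in> \<Omega>"
  then have "(F has_derivative (\<lambda>v. F' (g x) * v)) (at (g x))"
    using F closure_subset by (auto simp: has_field_derivative_def)
  from has_derivative_compose[OF C1_closureD(3)[OF assms(1) x] this]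
  show "((\<lambda>x. F (g x)) has_derivative (\<lambda>v. (F' (g x) *\<^sub>R G x) \<bullet> v)) (at x)"
    by simp
qed

lemma C1_UNIV_imp_C1_closure:
  assumes "C1_closure UNIV g G" shows "C1_closure \<Omega> g G"
  using assms unfolding C1_closure_def
  by (auto intro: continuous_on_subset)

text \<open>Schwarz's theorem, by the mean value theorem applied twice to the mixed second difference.\<close>

lemma mixed_second_difference:
  fixes g :: "real^'n \<Rightarrow> real"
  assumes \<Omega>: "ball x (2 * r) \<subseteq> \<Omega>" and t: "0 < t" "t < r"
    and g: "\<And>y. y \<in> \<Omega> \<Longrightarrow> (g has_derivative (\<lambda>v. G y \<bullet> v)) (at y)"
    and H: "\<And>y. y \<in> \<Omega> \<Longrightarrow> ((\<lambda>y. G y $ i) has_derivative (\<lambda>v. H y \<bullet> v)) (at y)"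
  obtains y where "dist y x \<le> 2 * t"
    "g (x + t *\<^sub>R axis i 1 + t *\<^sub>R axis j 1) - g (x + t *\<^sub>R axis i 1) - g (x + t *\<^sub>R axis j 1) + g x = t\<^sup>2 * H y $ j"
proof -
  let ?e = "axis i 1 :: real^'n" and ?e' = "axis j 1 :: real^'n"
  have in\<Omega>: "x + s *\<^sub>R ?e + s' *\<^sub>R ?e' \<in> \<Omega> \<and> dist (x + s *\<^sub>R ?e + s' *\<^sub>R ?e') x \<le> 2 * t"
    if "0 \<le> s" "s \<le> t" "0 \<le> s'" "s' \<le> t" for s s'
  proof -
    have "norm (s *\<^sub>R ?e + s' *\<^sub>R ?e') \<le> norm (s *\<^sub>R ?e) + norm (s' *\<^sub>R ?e')" by (rule norm_triangle_ineq)
    also have "\<dots> \<le> 2 * t" using that by simp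
    finally have "dist (x + s *\<^sub>R ?e + s' *\<^sub>R ?e') x \<le> 2 * t" by (simp add: dist_norm algebra_simps)
    then show ?thesis using \<Omega> t by (auto simp: dist_commute)
  qed
  define p where "p s = g (x + s *\<^sub>R ?e + t *\<^sub>R ?e') - g (x + s *\<^sub>R ?e)" for s
  have p: "(p has_real_derivative (G (x + s *\<^sub>R ?e + t *\<^sub>R ?e') $ i - G (x + s *\<^sub>R ?e) $ i)) (at s)"
    if "0 \<le> s" "s \<le> t" for s
  proof -
    have A: "((\<lambda>s. g (x + s *\<^sub>R ?e + s' *\<^sub>R ?e')) has_real_derivative G (x + s *\<^sub>R ?e + s' *\<^sub>R ?e') $ i) (at s)"
      if s': "0 \<le> s'" "s' \<le> t" for s'
    proof -
      have "((\<lambda>s. x + s *\<^sub>R ?e + s' *\<^sub>R ?e') has_derivative (\<lambda>v. v *\<^sub>R ?e)) (at s)"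
        by (auto intro!: derivative_eq_intros)
      from has_derivative_compose[OF this g] in\<Omega>[OF \<open>0 \<le> s\<close> \<open>s \<le> t\<close> s']
      show ?thesis by (simp add: has_field_derivative_def inner_axis mult_commute_abs)
    qed
    show ?thesis unfolding p_def
      using DERIV_diff[OF A[of t] A[of 0]] t by simp
  qed
  from MVT2[OF t(1) p] obtain s where s: "0 < s" "s < t"
    "p t - p 0 = t * (G (x + s *\<^sub>R ?e + t *\<^sub>R ?e') $ i - G (x + s *\<^sub>R ?e) $ i)" by auto
  define q where "q s' = G (x + s *\<^sub>R ?e + s' *\<^sub>R ?e') $ i" for s'
  have q: "(q has_real_derivative (H (x + s *\<^sub>R ?e + s' *\<^sub>R ?e') $ j)) (at s')"
    if "0 \<le> s'" "s' \<le> t" for s'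
  proof -
    have "((\<lambda>s'. x + s *\<^sub>R ?e + s' *\<^sub>R ?e') has_derivative (\<lambda>v. v *\<^sub>R ?e')) (at s')"
      by (auto intro!: derivative_eq_intros)
    from has_derivative_compose[OF this H] in\<Omega>[of s s'] that s
    show ?thesis unfolding q_def[abs_def]
      by (simp add: has_field_derivative_def inner_axis mult_commute_abs)
  qed
  from MVT2[OF t(1) q] obtain s' where s': "0 < s'" "s' < t"
    "q t - q 0 = t * H (x + s *\<^sub>R ?e + s' *\<^sub>R ?e') $ j" by auto
  show thesis
  proof (rule that)
    show "dist (x + s *\<^sub>R ?e + s' *\<^sub>R ?e') x \<le> 2 * t" using in\<Omega> s s' by simp
    show "g (x + t *\<^sub>R ?e + t *\<^sub>R ?e') - g (x + t *\<^sub>R ?e) - g (x + t *\<^sub>R ?e') + g x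
      = t\<^sup>2 * H (x + s *\<^sub>R ?e + s' *\<^sub>R ?e') $ j"
      using s(3) s'(3) by (simp add: p_def q_def power2_eq_square)
  qed
qed

lemma second_derivative_symmetric:
  fixes g :: "real^'n \<Rightarrow> real"
  assumes \<Omega>: "open \<Omega>" "x \<in> \<Omega>"
    and g: "\<And>y. y \<in> \<Omega> \<Longrightarrow> (g has_derivative (\<lambda>v. G y \<bullet> v)) (at y)"
    and H: "\<And>y i. y \<in> \<Omega> \<Longrightarrow> ((\<lambda>y. G y $ i) has_derivative (\<lambda>v. H i y \<bullet> v)) (at y)"
    and cont: "\<And>i. continuous_on \<Omega> (H i)"
  shows "H i x $ j = H j x $ i"
proof -
  obtain r where r: "r > 0" "ball x (2 * r) \<subseteq> \<Omega>"
  proof -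
    obtain e where "e > 0" "ball x e \<subseteq> \<Omega>" using \<Omega> open_contains_ball by blast
    then show ?thesis using that[of "e/2"] by simp
  qed
  \<comment> \<open>The shift by 2 keeps \<open>t 0 = r / 2\<close> strictly below \<open>r\<close>,
    as \<open>mixed_second_difference\<close> requires.\<close>
  define t where "t n = r / real (n + 2)" for n
  have t: "0 < t n" "t n < r" for n using r by (auto simp: t_def field_simps add_pos_nonneg)
  have t0: "t \<longlonglongrightarrow> 0" unfolding t_def
    using LIMSEQ_ignore_initial_segment[OF lim_const_over_n, of r 2] .
  define D where "D i j n = g (x + t n *\<^sub>R axis i 1 + t n *\<^sub>R axis j 1) - g (x + t n *\<^sub>R axis i 1) - g (x + t n *\<^sub>R axis j 1) + g x" for i j n
  have lim: "(\<lambda>n. D i j n / (t n)\<^sup>2) \<longlonglongrightarrow> H i x $ j" for i j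
  proof -
    have "\<exists>y. dist y x \<le> 2 * t n \<and> D i j n = (t n)\<^sup>2 * H i y $ j" for n
      unfolding D_def by (rule mixed_second_difference[where G=G and H="H i" and i=i and j=j, OF r(2) t[of n] g H]) auto
    then obtain y where y: "\<And>n. dist (y n) x \<le> 2 * t n" "\<And>n. D i j n = (t n)\<^sup>2 * H i (y n) $ j" by metis
    have "(\<lambda>n. dist (y n) x) \<longlonglongrightarrow> 0"
      by (rule tendsto_sandwich[OF _ _ tendsto_const, where h="\<lambda>n. 2 * t n"])
        (use y tendsto_mult_right_zero[OF t0, of 2] in auto)
    then have "y \<longlonglongrightarrow> x" using tendsto_dist_iff by blast
    then have "(\<lambda>n. H i (y n)) \<longlonglongrightarrow> H i x"
      using cont \<Omega> by (metis continuous_on_eq_continuous_at isCont_tendsto_compose)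
    then have "(\<lambda>n. H i (y n) $ j) \<longlonglongrightarrow> H i x $ j" by (rule tendsto_vec_nth)
    moreover have "D i j n / (t n)\<^sup>2 = H i (y n) $ j" for n using y(2)[of n] t[of n] by simp
    ultimately show ?thesis by simp
  qed
  have "D i j n = D j i n" for n by (simp add: D_def add.commute add.left_commute)
  then show ?thesis using lim[of i j] lim[of j i] LIMSEQ_unique by fastforce
qed

subsection \<open>Charts of the boundary\<close>

lemma has_derivative_line:
  fixes F :: "real^'n \<Rightarrow> real"
  assumes "(F has_derivative (\<lambda>v. G \<bullet> v)) (at (x + t *\<^sub>R w))"
  shows "((\<lambda>t. F (x + t *\<^sub>R w)) has_real_derivative (G \<bullet> w)) (at t)"
proof -
  have "((\<lambda>t. x + t *\<^sub>R w) has_derivative (\<lambda>h. h *\<^sub>R w)) (at t)"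
    by (auto intro!: derivative_eq_intros)
  from has_derivative_compose[OF this assms] show ?thesis
    by (simp add: has_field_derivative_def mult_commute_abs)
qed

text \<open>Decides on which side of a level set the points along a transversal direction lie;
  \<open>outer_normal_eq\<close> applies it to both signs of the normal.\<close>

lemma increases_along:
  fixes F :: "real^'n \<Rightarrow> real"
  assumes "(F has_derivative (\<lambda>v. G \<bullet> v)) (at x)" "G \<bullet> w > 0"
  shows "\<exists>\<epsilon>>0. \<forall>t. 0 < t \<and> t < \<epsilon> \<longrightarrow> F x < F (x + t *\<^sub>R w)"
  using DERIV_pos_inc_right[OF has_derivative_line[of F G x 0 w]] assms by auto

text \<open>
  The curve realising a tangent direction \<open>w\<close> is \<open>x + t w + s(t) G\<close>. The intermediate value theorem
  provides some root \<open>\<bar>s(t)\<bar> \<le> \<bar>t\<bar>\<close>, and differentiability at \<open>x\<close> alone forces \<open>s(t) = o(t)\<close>, so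
  the implicit function theorem is not needed.
\<close>

lemma tangent_space_level_set:
  fixes F :: "real^'n \<Rightarrow> real"
  assumes U: "open U" "x \<in> U" and S: "S \<inter> U = {y \<in> U. F y = 0}" and Fx: "F x = 0"
    and cont: "continuous_on U F" and F: "(F has_derivative (\<lambda>v. G \<bullet> v)) (at x)" and "G \<noteq> 0"
  shows "tangent_space S x = {w. G \<bullet> w = 0}"
proof (intro equalityI subsetI)
  fix w assume "w \<in> tangent_space S x"
  then obtain \<gamma> e where \<gamma>: "0 < e" "\<gamma> 0 = x" "\<And>t. \<bar>t\<bar> < e \<Longrightarrow> \<gamma> t \<in> S"
    "(\<gamma> has_vector_derivative w) (at 0)" unfolding tangent_space_def by blast
  have "continuous (at 0) \<gamma>" using \<gamma>(4) has_vector_derivative_continuous by blast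
  then have "\<forall>\<^sub>F t in at 0. \<gamma> t \<in> U"
    using U \<gamma>(2) unfolding continuous_at by (metis topological_tendstoD)
  moreover have "\<forall>\<^sub>F t in at (0::real). \<bar>t\<bar> < e"
    using \<gamma>(1) by (auto simp: eventually_at intro!: exI[of _ e])
  ultimately have "\<forall>\<^sub>F t in at 0. F (\<gamma> t) = 0"
    by eventually_elim (use S \<gamma>(3) in auto)
  moreover have "F (\<gamma> 0) = 0" using \<gamma>(2) Fx by simp
  ultimately have ev: "\<forall>\<^sub>F t in nhds 0. F (\<gamma> t) = 0"
    by (simp add: eventually_nhds_conv_at)
  have "((\<lambda>t. F (\<gamma> t)) has_derivative (\<lambda>h. G \<bullet> (h *\<^sub>R w))) (at 0)"
    using has_derivative_compose[OF \<gamma>(4)[unfolded has_vector_derivative_def], of F "\<lambda>v. G \<bullet> v"] F \<gamma>(2)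
    by blast
  then have "((\<lambda>t. F (\<gamma> t)) has_real_derivative (G \<bullet> w)) (at 0)"
    by (simp add: has_field_derivative_def mult_commute_abs)
  then have "((\<lambda>t. 0) has_real_derivative (G \<bullet> w)) (at 0)"
    using DERIV_cong_ev[OF refl ev refl] by blast
  then show "w \<in> {w. G \<bullet> w = 0}" using DERIV_unique[OF _ DERIV_const[of 0]] by simp
next
  fix w assume "w \<in> {w. G \<bullet> w = 0}"
  then have w: "G \<bullet> w = 0" by simp
  have n: "G \<bullet> G > 0" "norm G > 0" using \<open>G \<noteq> 0\<close> by auto
  \<comment> \<open>First-order expansion at \<open>x\<close>: \<open>G\<close> annihilates
    \<open>w\<close>, so only \<open>s * (G \<bullet> G)\<close> remains, with an error that is
    uniform over \<open>\<bar>s\<bar> \<le> \<bar>t\<bar>\<close>.\<close>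
  have est: "\<exists>d>0. \<forall>t s. \<bar>t\<bar> < d \<and> \<bar>s\<bar> \<le> \<bar>t\<bar> \<longrightarrow> x + t *\<^sub>R w + s *\<^sub>R G \<in> U \<and>
      \<bar>F (x + t *\<^sub>R w + s *\<^sub>R G) - s * (G \<bullet> G)\<bar> \<le> e * \<bar>t\<bar>" if "e > 0" for e
  proof -
    define c where "c = norm w + norm G"
    have c: "c > 0" using add_nonneg_pos[OF norm_ge_zero[of w] n(2)] by (simp only: c_def)
    obtain d1 where d1: "d1 > 0" "\<And>y. norm (y - x) < d1 \<Longrightarrow> \<bar>F y - F x - G \<bullet> (y - x)\<bar> \<le> e / c * norm (y - x)"
      using F[unfolded has_derivative_at_alt] \<open>e > 0\<close> c by (metis divide_pos_pos real_norm_def)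
    obtain d2 where d2: "d2 > 0" "ball x d2 \<subseteq> U" using U open_contains_ball by blast
    show ?thesis
    proof (intro exI conjI allI impI)
      show "0 < min d1 d2 / c" using d1 d2 c by simp
      fix t s assume ts: "\<bar>t\<bar> < min d1 d2 / c \<and> \<bar>s\<bar> \<le> \<bar>t\<bar>"
      define y where "y = x + t *\<^sub>R w + s *\<^sub>R G"
      have "norm (y - x) \<le> norm (t *\<^sub>R w) + norm (s *\<^sub>R G)"
        using norm_triangle_ineq[of "t *\<^sub>R w" "s *\<^sub>R G"] by (simp add: y_def)
      also have "\<dots> \<le> \<bar>t\<bar> * c" using ts mult_right_mono[of "\<bar>s\<bar>" "\<bar>t\<bar>" "norm G"] by (simp add: c_def algebra_simps)
      finally have y: "norm (y - x) \<le> \<bar>t\<bar> * c" .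
      moreover have "\<bar>t\<bar> * c < min d1 d2" using ts c by (simp add: pos_less_divide_eq)
      ultimately have "norm (y - x) < d1" "norm (y - x) < d2" by auto
      then have "y \<in> U" using d2 by (auto simp: dist_norm norm_minus_commute)
      moreover have "G \<bullet> (y - x) = s * (G \<bullet> G)" using w by (simp add: y_def inner_add_right)
      moreover have "e / c * norm (y - x) \<le> e * \<bar>t\<bar>"
        using mult_left_mono[OF y, of "e / c"] c \<open>e > 0\<close> by simp
      ultimately show "x + t *\<^sub>R w + s *\<^sub>R G \<in> U"
        "\<bar>F (x + t *\<^sub>R w + s *\<^sub>R G) - s * (G \<bullet> G)\<bar> \<le> e * \<bar>t\<bar>"
        using d1(2)[OF \<open>norm (y - x) < d1\<close>] Fx by (auto simp: y_def)
    qed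
  qed
  \<comment> \<open>The choice \<open>e = G \<bullet> G\<close> makes the error at most the size of
    the linear part at \<open>s = - \<bar>t\<bar>\<close> and \<open>s = \<bar>t\<bar>\<close>, so
    \<open>F\<close> has opposite weak signs there.\<close>
  obtain d where d: "d > 0" "\<And>t s. \<bar>t\<bar> < d \<Longrightarrow> \<bar>s\<bar> \<le> \<bar>t\<bar> \<Longrightarrow> x + t *\<^sub>R w + s *\<^sub>R G \<in> U"
    "\<And>t s. \<bar>t\<bar> < d \<Longrightarrow> \<bar>s\<bar> \<le> \<bar>t\<bar> \<Longrightarrow> \<bar>F (x + t *\<^sub>R w + s *\<^sub>R G) - s * (G \<bullet> G)\<bar> \<le> (G \<bullet> G) * \<bar>t\<bar>"
    using est[of "G \<bullet> G"] n by metis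
  have root: "\<exists>s. \<bar>s\<bar> \<le> \<bar>t\<bar> \<and> F (x + t *\<^sub>R w + s *\<^sub>R G) = 0" if t: "\<bar>t\<bar> < d" for t
  proof -
    have "\<exists>s. -\<bar>t\<bar> \<le> s \<and> s \<le> \<bar>t\<bar> \<and> F (x + t *\<^sub>R w + s *\<^sub>R G) = 0"
    proof (rule IVT')
      show "F (x + t *\<^sub>R w + (- \<bar>t\<bar>) *\<^sub>R G) \<le> 0" using d(3)[OF t, of "-\<bar>t\<bar>"] by (simp add: algebra_simps abs_le_iff)
      show "0 \<le> F (x + t *\<^sub>R w + \<bar>t\<bar> *\<^sub>R G)" using d(3)[OF t, of "\<bar>t\<bar>"] by (simp add: algebra_simps abs_le_iff)
      show "continuous_on {-\<bar>t\<bar>..\<bar>t\<bar>} (\<lambda>s. F (x + t *\<^sub>R w + s *\<^sub>R G))"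
        by (rule continuous_on_compose2[OF cont]) (use d(2)[OF t] in \<open>auto intro!: continuous_intros\<close>)
    qed auto
    then show ?thesis by (auto simp: abs_le_iff)
  qed
  then obtain s where s: "\<And>t. \<bar>t\<bar> < d \<Longrightarrow> \<bar>s t\<bar> \<le> \<bar>t\<bar>" "\<And>t. \<bar>t\<bar> < d \<Longrightarrow> F (x + t *\<^sub>R w + s t *\<^sub>R G) = 0"
    by metis
  define \<gamma> where "\<gamma> t = x + t *\<^sub>R w + s t *\<^sub>R G" for t
  have s0: "s 0 = 0" using s(1)[of 0] d by simp
  have "(\<gamma> has_derivative (\<lambda>h. h *\<^sub>R w)) (at 0)"
    unfolding has_derivative_at_alt
  proof (intro conjI allI impI)
    show "bounded_linear (\<lambda>h. h *\<^sub>R w)" by (rule bounded_linear_scaleR_left)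
    fix e :: real assume e: "e > 0"
    \<comment> \<open>Calibrated so that
      \<open>\<bar>s t\<bar> * (G \<bullet> G) \<le> e' * \<bar>t\<bar>\<close> turns into
      \<open>\<bar>s t\<bar> * norm G \<le> e * \<bar>t\<bar>\<close>.\<close>
    define e' where "e' = e * (G \<bullet> G) / norm G"
    have e': "e' > 0" using e n by (simp add: e'_def)
    obtain d' where d': "d' > 0"
      "\<And>t s. \<bar>t\<bar> < d' \<Longrightarrow> \<bar>s\<bar> \<le> \<bar>t\<bar> \<Longrightarrow> \<bar>F (x + t *\<^sub>R w + s *\<^sub>R G) - s * (G \<bullet> G)\<bar> \<le> e' * \<bar>t\<bar>"
      using est[OF e'] by metis
    have "norm (\<gamma> t - \<gamma> 0 - (t - 0) *\<^sub>R w) \<le> e * norm (t - 0)" if t: "norm (t - 0) < min d d'" for t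
    proof -
      have t1: "\<bar>t\<bar> < d" "\<bar>t\<bar> < d'" using t by auto
      have "\<bar>s t * (G \<bullet> G)\<bar> \<le> e' * \<bar>t\<bar>" using d'(2)[OF t1(2) s(1)[OF t1(1)]] s(2)[OF t1(1)] by simp
      then have "\<bar>s t\<bar> * (G \<bullet> G) \<le> e' * \<bar>t\<bar>" using n by (simp add: abs_mult)
      then have "\<bar>s t\<bar> * norm G \<le> e * \<bar>t\<bar>" using n by (simp add: e'_def field_simps)
      then show ?thesis by (simp add: \<gamma>_def s0)
    qed
    then show "\<exists>d>0. \<forall>t. norm (t - 0) < d \<longrightarrow> norm (\<gamma> t - \<gamma> 0 - (t - 0) *\<^sub>R w) \<le> e * norm (t - 0)"
      using d d' by (intro exI[of _ "min d d'"]) auto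
  qed
  moreover have "\<gamma> t \<in> S" if "\<bar>t\<bar> < d" for t
  proof -
    have "\<gamma> t \<in> U" using d(2) s(1) that by (auto simp: \<gamma>_def)
    then show ?thesis using s(2)[OF that] S by (auto simp: \<gamma>_def)
  qed
  moreover have "\<gamma> 0 = x" by (simp add: \<gamma>_def s0)
  ultimately show "w \<in> tangent_space S x"
    unfolding tangent_space_def has_vector_derivative_def using d(1) by blast
qed

lemma orthogonal_to_complement:
  fixes v G :: "'a::euclidean_space"
  assumes "\<And>w. G \<bullet> w = 0 \<Longrightarrow> v \<bullet> w = 0" "G \<noteq> 0"
  shows "v = ((v \<bullet> G) / (G \<bullet> G)) *\<^sub>R G"
proof -
  define w where "w = v - ((v \<bullet> G) / (G \<bullet> G)) *\<^sub>R G"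
  have "G \<bullet> w = 0" using assms(2) by (simp add: w_def inner_diff_right inner_commute)
  moreover from this have "v \<bullet> w = 0" by (rule assms(1))
  ultimately have "w \<bullet> w = 0" by (simp add: w_def inner_diff_left)
  then show ?thesis by (simp add: w_def)
qed

text \<open>Serves both the uniqueness of the outer normal and the comparison of an arbitrary unit
  normal field of a level set with the normalised gradient; in both cases the sign is settled
  separately.\<close>

lemma unit_orthogonal_to_complement:
  fixes v G :: "'a::euclidean_space"
  assumes "\<And>w. G \<bullet> w = 0 \<Longrightarrow> v \<bullet> w = 0" "G \<noteq> 0" "norm v = 1"
  shows "v = G /\<^sub>R norm G \<or> v = - (G /\<^sub>R norm G)"
proof -
  define c where "c = (v \<bullet> G) / (G \<bullet> G)"
  have v: "v = c *\<^sub>R G" unfolding c_def by (rule orthogonal_to_complement[OF assms(1,2)])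
  then have "\<bar>c\<bar> * norm G = 1" using assms(3) by (metis norm_scaleR)
  then have "\<bar>c\<bar> = inverse (norm G)" using assms(2) by (simp add: field_simps)
  then have "c = inverse (norm G) \<or> c = - inverse (norm G)" by linarith
  then show ?thesis using v by auto
qed

section \<open>Defining function and outer normal in a boundary chart\<close>

locale graph_chart =
  fixes \<Omega> :: "(real^'n) set" and x\<^sub>0 :: "real^'n" and r :: real and i :: 'n
    and g :: "real^'n \<Rightarrow> real" and s :: real
  assumes open_domain: "open \<Omega>" and r_pos: "r > 0" and sign: "s \<in> {-1, 1}"
    and smooth: "smooth_function g" and indep: "indep_coord i g"
    and graph: "\<Omega> \<inter> ball x\<^sub>0 r = {x \<in> ball x\<^sub>0 r. 0 < s * (x $ i - g x)}"
begin

text \<open>The defining function of the chart. Absorbing \<open>s\<close> makes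
  \<open>\<Phi> > 0\<close> the inner side for both orientations, so \<open>- D\<Phi>\<close> points
  outward in either case.\<close>

definition \<Phi> :: "real^'n \<Rightarrow> real" where "\<Phi> x = s * (x $ i - g x)"

definition D\<Phi> :: "real^'n \<Rightarrow> real^'n" where "D\<Phi> x = s *\<^sub>R (axis i 1 - grad UNIV g x)"

lemma g_C1: "C1_closure UNIV g (grad UNIV g)"
  using smooth Ck_closure_1[OF open_UNIV, of g] unfolding smooth_function_def by blast

lemma g_C2: "C1_closure UNIV (\<lambda>x. grad UNIV g x $ j) (grad UNIV (pd UNIV j g))"
  using smooth Ck_closure_2[OF open_UNIV, of g] unfolding smooth_function_def grad_def by simp

lemma s_sq: "s * s = 1" "\<bar>s\<bar> = 1" "s \<noteq> 0" using sign by auto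

lemma g_has_derivative: "(g has_derivative (\<lambda>v. grad UNIV g x \<bullet> v)) (at x)"
  using C1_closureD(3)[OF g_C1] by simp

lemma continuous_on_g: "continuous_on S g" "continuous_on S (grad UNIV g)"
  using C1_closureD(1,2)[OF g_C1] continuous_on_subset by auto

lemma \<Phi>_has_derivative: "(\<Phi> has_derivative (\<lambda>v. D\<Phi> x \<bullet> v)) (at x)"
  unfolding \<Phi>_def[abs_def] D\<Phi>_def
  by (auto intro!: derivative_eq_intros g_has_derivative bounded_linear_imp_has_derivative bounded_linear_vec_nth
      simp: inner_diff_left inner_axis' algebra_simps)

lemma continuous_on_\<Phi>: "continuous_on S \<Phi>" "continuous_on S D\<Phi>"
  unfolding \<Phi>_def[abs_def] D\<Phi>_def[abs_def] by (intro continuous_intros continuous_on_g)+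

lemma g_shift: "g (x + t *\<^sub>R axis i 1) = g x"
  using indep unfolding indep_coord_def by (auto simp: axis_def)

lemma grad_g_i: "grad UNIV g x $ i = 0"
proof -
  have "((\<lambda>t. g (x + t *\<^sub>R axis i 1)) has_real_derivative (grad UNIV g x \<bullet> axis i 1)) (at 0)"
    by (rule has_derivative_line) (simp add: g_has_derivative)
  then show ?thesis unfolding g_shift using DERIV_unique[OF _ DERIV_const] by (simp add: inner_axis)
qed

lemma \<Phi>_shift: "\<Phi> (x + t *\<^sub>R axis i 1) = \<Phi> x + s * t"
  by (simp add: \<Phi>_def g_shift algebra_simps)

text \<open>The gradient of \<open>g\<close> is orthogonal to the i-th axis, so the squares add up.
  The right-hand side is the area element of the graph, which links \<open>D\<Phi>\<close> to the
  surface measure as well as to the normal.\<close>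

lemma norm_D\<Phi>: "norm (D\<Phi> x) = sqrt (1 + (norm (grad UNIV g x))\<^sup>2)"
proof -
  have "(norm (D\<Phi> x))\<^sup>2 = (axis i 1 - grad UNIV g x) \<bullet> (axis i 1 - grad UNIV g x)"
    using s_sq by (simp add: D\<Phi>_def power_mult_distrib power2_norm_eq_inner[symmetric])
  also have "\<dots> = 1 + (norm (grad UNIV g x))\<^sup>2"
    by (simp add: inner_diff_left inner_diff_right inner_axis inner_axis' grad_g_i power2_norm_eq_inner)
  finally show ?thesis by (metis norm_ge_zero real_sqrt_abs abs_of_nonneg)
qed

lemma norm_D\<Phi>_pos: "norm (D\<Phi> x) > 0" "D\<Phi> x \<noteq> 0"
proof -
  have "0 < 1 + (norm (grad UNIV g x))\<^sup>2" by (simp add: add_pos_nonneg)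
  then show "norm (D\<Phi> x) > 0" unfolding norm_D\<Phi> by simp
  then show "D\<Phi> x \<noteq> 0" by auto
qed

lemma in_domain_iff: "x \<in> ball x\<^sub>0 r \<Longrightarrow> x \<in> \<Omega> \<longleftrightarrow> \<Phi> x > 0"
  using graph unfolding \<Phi>_def by blast

text \<open>Moving by \<open>s * d\<close> along the i-th axis raises \<open>\<Phi>\<close> by
  \<open>d\<close>, so a point of the chart with \<open>\<Phi> x = 0\<close> is a limit of points of
  \<open>\<Omega>\<close>.\<close>

lemma in_closure_iff:
  assumes x: "x \<in> ball x\<^sub>0 r"
  shows "x \<in> closure \<Omega> \<longleftrightarrow> \<Phi> x \<ge> 0"
proof
  assume "x \<in> closure \<Omega>"
  then have "x \<in> closure (\<Omega> \<inter> ball x\<^sub>0 r)"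
    using x open_Int_closure_subset[OF open_ball, of x\<^sub>0 r \<Omega>] by (auto simp: Int_commute)
  also have "\<dots> \<subseteq> closure {x. \<Phi> x \<ge> 0}" by (rule closure_mono) (use in_domain_iff in fastforce)
  also have "\<dots> = {x. \<Phi> x \<ge> 0}"
    by (rule closure_closed) (intro closed_Collect_le continuous_intros continuous_on_\<Phi>)
  finally show "\<Phi> x \<ge> 0" by simp
next
  assume p: "\<Phi> x \<ge> 0"
  show "x \<in> closure \<Omega>"
    unfolding closure_approachable
  proof (intro allI impI)
    fix e :: real assume e: "e > 0"
    define d where "d = min e (r - dist x\<^sub>0 x) / 2"
    have d: "d > 0" "d < e" "dist x\<^sub>0 x + d < r" using e x by (auto simp: d_def min_def field_simps)
    define y where "y = x + (s * d) *\<^sub>R axis i 1"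
    have dy: "dist y x = d" using d s_sq by (simp add: y_def dist_norm abs_mult)
    then have "y \<in> ball x\<^sub>0 r" using d dist_triangle[of x\<^sub>0 y x] by (simp add: dist_commute)
    moreover have "\<Phi> y > 0" using p d s_sq by (simp add: y_def \<Phi>_shift mult.assoc[symmetric] add_nonneg_pos)
    ultimately have "y \<in> \<Omega>" using in_domain_iff by blast
    then show "\<exists>y\<in>\<Omega>. dist y x < e" using dy d by auto
  qed
qed

lemma in_frontier_iff:
  assumes "x \<in> ball x\<^sub>0 r"
  shows "x \<in> frontier \<Omega> \<longleftrightarrow> \<Phi> x = 0"
  using in_domain_iff[OF assms] in_closure_iff[OF assms] open_domain
  by (auto simp: frontier_def interior_open)

lemma frontier_graph: "frontier \<Omega> \<inter> ball x\<^sub>0 r = {x \<in> ball x\<^sub>0 r. x $ i = g x}"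
  using in_frontier_iff s_sq by (auto simp: \<Phi>_def)

lemma tangent_space_frontier:
  assumes "x \<in> frontier \<Omega> \<inter> ball x\<^sub>0 r"
  shows "tangent_space (frontier \<Omega>) x = {w. D\<Phi> x \<bullet> w = 0}"
  by (rule tangent_space_level_set[where U = "ball x\<^sub>0 r" and F = \<Phi>])
    (use assms in_frontier_iff norm_D\<Phi>_pos \<Phi>_has_derivative continuous_on_\<Phi> in auto)

text \<open>Orthogonality to the tangent space leaves two opposite unit vectors, and the sign of the
  derivative of \<open>\<Phi>\<close> along them excludes one. The uniqueness is what gives
  \<open>THE\<close> in \<open>outer_normal\<close> its value.\<close>

lemma outer_normal_eq:
  assumes x: "x \<in> frontier \<Omega> \<inter> ball x\<^sub>0 r"
  shows "outer_normal \<Omega> x = - (D\<Phi> x /\<^sub>R norm (D\<Phi> x))"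
proof -
  let ?N = "D\<Phi> x /\<^sub>R norm (D\<Phi> x)"
  have "open (ball x\<^sub>0 r)" "x \<in> ball x\<^sub>0 r" using x by auto
  have small: "\<exists>\<epsilon>>0. \<forall>t. 0 < t \<and> t < \<epsilon> \<longrightarrow> x + t *\<^sub>R w \<in> ball x\<^sub>0 r" if "norm w = 1" for w
  proof (intro exI conjI allI impI)
    show "r - dist x\<^sub>0 x > 0" using x by simp
    fix t assume "0 < t \<and> t < r - dist x\<^sub>0 x"
    then show "x + t *\<^sub>R w \<in> ball x\<^sub>0 r"
      using dist_triangle[of x\<^sub>0 "x + t *\<^sub>R w" x] that by (simp add: dist_norm)
  qed
  have Nn: "norm ?N = 1" "norm (- ?N) = 1" using norm_D\<Phi>_pos[of x] by auto
  have ND: "D\<Phi> x \<bullet> ?N > 0" using norm_D\<Phi>_pos[of x] by auto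
  have x0: "\<Phi> x = 0" using x in_frontier_iff by blast
  obtain e1 where e1: "e1 > 0" "\<And>t. 0 < t \<Longrightarrow> t < e1 \<Longrightarrow> \<Phi> (x + t *\<^sub>R ?N) > 0"
    using increases_along[OF \<Phi>_has_derivative ND] x0 by auto
  have "((\<lambda>x. - \<Phi> x) has_derivative (\<lambda>v. (- D\<Phi> x) \<bullet> v)) (at x)"
    using has_derivative_minus[OF \<Phi>_has_derivative] by simp
  from increases_along[OF this, of "- ?N"] ND x0
  obtain e2 where e2: "e2 > 0" "\<And>t. 0 < t \<Longrightarrow> t < e2 \<Longrightarrow> \<Phi> (x + t *\<^sub>R - ?N) < 0" by auto
  obtain e3 where e3: "e3 > 0" "\<And>t. 0 < t \<Longrightarrow> t < e3 \<Longrightarrow> x + t *\<^sub>R ?N \<in> ball x\<^sub>0 r"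
    using small[OF Nn(1)] by auto
  obtain e4 where e4: "e4 > 0" "\<And>t. 0 < t \<Longrightarrow> t < e4 \<Longrightarrow> x + t *\<^sub>R - ?N \<in> ball x\<^sub>0 r"
    using small[OF Nn(2)] by auto
  define e where "e = min (min e1 e2) (min e3 e4)"
  have e: "e > 0" using e1 e2 e3 e4 by (simp add: e_def)
  have dir: "x + t *\<^sub>R ?N \<in> \<Omega>" "x + t *\<^sub>R - ?N \<notin> closure \<Omega>" if "0 < t" "t < e" for t
    using that e1(2)[of t] e2(2)[of t] e3(2)[of t] e4(2)[of t] in_domain_iff[of "x + t *\<^sub>R ?N"]
      in_closure_iff[of "x + t *\<^sub>R - ?N"] unfolding e_def by auto
  have "is_outer_normal \<Omega> x (- ?N)"
    unfolding is_outer_normal_def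
  proof (intro conjI)
    show "norm (- ?N) = 1" by (rule Nn)
    show "\<forall>w\<in>tangent_space (frontier \<Omega>) x. - ?N \<bullet> w = 0"
      using tangent_space_frontier[OF x] by auto
    show "\<exists>\<epsilon>>0. \<forall>t. 0 < t \<and> t < \<epsilon> \<longrightarrow> x - t *\<^sub>R - ?N \<in> \<Omega> \<and> x + t *\<^sub>R - ?N \<notin> closure \<Omega>"
      using dir e by (intro exI[of _ e]) simp
  qed
  moreover have "v = - ?N" if v: "is_outer_normal \<Omega> x v" for v
  proof -
    have "v = ?N \<or> v = - ?N"
      by (rule unit_orthogonal_to_complement)
        (use v tangent_space_frontier[OF x] norm_D\<Phi>_pos in \<open>auto simp: is_outer_normal_def\<close>)
    moreover have "v \<noteq> ?N"
    proof
      assume vN: "v = ?N"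
      obtain e' where e': "e' > 0" "\<And>t. 0 < t \<Longrightarrow> t < e' \<Longrightarrow> x - t *\<^sub>R v \<in> \<Omega>"
        using v by (auto simp: is_outer_normal_def)
      define t where "t = min e e' / 2"
      have t: "0 < t" "t < e" "t < e'" using e e' by (auto simp: t_def min_def)
      then have "x + t *\<^sub>R - ?N \<in> \<Omega>" using e'(2)[of t] vN by simp
      then show False using dir(2)[of t] t closure_subset by auto
    qed
    ultimately show ?thesis by blast
  qed
  ultimately show ?thesis unfolding outer_normal_def by (rule the_equality)
qed

end

subsection \<open>Graph coordinates\<close>

text \<open>Differentiability is asked for only strictly between the end points, because the
  starting point may lie on the boundary, where only continuity is known.\<close>

lemma mvt_line:
  fixes F :: "real^'n \<Rightarrow> real"
  assumes "0 < t" and T: "\<And>\<tau>. 0 \<le> \<tau> \<Longrightarrow> \<tau> \<le> t \<Longrightarrow> x + \<tau> *\<^sub>R w \<in> T" "continuous_on T F"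
    and d: "\<And>\<tau>. 0 < \<tau> \<Longrightarrow> \<tau> < t \<Longrightarrow> (F has_derivative (\<lambda>v. G (x + \<tau> *\<^sub>R w) \<bullet> v)) (at (x + \<tau> *\<^sub>R w))"
  obtains \<tau> where "0 < \<tau>" "\<tau> < t" "F (x + t *\<^sub>R w) - F x = t * (G (x + \<tau> *\<^sub>R w) \<bullet> w)"
proof -
  have der: "((\<lambda>t. F (x + t *\<^sub>R w)) has_real_derivative (G (x + \<tau> *\<^sub>R w) \<bullet> w)) (at \<tau>)" if "0 < \<tau>" "\<tau> < t" for \<tau>
    using has_derivative_line[OF d[OF that]] .
  have "\<exists>l z. 0 < z \<and> z < t \<and> ((\<lambda>t. F (x + t *\<^sub>R w)) has_real_derivative l) (at z) \<and>
      F (x + t *\<^sub>R w) - F (x + 0 *\<^sub>R w) = (t - 0) * l"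
  proof (rule MVT[OF \<open>0 < t\<close>])
    show "continuous_on {0..t} (\<lambda>t. F (x + t *\<^sub>R w))"
      by (rule continuous_on_compose2[OF T(2)]) (use T(1) in \<open>auto intro!: continuous_intros\<close>)
    show "(\<lambda>t. F (x + t *\<^sub>R w)) differentiable (at z)" if "0 < z" "z < t" for z
      using der[OF that] real_differentiable_def by blast
  qed
  then obtain l z where "0 < z" "z < t" "((\<lambda>t. F (x + t *\<^sub>R w)) has_real_derivative l) (at z)"
    "F (x + t *\<^sub>R w) - F x = t * l" by auto
  then show thesis using that der DERIV_unique by metis
qed

section \<open>Lebesgue measure along the fibres over a hyperplane\<close>

abbreviation hyperplane_measure :: "'n \<Rightarrow> ('n::finite \<Rightarrow> real) measure" where
  "hyperplane_measure i \<equiv> Pi\<^sub>M (UNIV - {i}) (\<lambda>_. lborel)"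

lemma sigma_finite_hyperplane_measure: "sigma_finite_measure (hyperplane_measure i)"
proof -
  interpret product_sigma_finite "\<lambda>_. lborel :: real measure" by standard
  show ?thesis by (rule sigma_finite) simp
qed

lemma pair_sigma_finite_hyperplane:
  "pair_sigma_finite (hyperplane_measure i) (lborel :: real measure)"
  by (intro pair_sigma_finite.intro sigma_finite_hyperplane_measure lborel.sigma_finite_measure_axioms)

lemma measurable_hyperplane_pt [measurable]:
  fixes i :: "'n::finite"
  shows "hyperplane_pt i \<in> borel_measurable (hyperplane_measure i)"
proof (rule borel_measurable_euclidean_space[THEN iffD2], rule ballI)
  fix b :: "real^'n" assume "b \<in> Basis"
  then obtain j where b: "b = axis j 1" by (auto simp: Basis_vec_def)
  have "(\<lambda>y. if j = i then 0 else y j) \<in> borel_measurable (hyperplane_measure i)"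
    using measurable_component_singleton[of j "UNIV - {i}" "\<lambda>_. lborel :: real measure"]
    by (cases "j = i") (simp_all add: measurable_lborel2)
  then show "(\<lambda>y. hyperplane_pt i y \<bullet> b) \<in> borel_measurable (hyperplane_measure i)"
    by (simp add: b inner_axis hyperplane_pt_def)
qed

abbreviation graph_coords :: "'n::finite \<Rightarrow> ('n \<Rightarrow> real) \<times> real \<Rightarrow> real^'n" where
  "graph_coords i \<equiv> \<lambda>(y, z). hyperplane_pt i y + z *\<^sub>R axis i 1"

lemma measurable_graph_coords [measurable]:
  "graph_coords i \<in> borel_measurable (hyperplane_measure i \<Otimes>\<^sub>M lborel)"
  by measurable

text \<open>Open boxes determine Lebesgue measure, and splitting off the i-th coordinate turns a box
  into the product of a box in the hyperplane and an interval.\<close>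

lemma lborel_graph_coords:
  fixes i :: "'n::finite"
  shows "lborel = distr (hyperplane_measure i \<Otimes>\<^sub>M lborel) borel (graph_coords i)"
proof (rule lborel_eqI)
  interpret product_sigma_finite "\<lambda>_. lborel :: real measure" by standard
  interpret P: sigma_finite_measure "hyperplane_measure i" by (rule sigma_finite_hyperplane_measure)
  fix l u :: "real^'n"
  assume lu: "\<And>b. b \<in> Basis \<Longrightarrow> l \<bullet> b \<le> u \<bullet> b"
  have lu': "l $ j \<le> u $ j" for j
    using lu[of "axis j 1"] by (simp add: inner_axis)
  define A where "A = Pi\<^sub>E (UNIV - {i}) (\<lambda>j. {l $ j<..<u $ j})"
  have A: "A \<in> sets (hyperplane_measure i)"
    unfolding A_def by (rule sets_PiM_I_finite) auto
  have "graph_coords i -` box l u \<inter> space (hyperplane_measure i \<Otimes>\<^sub>M lborel) = A \<times> {l $ i<..<u $ i}"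
    unfolding A_def
  proof (intro set_eqI iffI)
    fix p assume "p \<in> graph_coords i -` box l u \<inter> space (hyperplane_measure i \<Otimes>\<^sub>M lborel)"
    then show "p \<in> Pi\<^sub>E (UNIV - {i}) (\<lambda>j. {l $ j<..<u $ j}) \<times> {l $ i<..<u $ i}"
      by (auto simp: space_pair_measure space_PiM mem_box_cart hyperplane_pt_def axis_def PiE_def Pi_def split: if_splits)
  next
    fix p assume "p \<in> Pi\<^sub>E (UNIV - {i}) (\<lambda>j. {l $ j<..<u $ j}) \<times> {l $ i<..<u $ i}"
    then show "p \<in> graph_coords i -` box l u \<inter> space (hyperplane_measure i \<Otimes>\<^sub>M lborel)"
      by (auto simp: space_pair_measure space_PiM mem_box_cart hyperplane_pt_def axis_def PiE_def Pi_def)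
  qed
  then have "emeasure (distr (hyperplane_measure i \<Otimes>\<^sub>M lborel) borel (graph_coords i)) (box l u)
      = emeasure (hyperplane_measure i \<Otimes>\<^sub>M lborel) (A \<times> {l $ i<..<u $ i})"
    by (subst emeasure_distr) auto
  also have "\<dots> = emeasure (hyperplane_measure i) A * emeasure lborel {l $ i<..<u $ i}"
    using A by (intro lborel.emeasure_pair_measure_Times) auto
  also have "emeasure (hyperplane_measure i) A = (\<Prod>j\<in>UNIV - {i}. emeasure lborel {l $ j<..<u $ j})"
    unfolding A_def by (rule emeasure_PiM) auto
  also have "\<dots> = (\<Prod>j\<in>UNIV - {i}. ennreal (u $ j - l $ j))" using lu' by simp
  also have "\<dots> * emeasure lborel {l $ i<..<u $ i} = (\<Prod>j\<in>UNIV. ennreal (u $ j - l $ j))"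
    using lu' by (simp add: prod.remove[of UNIV i] mult.commute)
  also have "\<dots> = ennreal (\<Prod>j\<in>UNIV. u $ j - l $ j)" using lu' by (simp add: prod_ennreal)
  also have "(\<Prod>j\<in>UNIV. u $ j - l $ j) = (\<Prod>b\<in>Basis. (u - l) \<bullet> b)"
  proof -
    have "(\<Prod>b\<in>Basis. (u - l) \<bullet> b) = (\<Prod>b\<in>(\<lambda>j. axis j 1) ` UNIV. (u - l) \<bullet> b)"
      by (rule prod.cong) (auto simp: Basis_vec_def)
    also have "\<dots> = (\<Prod>j\<in>UNIV. (u - l) \<bullet> axis j 1)"
      by (subst prod.reindex) (auto simp: inj_on_def axis_eq_axis)
    finally show ?thesis by (simp add: inner_axis)
  qed
  finally show "emeasure (distr (hyperplane_measure i \<Otimes>\<^sub>M lborel) borel (graph_coords i)) (box l u)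
      = ennreal (\<Prod>b\<in>Basis. (u - l) \<bullet> b)" .
qed simp

lemma integral_graph_coords:
  fixes F :: "real^'n \<Rightarrow> real"
  assumes F: "integrable lborel F"
  shows "(\<integral>y. (\<integral>z. F (hyperplane_pt i y + z *\<^sub>R axis i 1) \<partial>lborel) \<partial>hyperplane_measure i) = integral\<^sup>L lborel F"
proof -
  interpret pair_sigma_finite "hyperplane_measure i" "lborel :: real measure"
    by (rule pair_sigma_finite_hyperplane)
  have [measurable]: "F \<in> borel_measurable borel" using borel_measurable_integrable[OF F] by simp
  have "integrable (hyperplane_measure i \<Otimes>\<^sub>M lborel) (\<lambda>p. F (graph_coords i p))"
    using F by (subst (asm) lborel_graph_coords[of i], subst (asm) integrable_distr_eq) auto
  then have i: "integrable (hyperplane_measure i \<Otimes>\<^sub>M lborel) (\<lambda>(y, z). F (hyperplane_pt i y + z *\<^sub>R axis i 1))"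
    by (simp add: case_prod_beta')
  have "(\<integral>y. (\<integral>z. F (hyperplane_pt i y + z *\<^sub>R axis i 1) \<partial>lborel) \<partial>hyperplane_measure i)
      = integral\<^sup>L (hyperplane_measure i \<Otimes>\<^sub>M lborel) (\<lambda>(y, z). F (hyperplane_pt i y + z *\<^sub>R axis i 1))"
    by (rule integral_fst[OF i])
  also have "\<dots> = integral\<^sup>L (hyperplane_measure i \<Otimes>\<^sub>M lborel) (\<lambda>p. F (graph_coords i p))"
    by (simp add: case_prod_beta')
  also have "\<dots> = integral\<^sup>L lborel F"
    by (subst lborel_graph_coords[of i], subst integral_distr) auto
  finally show ?thesis .
qed

text \<open>This set is the fibre of the boundary layer over a point of the hyperplane. It lies
  above the graph for \<open>s = 1\<close> and below it for \<open>s = -1\<close>; a negative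
  \<open>\<theta>\<close> gives the empty set, hence \<open>max 0\<close>.\<close>

lemma fiber_interval:
  fixes s \<theta> a :: real
  assumes "s \<in> {-1, 1}"
  shows "{z. 0 < s * (z - a) \<and> s * (z - a) \<le> \<theta>} \<in> sets lborel"
    "emeasure lborel {z. 0 < s * (z - a) \<and> s * (z - a) \<le> \<theta>} = ennreal (max 0 \<theta>)"
    "measure lborel {z. 0 < s * (z - a) \<and> s * (z - a) \<le> \<theta>} = max 0 \<theta>"
proof -
  let ?I = "{z. 0 < s * (z - a) \<and> s * (z - a) \<le> \<theta>}"
  consider "s = 1" | "s = -1" using assms by auto
  then have I: "?I \<in> sets lborel \<and> emeasure lborel ?I = ennreal (max 0 \<theta>)"
  proof cases
    case 1
    then have "?I = {a<..a + \<theta>}" by auto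
    then show ?thesis by (auto simp: max_def emeasure_lborel_Ioc)
  next
    case 2
    then have I: "?I = {a - \<theta>..<a}" by auto
    show ?thesis unfolding I by (cases "\<theta> \<ge> 0") (auto simp: max_def emeasure_lborel_Ico)
  qed
  then show "?I \<in> sets lborel" "emeasure lborel ?I = ennreal (max 0 \<theta>)" by auto
  then show "measure lborel ?I = max 0 \<theta>" by (simp add: measure_def)
qed

lemma fiber_average_bound:
  fixes K :: "real \<Rightarrow> real"
  assumes s: "s \<in> {-1, 1}" and K: "K \<in> borel_measurable borel"
    and B: "\<And>z. 0 < s * (z - a) \<Longrightarrow> s * (z - a) \<le> \<theta> \<Longrightarrow> \<bar>K z\<bar> \<le> B"
  shows "integrable lborel (\<lambda>z. indicator {z. 0 < s * (z - a) \<and> s * (z - a) \<le> \<theta>} z * K z)"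
    "\<bar>\<integral>z. indicator {z. 0 < s * (z - a) \<and> s * (z - a) \<le> \<theta>} z * K z \<partial>lborel\<bar> \<le> B * max 0 \<theta>"
proof -
  let ?I = "{z. 0 < s * (z - a) \<and> s * (z - a) \<le> \<theta>}"
  note I = fiber_interval[OF s, of a \<theta>]
  have ii: "integrable lborel (\<lambda>z. indicator ?I z :: real)"
    using I by (simp add: integrable_indicator_iff)
  then have iB: "integrable lborel (\<lambda>z. B * indicator ?I z)" by simp
  have le: "norm (indicator ?I z * K z) \<le> B * indicator ?I z" for z
    using B[of z] by (auto simp: indicator_def)
  have m: "(\<lambda>z. indicator ?I z * K z) \<in> borel_measurable lborel"
    using K I(1) by (intro borel_measurable_times borel_measurable_indicator) auto
  show *: "integrable lborel (\<lambda>z. indicator ?I z * K z)"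
    by (rule Bochner_Integration.integrable_bound[OF iB m]) (use le in \<open>auto intro!: AE_I2 order_trans[OF _ abs_ge_self]\<close>)
  have "norm (\<integral>z. indicator ?I z * K z \<partial>lborel) \<le> (\<integral>z. norm (indicator ?I z * K z) \<partial>lborel)"
    by (rule integral_norm_bound)
  also have "\<dots> \<le> (\<integral>z. B * indicator ?I z \<partial>lborel)"
    by (rule integral_mono[OF integrable_norm[OF *] iB]) (use le in auto)
  finally show "\<bar>\<integral>z. indicator ?I z * K z \<partial>lborel\<bar> \<le> B * max 0 \<theta>"
    using I by simp
qed

text \<open>Once \<open>\<theta> n\<close> is small, \<open>K\<close> is within \<open>e\<close> of
  its one-sided limit \<open>k\<close> on the whole fibre, and the length of the fibre divided by
  \<open>t n\<close> tends to \<open>max 0 c\<close>.\<close>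

lemma fiber_average_tendsto:
  fixes K :: "real \<Rightarrow> real"
  assumes s: "s \<in> {-1, 1}" and K: "K \<in> borel_measurable borel" "\<And>z. \<bar>K z\<bar> \<le> B"
    and near: "\<And>e. e > 0 \<Longrightarrow> \<exists>d>0. \<forall>z. 0 < s * (z - a) \<and> s * (z - a) < d \<longrightarrow> \<bar>K z - k\<bar> \<le> e"
    and t: "\<And>n. t n > 0" "t \<longlonglongrightarrow> 0" and \<theta>: "(\<lambda>n. \<theta> n / t n) \<longlonglongrightarrow> c"
  shows "(\<lambda>n. (\<integral>z. indicator {z. 0 < s * (z - a) \<and> s * (z - a) \<le> \<theta> n} z * K z \<partial>lborel) / t n) \<longlonglongrightarrow> k * max 0 c"
proof -
  let ?I = "\<lambda>n. {z. 0 < s * (z - a) \<and> s * (z - a) \<le> \<theta> n}"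
  define J where "J n = (\<integral>z. indicator (?I n) z * K z \<partial>lborel) / t n" for n
  define m where "m n = max 0 (\<theta> n / t n)" for n
  have m: "m \<longlonglongrightarrow> max 0 c" unfolding m_def by (intro tendsto_intros \<theta>)
  have m_eq: "m n = max 0 (\<theta> n) / t n" for n
    using t(1)[of n] by (auto simp: m_def max_def field_simps zero_le_divide_iff)
  have "(\<lambda>n. \<theta> n / t n * t n) \<longlonglongrightarrow> c * 0" by (intro tendsto_intros \<theta> t)
  moreover have "\<theta> n / t n * t n = \<theta> n" for n using t(1)[of n] by simp
  ultimately have \<theta>0: "\<theta> \<longlonglongrightarrow> 0" by simp
  have close: "\<forall>\<^sub>F n in sequentially. \<bar>J n - k * m n\<bar> \<le> e * m n" if "e > 0" for e
  proof -
    obtain d where d: "d > 0" "\<And>z. 0 < s * (z - a) \<Longrightarrow> s * (z - a) < d \<Longrightarrow> \<bar>K z - k\<bar> \<le> e"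
      using near[OF \<open>e > 0\<close>] by blast
    have "\<forall>\<^sub>F n in sequentially. \<theta> n < d" using order_tendstoD(2)[OF \<theta>0 d(1)] .
    then show ?thesis
    proof eventually_elim
      case (elim n)
      have "J n - k * m n = ((\<integral>z. indicator (?I n) z * K z \<partial>lborel) - (\<integral>z. indicator (?I n) z * k \<partial>lborel)) / t n"
        using fiber_interval[OF s, of a "\<theta> n"] by (simp add: J_def m_eq diff_divide_distrib)
      also have "(\<integral>z. indicator (?I n) z * K z \<partial>lborel) - (\<integral>z. indicator (?I n) z * k \<partial>lborel)
          = (\<integral>z. indicator (?I n) z * K z - indicator (?I n) z * k \<partial>lborel)"
        by (rule Bochner_Integration.integral_diff[symmetric]; rule fiber_average_bound[OF s]) (use K in auto)
      also have "\<dots> = (\<integral>z. indicator (?I n) z * (K z - k) \<partial>lborel)" by (simp add: right_diff_distrib)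
      finally have "\<bar>J n - k * m n\<bar> = \<bar>\<integral>z. indicator (?I n) z * (K z - k) \<partial>lborel\<bar> / t n"
        using t(1)[of n] by simp
      also have "\<dots> \<le> e * max 0 (\<theta> n) / t n"
        using t(1)[of n] d(2) elim K(1)
        by (intro divide_right_mono fiber_average_bound[OF s]) (auto simp: order.strict_trans1)
      finally show ?case by (simp add: m_eq)
    qed
  qed
  have "(\<lambda>n. J n - k * m n) \<longlonglongrightarrow> 0"
  proof (rule tendstoI)
    fix e :: real assume e: "e > 0"
    \<comment> \<open>Since \<open>m n\<close> is eventually below \<open>max 0 c + 1\<close>, this
      choice turns the error \<open>e' * m n\<close> into one below \<open>e\<close>.\<close>
    define e' where "e' = e / (max 0 c + 1)"
    have e': "e' > 0" using e by (simp add: e'_def max_def)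
    have "\<forall>\<^sub>F n in sequentially. m n < max 0 c + 1" using order_tendstoD(2)[OF m, of "max 0 c + 1"] by simp
    with close[OF e'] show "\<forall>\<^sub>F n in sequentially. dist (J n - k * m n) 0 < e"
    proof eventually_elim
      case (elim n)
      have "e' * m n < e' * (max 0 c + 1)" using elim e' by simp
      also have "\<dots> = e" by (simp add: e'_def max_def)
      finally show ?case using elim by simp
    qed
  qed
  from tendsto_add[OF this tendsto_mult_left[OF m, of k]] show ?thesis
    by (simp add: J_def)
qed

lemma difference_quotient_tendsto:
  fixes F :: "real^'n \<Rightarrow> real"
  assumes F: "(F has_derivative (\<lambda>v. G \<bullet> v)) (at x)" and t: "\<And>n. t n > 0" "t \<longlonglongrightarrow> 0"
  shows "(\<lambda>n. (F (x + t n *\<^sub>R w) - F x) / t n) \<longlonglongrightarrow> G \<bullet> w"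
proof -
  have "((\<lambda>t. F (x + t *\<^sub>R w)) has_real_derivative (G \<bullet> w)) (at 0)"
    by (rule has_derivative_line) (use F in simp)
  then have "((\<lambda>h. (F (x + h *\<^sub>R w) - F x) / h) \<longlongrightarrow> G \<bullet> w) (at 0)"
    by (simp add: DERIV_def)
  moreover have "filterlim t (at 0) sequentially"
    using t by (auto simp: filterlim_at intro!: always_eventually less_imp_neq[symmetric] dest: less_imp_neq)
  ultimately show ?thesis by (rule filterlim_compose)
qed

lemma compact_norm_bound:
  fixes F :: "'a::topological_space \<Rightarrow> 'b::real_normed_vector"
  assumes "compact K" "continuous_on K F"
  obtains B where "B \<ge> 0" "\<And>x. x \<in> K \<Longrightarrow> norm (F x) \<le> B"
proof -
  have "bounded (F ` K)" using compact_continuous_image[OF assms(2,1)] by (rule compact_imp_bounded)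
  then obtain B where "B > 0" "\<forall>y\<in>F ` K. norm y \<le> B" unfolding bounded_pos by blast
  then show thesis using that[of B] by auto
qed

lemma abs_inner_le: "norm a \<le> M \<Longrightarrow> \<bar>a \<bullet> b\<bar> \<le> M * norm b"
  by (rule order_trans[OF Cauchy_Schwarz_ineq2 mult_right_mono]) auto

lemma measurable_graph_pt:
  fixes i :: "'n::finite"
  assumes [measurable]: "g \<in> borel_measurable borel"
  shows "graph_pt i g \<in> borel_measurable (hyperplane_measure i)"
  unfolding graph_pt_def[abs_def] by measurable

section \<open>Surface measure and boundary layer in one chart\<close>

locale surface_chart = graph_chart \<Omega> x\<^sub>0 r i g s
  for \<Omega> :: "(real^'n) set" and x\<^sub>0 r i g s +
  fixes \<sigma> :: "(real^'n) measure"
  assumes surface: "surface_measure (frontier \<Omega>) \<sigma>" and bounded_domain: "bounded \<Omega>"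
begin

abbreviation "gp \<equiv> graph_pt i g"

lemma sets_\<sigma>: "sets \<sigma> = sets borel"
  using surface by (simp add: surface_measure_def)

lemma g_borel [measurable]: "g \<in> borel_measurable borel" and \<Phi>_borel [measurable]: "\<Phi> \<in> borel_measurable borel"
  and D\<Phi>_borel [measurable]: "D\<Phi> \<in> borel_measurable borel"
  by (intro borel_measurable_continuous_onI continuous_on_g continuous_on_\<Phi>)+

lemma gp_measurable [measurable]: "gp \<in> borel_measurable (hyperplane_measure i)"
  by (rule measurable_graph_pt) simp

lemma grad_g_shift: "grad UNIV g (x + t *\<^sub>R axis i 1) = grad UNIV g x"
proof -
  have "((\<lambda>x. x + t *\<^sub>R axis i 1) has_derivative (\<lambda>v. v)) (at x)"
    by (auto intro!: derivative_eq_intros)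
  from has_derivative_compose[OF this g_has_derivative] show ?thesis
    unfolding g_shift by (intro grad_in[symmetric]) auto
qed

lemma D\<Phi>_graph: "D\<Phi> (hyperplane_pt i y + z *\<^sub>R axis i 1) = D\<Phi> (hyperplane_pt i y)"
  by (simp add: D\<Phi>_def grad_g_shift)

lemma D\<Phi>_gp: "D\<Phi> (gp y) = D\<Phi> (hyperplane_pt i y)"
  by (simp add: graph_pt_def D\<Phi>_graph)

lemma \<Phi>_graph: "\<Phi> (hyperplane_pt i y + z *\<^sub>R axis i 1) = s * (z - g (hyperplane_pt i y))"
  unfolding \<Phi>_shift by (simp add: \<Phi>_def hyperplane_pt_def algebra_simps)

lemma \<Phi>_gp: "\<Phi> (gp y) = 0"
  by (simp add: graph_pt_def \<Phi>_graph)

lemma emeasure_surface: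
  assumes "B \<in> sets borel" "B \<subseteq> frontier \<Omega> \<inter> ball x\<^sub>0 r"
  shows "emeasure \<sigma> B = (\<integral>\<^sup>+ y. indicator B (gp y) * ennreal (norm (D\<Phi> (gp y))) \<partial>hyperplane_measure i)"
proof -
  have "emeasure \<sigma> B = (\<integral>\<^sup>+ y. indicator B (graph_pt i g y) *
      ennreal (sqrt (1 + (norm (grad UNIV g (hyperplane_pt i y)))\<^sup>2)) \<partial>hyperplane_measure i)"
    using surface[unfolded surface_measure_def, THEN conjunct2, THEN conjunct2, THEN spec[of _ "ball x\<^sub>0 r"],
        THEN spec[of _ i], THEN spec[of _ g], THEN mp[OF _ open_ball], THEN mp[OF _ smooth], THEN mp[OF _ indep],
        THEN mp[OF _ frontier_graph]] assms by blast
  then show ?thesis by (simp add: D\<Phi>_gp norm_D\<Phi>)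
qed

text \<open>\<open>surface_measure\<close> prescribes only masses of Borel sets inside charts. They
  identify \<open>\<sigma>\<close> restricted to the chart with the image, under the graph map, of
  \<open>norm (D\<Phi>)\<close> times the hyperplane measure; the integral is transported along this
  image.\<close>

lemma surface_integral:
  fixes F :: "real^'n \<Rightarrow> real"
  assumes [measurable]: "F \<in> borel_measurable borel"
    and F0: "\<And>x. x \<in> frontier \<Omega> \<Longrightarrow> x \<notin> ball x\<^sub>0 r \<Longrightarrow> F x = 0"
  shows "(LINT x:frontier \<Omega>|\<sigma>. F x) = (\<integral>y. indicator (ball x\<^sub>0 r) (gp y) * norm (D\<Phi> (gp y)) * F (gp y) \<partial>hyperplane_measure i)"
proof -
  note [measurable_cong] = sets_\<sigma>
  define W where "W = frontier \<Omega> \<inter> ball x\<^sub>0 r"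
  have W [measurable]: "W \<in> sets borel" unfolding W_def by auto
  have gpW: "indicator W (gp y) = (indicator (ball x\<^sub>0 r) (gp y) :: real)" for y
    using in_frontier_iff[of "gp y"] by (auto simp: W_def indicator_def \<Phi>_gp)
  define Q where "Q = density (hyperplane_measure i) (\<lambda>y. ennreal (indicator W (gp y) * norm (D\<Phi> (gp y))))"
  have Q: "sets Q = sets (hyperplane_measure i)" by (simp add: Q_def)
  have eq: "density \<sigma> (\<lambda>x. ennreal (indicator W x)) = distr Q borel gp"
  proof (rule measure_eqI)
    show "sets (density \<sigma> (\<lambda>x. ennreal (indicator W x))) = sets (distr Q borel gp)" by (simp add: sets_\<sigma>)
    fix A assume "A \<in> sets (density \<sigma> (\<lambda>x. ennreal (indicator W x)))"
    then have A [measurable]: "A \<in> sets borel" by (simp add: sets_\<sigma>)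
    have "emeasure (density \<sigma> (\<lambda>x. ennreal (indicator W x))) A = (\<integral>\<^sup>+x. ennreal (indicator W x) * indicator A x \<partial>\<sigma>)"
      by (rule emeasure_density) auto
    also have "\<dots> = (\<integral>\<^sup>+x. indicator (W \<inter> A) x \<partial>\<sigma>)"
      by (rule nn_integral_cong) (auto simp: indicator_def)
    also have "\<dots> = emeasure \<sigma> (W \<inter> A)" by (subst nn_integral_indicator) auto
    also have "\<dots> = (\<integral>\<^sup>+ y. indicator (W \<inter> A) (gp y) * ennreal (norm (D\<Phi> (gp y))) \<partial>hyperplane_measure i)"
      by (rule emeasure_surface) (auto simp: W_def)
    also have "\<dots> = emeasure Q (gp -` A \<inter> space Q)"
      unfolding Q_def
      by (subst emeasure_density)
        (auto intro!: nn_integral_cong measurable_sets[OF gp_measurable] simp: indicator_def)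
    also have "\<dots> = emeasure (distr Q borel gp) A"
      by (subst emeasure_distr) (auto simp: measurable_cong_sets[OF Q])
    finally show "emeasure (density \<sigma> (\<lambda>x. ennreal (indicator W x))) A = emeasure (distr Q borel gp) A" .
  qed
  have "(LINT x:frontier \<Omega>|\<sigma>. F x) = (\<integral>x. indicator W x *\<^sub>R F x \<partial>\<sigma>)"
    unfolding set_lebesgue_integral_def
    by (rule Bochner_Integration.integral_cong) (use F0 in \<open>auto simp: W_def indicator_def\<close>)
  also have "\<dots> = integral\<^sup>L (density \<sigma> (\<lambda>x. ennreal (indicator W x))) F"
    by (rule integral_density[symmetric]) auto
  also have "\<dots> = integral\<^sup>L Q (\<lambda>y. F (gp y))"
    unfolding eq by (rule integral_distr) (auto simp: measurable_cong_sets[OF Q])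
  also have "\<dots> = (\<integral>y. (indicator W (gp y) * norm (D\<Phi> (gp y))) *\<^sub>R F (gp y) \<partial>hyperplane_measure i)"
    unfolding Q_def by (rule integral_density) auto
  finally show ?thesis by (simp add: gpW)
qed

text \<open>A box containing the projection of the closed ball of radius \<open>\<rho>\<close> along
  the i-th axis; a box, because its product measure is an explicit finite product.\<close>

definition shadow :: "real \<Rightarrow> ('n \<Rightarrow> real) set" where
  "shadow \<rho> = Pi\<^sub>E (UNIV - {i}) (\<lambda>j. {x\<^sub>0 $ j - \<rho>..x\<^sub>0 $ j + \<rho>})"

lemma shadow_sets [measurable]: "shadow \<rho> \<in> sets (hyperplane_measure i)"
  unfolding shadow_def by (rule sets_PiM_I_finite) auto

lemma emeasure_shadow: "emeasure (hyperplane_measure i) (shadow \<rho>) < \<infinity>"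
proof -
  interpret product_sigma_finite "\<lambda>_. lborel :: real measure" by standard
  have "emeasure (hyperplane_measure i) (shadow \<rho>) = (\<Prod>j\<in>UNIV - {i}. emeasure lborel {x\<^sub>0 $ j - \<rho>..x\<^sub>0 $ j + \<rho>})"
    unfolding shadow_def by (rule emeasure_PiM) auto
  also have "\<dots> = (\<Prod>j\<in>UNIV - {i}. ennreal (max 0 (2 * \<rho>)))"
    by (rule prod.cong) (auto simp: emeasure_lborel_Icc_eq max_def)
  also have "\<dots> < \<infinity>" by (subst prod_ennreal) auto
  finally show ?thesis .
qed

lemma in_shadow:
  assumes "y \<in> space (hyperplane_measure i)" "hyperplane_pt i y + z *\<^sub>R axis i 1 \<in> cball x\<^sub>0 \<rho>"
  shows "y \<in> shadow \<rho>"
proof -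
  have "\<bar>x\<^sub>0 $ j - y j\<bar> \<le> \<rho>" if "j \<noteq> i" for j
    using component_le_norm_cart[of "x\<^sub>0 - (hyperplane_pt i y + z *\<^sub>R axis i 1)" j] assms(2) that
    by (auto simp: dist_norm hyperplane_pt_def axis_def)
  then show ?thesis using assms(1)
    unfolding shadow_def space_PiM by (auto simp: PiE_def Pi_def abs_le_iff) (smt (verit))+
qed

lemma emeasure_surface_finite:
  assumes "\<rho> < r"
  shows "emeasure \<sigma> (frontier \<Omega> \<inter> cball x\<^sub>0 \<rho>) < \<infinity>"
proof -
  obtain M where M: "M \<ge> 0" "\<And>x. x \<in> cball x\<^sub>0 \<rho> \<Longrightarrow> norm (D\<Phi> x) \<le> M"
    by (rule compact_norm_bound[OF compact_cball continuous_on_\<Phi>(2)]) blast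
  let ?B = "frontier \<Omega> \<inter> cball x\<^sub>0 \<rho>"
  have "emeasure \<sigma> ?B = (\<integral>\<^sup>+ y. indicator ?B (gp y) * ennreal (norm (D\<Phi> (gp y))) \<partial>hyperplane_measure i)"
    by (rule emeasure_surface) (use assms in auto)
  also have "\<dots> \<le> (\<integral>\<^sup>+ y. ennreal M * indicator (shadow \<rho>) y \<partial>hyperplane_measure i)"
  proof (rule nn_integral_mono)
    fix y assume y: "y \<in> space (hyperplane_measure i)"
    show "indicator ?B (gp y) * ennreal (norm (D\<Phi> (gp y))) \<le> ennreal M * indicator (shadow \<rho>) y"
      using in_shadow[OF y, of "g (hyperplane_pt i y)" \<rho>] M(2)[of "gp y"]
      by (auto simp: indicator_def graph_pt_def intro!: ennreal_leI)
  qed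
  also have "\<dots> = ennreal M * emeasure (hyperplane_measure i) (shadow \<rho>)"
    by (subst nn_integral_cmult_indicator) auto
  also have "\<dots> < \<infinity>" using emeasure_shadow[of \<rho>] by (simp add: ennreal_mult_less_top)
  finally show ?thesis .
qed

text \<open>
  The points of \<open>\<Omega>\<close> that leave \<open>\<Omega>\<close> under the shift by \<open>- t w\<close> form a layer of thickness
  \<open>t w \<sqdot> D\<Phi> + o(t)\<close> in the direction of the \<open>i\<close>-th axis, as \<open>g\<close> does not depend on that coordinate.
\<close>

lemma layer_limit_aux:
  fixes H :: "real^'n \<Rightarrow> real"
  assumes H: "continuous_on (closure \<Omega>) H" and supp: "\<And>x. x \<in> closure \<Omega> \<Longrightarrow> x \<notin> cball x\<^sub>0 \<rho> \<Longrightarrow> H x = 0"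
    and \<rho>: "\<rho> < r" and w: "\<And>x. x \<in> ball x\<^sub>0 r \<Longrightarrow> D\<Phi> x \<bullet> w > 0"
    and t: "\<And>n. t n > 0" "t \<longlonglongrightarrow> 0" and small: "\<And>n. t n \<le> 1" "\<And>n. t n * norm w < r - \<rho>"
  shows "(\<lambda>n. (\<integral>x. indicator {x\<in>\<Omega>. x - t n *\<^sub>R w \<notin> \<Omega>} x * H x \<partial>lborel) / t n)
    \<longlonglongrightarrow> - (LINT x:frontier \<Omega>|\<sigma>. H x * (w \<bullet> outer_normal \<Omega> x))"
proof -
  \<comment> \<open>\<open>H\<close> is arbitrary off the closure. This extension by zero is Borel
    on the whole space and continuous on all of \<open>{x. \<Phi> x \<ge> 0}\<close>, also outside
    the chart, so that the limit can be taken on every fibre.\<close>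
  define hh where "hh x = (if x \<in> cball x\<^sub>0 \<rho> \<and> \<Phi> x \<ge> 0 then H x else 0)" for x
  have "compact (closure \<Omega>)" using bounded_domain by simp
  from compact_norm_bound[OF this H]
  obtain B where B: "B \<ge> 0" "\<And>x. x \<in> closure \<Omega> \<Longrightarrow> norm (H x) \<le> B" by blast
  have cb: "cball x\<^sub>0 \<rho> \<subseteq> ball x\<^sub>0 r" using \<rho> by auto
  have hhB: "\<bar>hh x\<bar> \<le> B" "B \<ge> 0" for x
    using B(1) B(2)[of x] in_closure_iff[of x] cb unfolding hh_def by auto
  have hhH: "hh x = H x" if "x \<in> ball x\<^sub>0 r" "\<Phi> x \<ge> 0" for x
    using supp[of x] in_closure_iff[OF that(1)] that by (auto simp: hh_def)
  have closed: "closed {x. \<Phi> x \<ge> 0}" by (intro closed_Collect_le continuous_intros continuous_on_\<Phi>)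
  have hh_cont: "continuous_on {x. \<Phi> x \<ge> 0} hh"
    unfolding continuous_on_eq_continuous_within
  proof
    fix x assume x: "x \<in> {x. \<Phi> x \<ge> 0}"
    show "continuous (at x within {x. \<Phi> x \<ge> 0}) hh"
    proof (cases "x \<in> ball x\<^sub>0 r")
      case True
      have "continuous_on ({x. \<Phi> x \<ge> 0} \<inter> ball x\<^sub>0 r) H"
        by (rule continuous_on_subset[OF H]) (use in_closure_iff in auto)
      then have "continuous_on ({x. \<Phi> x \<ge> 0} \<inter> ball x\<^sub>0 r) hh"
        by (rule continuous_on_eq) (use hhH in auto)
      then have "continuous (at x within {x. \<Phi> x \<ge> 0} \<inter> ball x\<^sub>0 r) hh"
        using True x continuous_on_eq_continuous_within by blast
      moreover have "at x within {x. \<Phi> x \<ge> 0} \<inter> ball x\<^sub>0 r = at x within {x. \<Phi> x \<ge> 0}"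
        by (rule at_within_nhd[where S="ball x\<^sub>0 r"]) (use True in auto)
      ultimately show ?thesis by simp
    next
      case False
      have "open (- cball x\<^sub>0 \<rho>)" "x \<in> - cball x\<^sub>0 \<rho>" using False cb by auto
      moreover have "continuous_on (- cball x\<^sub>0 \<rho>) hh"
        by (rule continuous_on_eq[OF continuous_on_const[of _ 0]]) (auto simp: hh_def)
      ultimately have "continuous (at x) hh" using continuous_on_eq_continuous_at by blast
      then show ?thesis using continuous_at_imp_continuous_at_within by blast
    qed
  qed
  have [measurable]: "hh \<in> borel_measurable borel"
  proof -
    have "(\<lambda>x. indicator {x. \<Phi> x \<ge> 0} x *\<^sub>R hh x) \<in> borel_measurable borel"
      by (rule borel_measurable_continuous_on_indicator[OF _ hh_cont]) (use closed in auto)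
    moreover have "(\<lambda>x. indicator {x. \<Phi> x \<ge> 0} x *\<^sub>R hh x) = hh" by (auto simp: hh_def fun_eq_iff)
    ultimately show ?thesis by simp
  qed
  \<comment> \<open>On the support of \<open>hh\<close>, membership in \<open>\<Omega>\<close> is
    the sign of \<open>\<Phi>\<close>, both at \<open>x\<close> and at the shifted point. Written
    with \<open>\<Phi>\<close>, every fibre of the layer is an interval.\<close>
  define F where "F n x = indicator {x. 0 < \<Phi> x \<and> \<Phi> (x - t n *\<^sub>R w) \<le> 0} x * hh x" for n x
  have [measurable]: "F n \<in> borel_measurable borel" for n
    unfolding F_def[abs_def] by measurable
  have F_eq: "indicator {x\<in>\<Omega>. x - t n *\<^sub>R w \<notin> \<Omega>} x * H x = F n x" for n x
  proof (cases "x \<in> cball x\<^sub>0 \<rho>")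
    case True
    then have 1: "x \<in> ball x\<^sub>0 r" using cb by auto
    have "dist x\<^sub>0 (x - t n *\<^sub>R w) \<le> dist x\<^sub>0 x + dist x (x - t n *\<^sub>R w)" by (rule dist_triangle)
    then have 2: "x - t n *\<^sub>R w \<in> ball x\<^sub>0 r"
      using True small(2)[of n] t(1)[of n] by (simp add: dist_norm)
    show ?thesis
      using in_domain_iff[OF 1] in_domain_iff[OF 2] hhH[OF 1] by (auto simp: F_def indicator_def)
  next
    case False
    then have "hh x = 0" by (simp add: hh_def)
    moreover have "indicator {x\<in>\<Omega>. x - t n *\<^sub>R w \<notin> \<Omega>} x * H x = 0"
      using supp[of x] False closure_subset[of \<Omega>] by (auto simp: indicator_def)
    ultimately show ?thesis by (simp add: F_def)
  qed
  have F_int: "integrable lborel (F n)" for n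
  proof (rule Bochner_Integration.integrable_bound)
    show "integrable lborel (\<lambda>x. B * indicator (cball x\<^sub>0 \<rho>) x)"
      by (intro integrable_mult_right integrable_real_indicator) (use emeasure_bounded_finite[OF bounded_cball, of x\<^sub>0 \<rho>] in auto)
    have "norm (F n x) \<le> norm (B * indicator (cball x\<^sub>0 \<rho>) x)" for x
      using hhB(1)[of x] hhB(2) by (auto simp: F_def indicator_def hh_def)
    then show "AE x in lborel. norm (F n x) \<le> norm (B * indicator (cball x\<^sub>0 \<rho>) x)" by blast
  qed simp
  \<comment> \<open>\<open>\<Phi>\<close> is affine along a fibre with slope \<open>s\<close>, so
    the condition \<open>\<Phi> (x - t n *\<^sub>R w) \<le> 0\<close> can be solved for the signed
    height over the graph; \<open>\<theta> n y\<close> is the resulting upper bound.\<close>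
  define \<theta> where "\<theta> n y = s * (t n * w $ i + g (hyperplane_pt i y - t n *\<^sub>R w) - g (hyperplane_pt i y))" for n y
  define A where "A n y = (\<integral>z. F n (hyperplane_pt i y + z *\<^sub>R axis i 1) \<partial>lborel) / t n" for n y
  have F_fiber: "F n (hyperplane_pt i y + z *\<^sub>R axis i 1) =
      indicator {z. 0 < s * (z - g (hyperplane_pt i y)) \<and> s * (z - g (hyperplane_pt i y)) \<le> \<theta> n y} z
        * hh (hyperplane_pt i y + z *\<^sub>R axis i 1)" for n y z
  proof -
    have "\<Phi> (hyperplane_pt i y + z *\<^sub>R axis i 1 - t n *\<^sub>R w) = \<Phi> (hyperplane_pt i y - t n *\<^sub>R w + z *\<^sub>R axis i 1)"
      by (simp add: algebra_simps)
    also have "\<dots> = s * (z - g (hyperplane_pt i y)) - \<theta> n y"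
      unfolding \<Phi>_shift by (simp add: \<Phi>_def \<theta>_def hyperplane_pt_def algebra_simps)
    finally show ?thesis by (simp add: F_def \<Phi>_graph indicator_def)
  qed
  have hh_fiber [measurable]: "(\<lambda>z. hh (hyperplane_pt i y + z *\<^sub>R axis i 1)) \<in> borel_measurable borel" for y
    by measurable
  define L where "L y = hh (gp y) * max 0 (D\<Phi> (gp y) \<bullet> w)" for y
  have A_lim: "(\<lambda>n. A n y) \<longlonglongrightarrow> L y" for y
    unfolding A_def F_fiber L_def
  proof (rule fiber_average_tendsto[OF sign hh_fiber hhB(1) _ t])
    fix e :: real assume "e > 0"
    then obtain d where d: "d > 0" "\<And>x. \<Phi> x \<ge> 0 \<Longrightarrow> dist x (gp y) < d \<Longrightarrow> dist (hh x) (hh (gp y)) < e"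
      using hh_cont[unfolded continuous_on_iff, rule_format, of "gp y" e] \<Phi>_gp[of y] by auto
    show "\<exists>d>0. \<forall>z. 0 < s * (z - g (hyperplane_pt i y)) \<and> s * (z - g (hyperplane_pt i y)) < d \<longrightarrow>
        \<bar>hh (hyperplane_pt i y + z *\<^sub>R axis i 1) - hh (gp y)\<bar> \<le> e"
    proof (intro exI conjI allI impI)
      fix z assume z: "0 < s * (z - g (hyperplane_pt i y)) \<and> s * (z - g (hyperplane_pt i y)) < d"
      have "dist (hyperplane_pt i y + z *\<^sub>R axis i 1) (gp y) = norm ((z - g (hyperplane_pt i y)) *\<^sub>R (axis i 1 :: real^'n))"
        by (simp add: graph_pt_def dist_norm algebra_simps)
      also have "\<dots> = \<bar>s * (z - g (hyperplane_pt i y))\<bar>" using s_sq by (simp add: abs_mult)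
      also have "\<dots> < d" using z by simp
      finally show "\<bar>hh (hyperplane_pt i y + z *\<^sub>R axis i 1) - hh (gp y)\<bar> \<le> e"
        using d(2)[of "hyperplane_pt i y + z *\<^sub>R axis i 1"] z by (simp add: \<Phi>_graph dist_real_def)
    qed (rule d)
  next
    have "(\<lambda>n. s * (w $ i + (g (hyperplane_pt i y + t n *\<^sub>R (- w)) - g (hyperplane_pt i y)) / t n))
        \<longlonglongrightarrow> s * (w $ i + grad UNIV g (hyperplane_pt i y) \<bullet> (- w))"
      by (intro tendsto_intros difference_quotient_tendsto g_has_derivative t)
    moreover have "s * (w $ i + (g (hyperplane_pt i y + t n *\<^sub>R (- w)) - g (hyperplane_pt i y)) / t n) = \<theta> n y / t n" for n
      using t(1)[of n] by (simp add: \<theta>_def field_simps)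
    moreover have "s * (w $ i + grad UNIV g (hyperplane_pt i y) \<bullet> (- w)) = D\<Phi> (gp y) \<bullet> w"
      unfolding D\<Phi>_gp by (simp add: D\<Phi>_def inner_diff_left inner_axis')
    ultimately show "(\<lambda>n. \<theta> n y / t n) \<longlonglongrightarrow> D\<Phi> (gp y) \<bullet> w" by simp
  qed
  obtain C where C: "C \<ge> 0" "\<And>n y. y \<in> shadow \<rho> \<Longrightarrow> \<bar>\<theta> n y\<bar> \<le> C * t n"
  proof -
    \<comment> \<open>\<open>R\<close> bounds all points
      \<open>hyperplane_pt i y - \<tau> *\<^sub>R w\<close> with \<open>y\<close> in the shadow and
      \<open>0 \<le> \<tau> \<le> 1\<close>. This uses \<open>t n \<le> 1\<close> and makes the
      bound on \<open>\<theta>\<close> uniform in \<open>y\<close>.\<close>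
    define R where "R = (\<Sum>j\<in>UNIV. \<bar>x\<^sub>0 $ j\<bar> + \<bar>\<rho>\<bar>) + norm w"
    obtain M where M: "M \<ge> 0" "\<And>x. x \<in> cball 0 R \<Longrightarrow> norm (grad UNIV g x) \<le> M"
      by (rule compact_norm_bound[OF compact_cball continuous_on_g(2)]) blast
    show thesis
    proof (rule that)
      show "\<bar>w $ i\<bar> + M * norm w \<ge> 0" using M by simp
      fix n y assume y: "y \<in> shadow \<rho>"
      have "norm (hyperplane_pt i y :: real^'n) \<le> (\<Sum>j\<in>UNIV. \<bar>(hyperplane_pt i y :: real^'n) $ j\<bar>)" by (rule norm_le_l1_cart)
      also have "\<dots> \<le> (\<Sum>j\<in>UNIV. \<bar>x\<^sub>0 $ j\<bar> + \<bar>\<rho>\<bar>)"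
      proof (rule sum_mono)
        fix j show "\<bar>(hyperplane_pt i y :: real^'n) $ j\<bar> \<le> \<bar>x\<^sub>0 $ j\<bar> + \<bar>\<rho>\<bar>"
        proof (cases "j = i")
          case False
          then have "y j \<in> {x\<^sub>0 $ j - \<rho>..x\<^sub>0 $ j + \<rho>}" 
            using PiE_mem[OF y[unfolded shadow_def], of j] by simp
          then have "x\<^sub>0 $ j - \<rho> \<le> y j" "y j \<le> x\<^sub>0 $ j + \<rho>" by auto
          then have "\<bar>y j\<bar> \<le> \<bar>x\<^sub>0 $ j\<bar> + \<bar>\<rho>\<bar>" by linarith
          then show ?thesis using False by (simp add: hyperplane_pt_def)
        qed (simp add: hyperplane_pt_def)
      qed
      finally have hp: "norm (hyperplane_pt i y :: real^'n) \<le> R - norm w" by (simp add: R_def)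
      obtain \<tau> where \<tau>: "0 < \<tau>" "\<tau> < t n"
        "g (hyperplane_pt i y + t n *\<^sub>R (- w)) - g (hyperplane_pt i y) = t n * (grad UNIV g (hyperplane_pt i y + \<tau> *\<^sub>R (- w)) \<bullet> (- w))"
        using mvt_line[where x="hyperplane_pt i y" and w="- w" and T=UNIV and F=g and G="grad UNIV g",
            OF t(1)[of n] UNIV_I continuous_on_g(1) g_has_derivative] by blast
      have "norm (hyperplane_pt i y + \<tau> *\<^sub>R (- w)) \<le> norm (hyperplane_pt i y :: real^'n) + norm (\<tau> *\<^sub>R (- w))"
        by (rule norm_triangle_ineq)
      also have "norm (\<tau> *\<^sub>R (- w)) \<le> norm w" using \<tau> small(1)[of n] by (simp add: mult_left_le_one_le)
      finally have "norm (grad UNIV g (hyperplane_pt i y + \<tau> *\<^sub>R (- w))) \<le> M" using hp by (intro M) simp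
      then have "\<bar>grad UNIV g (hyperplane_pt i y + \<tau> *\<^sub>R (- w)) \<bullet> (- w)\<bar> \<le> M * norm w"
        using abs_inner_le[of _ M "- w"] by simp
      then have b: "\<bar>w $ i + grad UNIV g (hyperplane_pt i y + \<tau> *\<^sub>R (- w)) \<bullet> (- w)\<bar> \<le> \<bar>w $ i\<bar> + M * norm w" by linarith
      have "\<theta> n y = s * (t n * w $ i + t n * (grad UNIV g (hyperplane_pt i y + \<tau> *\<^sub>R (- w)) \<bullet> (- w)))"
        using \<tau>(3) by (simp add: \<theta>_def)
      also have "\<bar>\<dots>\<bar> = t n * \<bar>w $ i + grad UNIV g (hyperplane_pt i y + \<tau> *\<^sub>R (- w)) \<bullet> (- w)\<bar>"
        using s_sq t(1)[of n] unfolding distrib_left[symmetric] abs_mult by simp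
      finally show "\<bar>\<theta> n y\<bar> \<le> (\<bar>w $ i\<bar> + M * norm w) * t n"
        using mult_left_mono[OF b, of "t n"] t(1)[of n] by (simp add: mult.commute)
    qed
  qed
  have A_bound: "\<bar>A n y\<bar> \<le> B * C * indicator (shadow \<rho>) y" if "y \<in> space (hyperplane_measure i)" for n y
  proof (cases "y \<in> shadow \<rho>")
    case True
    have "\<bar>A n y\<bar> \<le> B * max 0 (\<theta> n y) / t n"
      unfolding A_def F_fiber abs_divide using t(1)[of n] hhB
      by (simp add: divide_right_mono fiber_average_bound(2)[OF sign hh_fiber])
    also have "\<dots> \<le> B * (C * t n) / t n"
      using C(1) C(2)[OF True, of n] t(1)[of n] hhB(2) by (intro divide_right_mono mult_left_mono) auto
    also have "\<dots> = B * C" using t(1)[of n] by simp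
    finally show ?thesis using True by simp
  next
    case False
    then have "hh (hyperplane_pt i y + z *\<^sub>R axis i 1) = 0" for z
      using in_shadow[OF that] by (auto simp: hh_def)
    then show ?thesis using False by (simp add: A_def F_def)
  qed
  have "(\<lambda>n. \<integral>y. A n y \<partial>hyperplane_measure i) \<longlonglongrightarrow> (\<integral>y. L y \<partial>hyperplane_measure i)"
  proof (rule integral_dominated_convergence)
    show "L \<in> borel_measurable (hyperplane_measure i)" unfolding L_def[abs_def] by measurable
    show "A n \<in> borel_measurable (hyperplane_measure i)" for n unfolding A_def[abs_def] by measurable
    show "integrable (hyperplane_measure i) (\<lambda>y. B * C * indicator (shadow \<rho>) y)"
      by (intro integrable_mult_right integrable_real_indicator) (use emeasure_shadow[of \<rho>] in auto)
    show "AE y in hyperplane_measure i. (\<lambda>n. A n y) \<longlonglongrightarrow> L y" using A_lim by simp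
    show "AE y in hyperplane_measure i. norm (A n y) \<le> B * C * indicator (shadow \<rho>) y" for n
      using A_bound by (intro AE_I2) simp
  qed
  moreover have "(\<integral>y. A n y \<partial>hyperplane_measure i) = (\<integral>x. indicator {x\<in>\<Omega>. x - t n *\<^sub>R w \<notin> \<Omega>} x * H x \<partial>lborel) / t n" for n
    unfolding F_eq A_def using integral_graph_coords[OF F_int[of n], of i] by simp
  moreover have "(\<integral>y. L y \<partial>hyperplane_measure i) = - (LINT x:frontier \<Omega>|\<sigma>. H x * (w \<bullet> outer_normal \<Omega> x))"
  proof -
    \<comment> \<open>\<open>outer_normal\<close> is known only on the frontier. Its expression by
      \<open>D\<Phi>\<close> is Borel on the whole space, and the factor
      \<open>1 / norm (D\<Phi> x)\<close> cancels against the area element.\<close>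
    define K where "K x = hh x * (w \<bullet> D\<Phi> x) / norm (D\<Phi> x)" for x
    have "(LINT x:frontier \<Omega>|\<sigma>. H x * (w \<bullet> outer_normal \<Omega> x)) = (LINT x:frontier \<Omega>|\<sigma>. - K x)"
    proof (rule set_lebesgue_integral_cong)
      show "frontier \<Omega> \<in> sets \<sigma>" by (simp add: sets_\<sigma>)
      have "H x * (w \<bullet> outer_normal \<Omega> x) = - K x" if x: "x \<in> frontier \<Omega>" for x
      proof (cases "x \<in> ball x\<^sub>0 r")
        case True
        then show ?thesis
          using outer_normal_eq[of x] hhH[of x] in_frontier_iff[OF True] x by (simp add: K_def divide_inverse)
      next
        case False
        then have "x \<notin> cball x\<^sub>0 \<rho>" using cb by auto
        then show ?thesis using supp[of x] x by (simp add: K_def hh_def frontier_def)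
      qed
      then show "\<forall>x. x \<in> frontier \<Omega> \<longrightarrow> H x * (w \<bullet> outer_normal \<Omega> x) = - K x" by blast
    qed
    also have "\<dots> = - (LINT x:frontier \<Omega>|\<sigma>. K x)" by (simp add: set_lebesgue_integral_def)
    also have "(LINT x:frontier \<Omega>|\<sigma>. K x) = (\<integral>y. indicator (ball x\<^sub>0 r) (gp y) * norm (D\<Phi> (gp y)) * K (gp y) \<partial>hyperplane_measure i)"
    proof (rule surface_integral)
      show "K \<in> borel_measurable borel" unfolding K_def[abs_def] by measurable
      show "K x = 0" if "x \<notin> ball x\<^sub>0 r" for x
        using that cb by (auto simp: K_def hh_def)
    qed
    also have "\<dots> = (\<integral>y. L y \<partial>hyperplane_measure i)"
    proof (rule Bochner_Integration.integral_cong[OF refl])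
      fix y
      show "indicator (ball x\<^sub>0 r) (gp y) * norm (D\<Phi> (gp y)) * K (gp y) = L y"
      proof (cases "gp y \<in> ball x\<^sub>0 r")
        case True
        then show ?thesis using w[OF True] norm_D\<Phi>_pos[of "gp y"] by (simp add: L_def K_def inner_commute)
      next
        case False
        then have "hh (gp y) = 0" using cb by (auto simp: hh_def)
        then show ?thesis by (simp add: L_def K_def)
      qed
    qed
    finally show ?thesis by simp
  qed
  ultimately show ?thesis by simp
qed

text \<open>The smallness conditions on \<open>t\<close> hold on a tail of the sequence, and the
  limit depends only on a tail.\<close>

lemma layer_limit:
  fixes H :: "real^'n \<Rightarrow> real"
  assumes H: "continuous_on (closure \<Omega>) H" and supp: "\<And>x. x \<in> closure \<Omega> \<Longrightarrow> x \<notin> cball x\<^sub>0 \<rho> \<Longrightarrow> H x = 0"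
    and \<rho>: "\<rho> < r" and w: "\<And>x. x \<in> ball x\<^sub>0 r \<Longrightarrow> D\<Phi> x \<bullet> w > 0"
    and t: "\<And>n. t n > 0" "t \<longlonglongrightarrow> 0"
  shows "(\<lambda>n. (\<integral>x. indicator {x\<in>\<Omega>. x - t n *\<^sub>R w \<notin> \<Omega>} x * H x \<partial>lborel) / t n)
    \<longlonglongrightarrow> - (LINT x:frontier \<Omega>|\<sigma>. H x * (w \<bullet> outer_normal \<Omega> x))"
proof -
  have "(\<lambda>n. t n * norm w) \<longlonglongrightarrow> 0" using tendsto_mult_left_zero[OF t(2)] by simp
  then have "\<forall>\<^sub>F n in sequentially. t n * norm w < r - \<rho>" using order_tendstoD(2) \<rho> by fastforce
  moreover have "\<forall>\<^sub>F n in sequentially. t n < 1" using order_tendstoD(2)[OF t(2)] by simp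
  ultimately have "\<forall>\<^sub>F n in sequentially. t n * norm w < r - \<rho> \<and> t n \<le> 1"
    by eventually_elim simp
  then obtain N where N: "\<And>n. n \<ge> N \<Longrightarrow> t n * norm w < r - \<rho> \<and> t n \<le> 1"
    by (auto simp: eventually_sequentially)
  show ?thesis
    by (rule LIMSEQ_offset[where k=N], rule layer_limit_aux[OF H supp \<rho> w])
      (use t N LIMSEQ_ignore_initial_segment[OF t(2), of N] in auto)
qed

end

subsection \<open>Shifting the domain into itself\<close>

lemma continuous_on_locally:
  fixes F :: "'a::t2_space \<Rightarrow> 'b::topological_space"
  assumes "\<And>x. x \<in> S \<Longrightarrow> \<exists>U. open U \<and> x \<in> U \<and> continuous_on (S \<inter> U) F"
  shows "continuous_on S F"
  unfolding continuous_on_eq_continuous_within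
proof
  fix x assume x: "x \<in> S"
  then obtain U where U: "open U" "x \<in> U" "continuous_on (S \<inter> U) F" using assms by blast
  then have "continuous (at x within S \<inter> U) F" using x continuous_on_eq_continuous_within by blast
  moreover have "at x within S \<inter> U = at x within S"
    by (rule at_within_nhd[where S=U]) (use U in auto)
  ultimately show "continuous (at x within S) F" by simp
qed

text \<open>Boundary points are included among the \<open>x\<close> and land in the open set
  \<open>\<Omega>\<close>. A translate of a test function therefore draws only on values inside
  \<open>\<Omega>\<close>, where classical derivatives exist.\<close>

definition shifts_inward :: "(real^'n) set \<Rightarrow> real^'n \<Rightarrow> real \<Rightarrow> real^'n \<Rightarrow> bool" where
  "shifts_inward \<Omega> x\<^sub>0 r w \<longleftrightarrow>
     (\<forall>x t. x \<in> closure \<Omega> \<inter> ball x\<^sub>0 r \<and> 0 < t \<and> x + t *\<^sub>R w \<in> ball x\<^sub>0 r \<longrightarrow> x + t *\<^sub>R w \<in> \<Omega>)"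

text \<open>
  The points of \<open>\<Omega>\<close> that leave it under the shift by \<open>- t w\<close>, weighted by \<open>1 / t\<close>, concentrate to
  \<open>- w \<sqdot> \<nu> d\<sigma>\<close> on the boundary.
\<close>

definition layer_converges :: "(real^'n) set \<Rightarrow> (real^'n) measure \<Rightarrow> real^'n \<Rightarrow> real \<Rightarrow> real^'n \<Rightarrow> bool" where
  "layer_converges \<Omega> \<sigma> x\<^sub>0 r w \<longleftrightarrow>
     (\<forall>H \<rho> t. continuous_on (closure \<Omega>) H \<and> (\<forall>x\<in>closure \<Omega>. x \<notin> cball x\<^sub>0 \<rho> \<longrightarrow> H x = 0) \<and> \<rho> < r \<and>
        (\<forall>n. t n > 0) \<and> t \<longlonglongrightarrow> 0 \<longrightarrow>
        (\<lambda>n. (\<integral>x. indicator {x\<in>\<Omega>. x - t n *\<^sub>R w \<notin> \<Omega>} x * H x \<partial>lborel) / t n)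
          \<longlonglongrightarrow> - (LINT x:frontier \<Omega>|\<sigma>. H x * (w \<bullet> outer_normal \<Omega> x)))"

definition shift_chart :: "(real^'n) set \<Rightarrow> (real^'n) measure \<Rightarrow> real^'n \<Rightarrow> real \<Rightarrow> real^'n \<Rightarrow> bool" where
  "shift_chart \<Omega> \<sigma> x\<^sub>0 r w \<longleftrightarrow> shifts_inward \<Omega> x\<^sub>0 r w \<and> layer_converges \<Omega> \<sigma> x\<^sub>0 r w"

text \<open>The ball is convex, so \<open>\<Phi>\<close> increases strictly along the whole segment
  in direction \<open>w\<close>: starting from \<open>\<Phi> \<ge> 0\<close> it ends with
  \<open>\<Phi> > 0\<close>.\<close>

lemma (in surface_chart) shift_chart_graph:
  assumes w: "\<And>x. x \<in> ball x\<^sub>0 r \<Longrightarrow> D\<Phi> x \<bullet> w > 0"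
  shows "shift_chart \<Omega> \<sigma> x\<^sub>0 r w"
  unfolding shift_chart_def
proof
  show "shifts_inward \<Omega> x\<^sub>0 r w"
    unfolding shifts_inward_def
  proof (intro allI impI)
    fix x t assume a: "x \<in> closure \<Omega> \<inter> ball x\<^sub>0 r \<and> 0 < t \<and> x + t *\<^sub>R w \<in> ball x\<^sub>0 r"
    then have a1: "x \<in> ball x\<^sub>0 r" "0 < t" "x + t *\<^sub>R w \<in> ball x\<^sub>0 r" "\<Phi> x \<ge> 0"
      using in_closure_iff[of x] by auto
    have seg: "x + \<tau> *\<^sub>R w \<in> ball x\<^sub>0 r" if "0 \<le> \<tau>" "\<tau> \<le> t" for \<tau>
    proof -
      have "(1 - \<tau> / t) *\<^sub>R x + (\<tau> / t) *\<^sub>R (x + t *\<^sub>R w) \<in> ball x\<^sub>0 r"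
        by (rule convexD[OF convex_ball a1(1,3)]) (use that a1(2) in auto)
      then show ?thesis using a1(2) by (simp add: algebra_simps)
    qed
    obtain \<tau> where \<tau>: "0 < \<tau>" "\<tau> < t" "\<Phi> (x + t *\<^sub>R w) - \<Phi> x = t * (D\<Phi> (x + \<tau> *\<^sub>R w) \<bullet> w)"
      using mvt_line[where x=x and w=w and T=UNIV and F=\<Phi> and G=D\<Phi>,
            OF a1(2) UNIV_I continuous_on_\<Phi>(1) \<Phi>_has_derivative] by blast
    have "D\<Phi> (x + \<tau> *\<^sub>R w) \<bullet> w > 0" by (rule w, rule seg) (use \<tau> in auto)
    then have "\<Phi> (x + t *\<^sub>R w) > 0" using \<tau>(3) a1(2,4) by (simp add: add_nonneg_pos algebra_simps)
    then show "x + t *\<^sub>R w \<in> \<Omega>" using in_domain_iff[OF a1(3)] by blast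
  qed
  show "layer_converges \<Omega> \<sigma> x\<^sub>0 r w"
    unfolding layer_converges_def using layer_limit w by blast
qed

text \<open>Near the support of \<open>H\<close> nothing leaves \<open>\<Omega>\<close> under a
  small shift, and \<open>H\<close> vanishes on the frontier, so the quotients are eventually 0 and
  so is their limit. Every direction is thus admissible, and interior and boundary points can be
  treated alike.\<close>

lemma shift_chart_interior:
  fixes \<Omega> :: "(real^'n) set"
  assumes "ball x\<^sub>0 r \<subseteq> \<Omega>" "open \<Omega>"
  shows "shift_chart \<Omega> \<sigma> x\<^sub>0 r w"
  unfolding shift_chart_def
proof
  show "shifts_inward \<Omega> x\<^sub>0 r w" using assms by (auto simp: shifts_inward_def)
  show "layer_converges \<Omega> \<sigma> x\<^sub>0 r w"
    unfolding layer_converges_def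
  proof (intro allI impI)
    fix H :: "real^'n \<Rightarrow> real" and \<rho> and t :: "nat \<Rightarrow> real"
    assume a: "continuous_on (closure \<Omega>) H \<and> (\<forall>x\<in>closure \<Omega>. x \<notin> cball x\<^sub>0 \<rho> \<longrightarrow> H x = 0) \<and> \<rho> < r \<and>
        (\<forall>n. t n > 0) \<and> t \<longlonglongrightarrow> 0"
    have fr: "H x = 0" if "x \<in> frontier \<Omega>" for x
    proof -
      have "x \<notin> ball x\<^sub>0 r" using that assms by (auto simp: frontier_def interior_open)
      then show ?thesis using a that by (auto simp: frontier_def)
    qed
    have "(LINT x:frontier \<Omega>|\<sigma>. H x * (w \<bullet> outer_normal \<Omega> x)) = (\<integral>x. 0 \<partial>\<sigma>)"
      unfolding set_lebesgue_integral_def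
      by (rule Bochner_Integration.integral_cong) (auto simp: fr indicator_def)
    then have I0: "(LINT x:frontier \<Omega>|\<sigma>. H x * (w \<bullet> outer_normal \<Omega> x)) = 0" by simp
    have "(\<lambda>n. t n * norm w) \<longlonglongrightarrow> 0" using a tendsto_mult_left_zero by blast
    then have "\<forall>\<^sub>F n in sequentially. t n * norm w < r - \<rho>" using order_tendstoD(2) a by fastforce
    then have "\<forall>\<^sub>F n in sequentially. (\<integral>x. indicator {x\<in>\<Omega>. x - t n *\<^sub>R w \<notin> \<Omega>} x * H x \<partial>lborel) / t n = 0"
    proof eventually_elim
      case (elim n)
      have "indicator {x\<in>\<Omega>. x - t n *\<^sub>R w \<notin> \<Omega>} x * H x = 0" for x
      proof (cases "x \<in> cball x\<^sub>0 \<rho>")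
        case True
        have "dist x\<^sub>0 (x - t n *\<^sub>R w) \<le> dist x\<^sub>0 x + dist x (x - t n *\<^sub>R w)" by (rule dist_triangle)
        moreover have "\<bar>t n\<bar> = t n" using a by (simp add: abs_of_pos)
        ultimately have "x - t n *\<^sub>R w \<in> ball x\<^sub>0 r" using True elim by (simp add: dist_norm)
        then show ?thesis using assms by auto
      next
        case False
        then show ?thesis using a closure_subset[of \<Omega>] by (auto simp: indicator_def)
      qed
      then have "(\<lambda>x. indicator {x\<in>\<Omega>. x - t n *\<^sub>R w \<notin> \<Omega>} x * H x) = (\<lambda>x. 0)" by (rule ext)
      then show ?case by (simp only: Bochner_Integration.integral_zero div_0)
    qed
    then show "(\<lambda>n. (\<integral>x. indicator {x\<in>\<Omega>. x - t n *\<^sub>R w \<notin> \<Omega>} x * H x \<partial>lborel) / t n)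
          \<longlonglongrightarrow> - (LINT x:frontier \<Omega>|\<sigma>. H x * (w \<bullet> outer_normal \<Omega> x))"
      unfolding I0 by (simp add: tendsto_eventually)
  qed
qed

section \<open>Translates and difference quotients of test functions\<close>

lemma C1_closure_gradient_support:
  assumes q: "C1_closure \<Omega> q Dq" and "open \<Omega>"
    and supp: "\<And>x. x \<in> closure \<Omega> \<Longrightarrow> x \<notin> cball x\<^sub>0 \<rho> \<Longrightarrow> q x = 0"
    and x: "x \<in> closure \<Omega>" "x \<notin> cball x\<^sub>0 \<rho>"
  shows "Dq x = 0"
proof -
  have zero: "Dq y = 0" if "y \<in> \<Omega> - cball x\<^sub>0 \<rho>" for y
  proof -
    have "(q has_derivative (\<lambda>v. Dq y \<bullet> v)) (at y)" using C1_closureD(3)[OF q] that by auto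
    moreover have "(q has_derivative (\<lambda>v. 0)) (at y)"
      by (rule has_derivative_transform_within_open[OF has_derivative_const[of 0] open_Diff[OF assms(2) closed_cball] that])
        (use supp closure_subset[of \<Omega>] in auto)
    ultimately have "(\<lambda>v. Dq y \<bullet> v) = (\<lambda>v. 0)" by (rule has_derivative_unique)
    then show ?thesis by (metis inner_eq_zero_iff)
  qed
  have "x \<in> closure (\<Omega> - cball x\<^sub>0 \<rho>)"
    using x open_Int_closure_subset[of "- cball x\<^sub>0 \<rho>" \<Omega>] by (auto simp: Diff_eq Int_commute open_Compl)
  moreover have "continuous_on (closure (\<Omega> - cball x\<^sub>0 \<rho>)) Dq"
    by (rule continuous_on_subset[OF C1_closureD(2)[OF q]]) (rule closure_mono, auto)
  ultimately show ?thesis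
    using continuous_constant_on_closure[of "\<Omega> - cball x\<^sub>0 \<rho>" Dq 0 x] zero by blast
qed

text \<open>The point \<open>x + v\<close> may lie outside the closure of the domain, where
  \<open>q\<close> is unspecified. The test on the ball makes this the translate of the extension by
  zero of a function supported there.\<close>

definition shifted :: "real^'n \<Rightarrow> real \<Rightarrow> real^'n \<Rightarrow> (real^'n \<Rightarrow> 'b::zero) \<Rightarrow> real^'n \<Rightarrow> 'b" where
  "shifted x\<^sub>0 \<rho> v q x = (if x + v \<in> cball x\<^sub>0 \<rho> then q (x + v) else 0)"

locale inward_shift =
  fixes \<Omega> :: "(real^'n) set" and x\<^sub>0 :: "real^'n" and r \<rho> :: real and w :: "real^'n" and t :: real
  assumes open_domain: "open \<Omega>" and inward: "shifts_inward \<Omega> x\<^sub>0 r w" and t_pos: "0 < t" and small: "t * norm w < r - \<rho>"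
begin

lemma in_ball_r: "x \<in> cball x\<^sub>0 \<rho> \<Longrightarrow> x \<in> ball x\<^sub>0 r"
  using small mult_nonneg_nonneg[OF less_imp_le[OF t_pos] norm_ge_zero[of w]] by auto

lemma back_in_ball:
  assumes "x + t *\<^sub>R w \<in> cball x\<^sub>0 \<rho>" shows "x \<in> ball x\<^sub>0 r"
proof -
  have "dist x\<^sub>0 x \<le> dist x\<^sub>0 (x + t *\<^sub>R w) + dist (x + t *\<^sub>R w) x" by (rule dist_triangle)
  also have "dist (x + t *\<^sub>R w) x = t * norm w" using t_pos by (simp add: dist_norm)
  finally show ?thesis using assms small by simp
qed

lemma forth_in_ball:
  assumes "x \<in> cball x\<^sub>0 \<rho>" shows "x + t *\<^sub>R w \<in> ball x\<^sub>0 r"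
proof -
  have "dist x\<^sub>0 (x + t *\<^sub>R w) \<le> dist x\<^sub>0 x + dist x (x + t *\<^sub>R w)" by (rule dist_triangle)
  also have "dist x (x + t *\<^sub>R w) = t * norm w" using t_pos by (simp add: dist_norm)
  finally show ?thesis using assms small by simp
qed

lemma segment_in_domain:
  assumes "x \<in> closure \<Omega> \<inter> ball x\<^sub>0 r" "x + t *\<^sub>R w \<in> ball x\<^sub>0 r" "0 < \<tau>" "\<tau> \<le> t"
  shows "x + \<tau> *\<^sub>R w \<in> \<Omega>"
proof -
  have "(1 - \<tau> / t) *\<^sub>R x + (\<tau> / t) *\<^sub>R (x + t *\<^sub>R w) \<in> ball x\<^sub>0 r"
    by (rule convexD[OF convex_ball]) (use assms t_pos in auto)
  then have "x + \<tau> *\<^sub>R w \<in> ball x\<^sub>0 r" using t_pos by (simp add: algebra_simps)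
  then show ?thesis using inward assms unfolding shifts_inward_def by blast
qed

lemma shift_in_domain:
  assumes "x \<in> closure \<Omega> \<inter> ball x\<^sub>0 r" "x + t *\<^sub>R w \<in> ball x\<^sub>0 r"
  shows "x + t *\<^sub>R w \<in> \<Omega>"
  using segment_in_domain[OF assms t_pos] by simp

text \<open>On the first of these two open sets \<open>shifted\<close> is the plain translate, on
  the second it is zero; continuity and differentiability are checked on each separately.\<close>

lemma shift_cover:
  "closure \<Omega> \<subseteq> (ball x\<^sub>0 r \<inter> (\<lambda>x. x + t *\<^sub>R w) -` ball x\<^sub>0 r) \<union> (\<lambda>x. x + t *\<^sub>R w) -` (- cball x\<^sub>0 \<rho>)"
  using back_in_ball in_ball_r by auto

lemma open_shift_cover:
  "open (ball x\<^sub>0 r \<inter> (\<lambda>x. x + t *\<^sub>R w) -` ball x\<^sub>0 r)" "open ((\<lambda>x. x + t *\<^sub>R w) -` (- cball x\<^sub>0 \<rho>))"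
  by (intro open_Int open_ball open_vimage continuous_intros open_Compl closed_cball)+

lemma shifted_eq:
  assumes "x \<in> closure \<Omega> \<inter> ball x\<^sub>0 r" "x + t *\<^sub>R w \<in> ball x\<^sub>0 r"
    and supp: "\<And>x. x \<in> closure \<Omega> \<Longrightarrow> x \<notin> cball x\<^sub>0 \<rho> \<Longrightarrow> q x = 0"
  shows "shifted x\<^sub>0 \<rho> (t *\<^sub>R w) q x = q (x + t *\<^sub>R w)"
  using shift_in_domain[OF assms(1,2)] supp closure_subset[of \<Omega>] by (auto simp: shifted_def)

lemma continuous_on_shifted:
  fixes q :: "real^'n \<Rightarrow> 'b::real_normed_vector"
  assumes q: "continuous_on (closure \<Omega>) q"
    and supp: "\<And>x. x \<in> closure \<Omega> \<Longrightarrow> x \<notin> cball x\<^sub>0 \<rho> \<Longrightarrow> q x = 0"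
  shows "continuous_on (closure \<Omega>) (shifted x\<^sub>0 \<rho> (t *\<^sub>R w) q)"
proof (rule continuous_on_locally)
  let ?U = "ball x\<^sub>0 r \<inter> (\<lambda>x. x + t *\<^sub>R w) -` ball x\<^sub>0 r" and ?V = "(\<lambda>x. x + t *\<^sub>R w) -` (- cball x\<^sub>0 \<rho>)"
  have "continuous_on (closure \<Omega> \<inter> ?U) (\<lambda>x. q (x + t *\<^sub>R w))"
    by (rule continuous_on_compose2[OF q])
      (use shift_in_domain closure_subset[of \<Omega>] in \<open>auto intro!: continuous_intros\<close>)
  then have 1: "continuous_on (closure \<Omega> \<inter> ?U) (shifted x\<^sub>0 \<rho> (t *\<^sub>R w) q)"
    by (rule continuous_on_eq) (use shifted_eq[where q=q] supp in auto)
  have 2: "continuous_on (closure \<Omega> \<inter> ?V) (shifted x\<^sub>0 \<rho> (t *\<^sub>R w) q)"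
    by (rule continuous_on_eq[OF continuous_on_const[of _ 0]]) (auto simp: shifted_def)
  fix x assume "x \<in> closure \<Omega>"
  then have "x \<in> ?U \<or> x \<in> ?V" using shift_cover by blast
  then show "\<exists>U. open U \<and> x \<in> U \<and> continuous_on (closure \<Omega> \<inter> U) (shifted x\<^sub>0 \<rho> (t *\<^sub>R w) q)"
    using 1 2 open_shift_cover by blast
qed

lemma C1_closure_shifted:
  assumes q: "C1_closure \<Omega> q Dq"
    and supp: "\<And>x. x \<in> closure \<Omega> \<Longrightarrow> x \<notin> cball x\<^sub>0 \<rho> \<Longrightarrow> q x = 0"
  shows "C1_closure \<Omega> (shifted x\<^sub>0 \<rho> (t *\<^sub>R w) q) (shifted x\<^sub>0 \<rho> (t *\<^sub>R w) Dq)"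
proof -
  have supp': "Dq x = 0" if "x \<in> closure \<Omega>" "x \<notin> cball x\<^sub>0 \<rho>" for x
    by (rule C1_closure_gradient_support[OF q open_domain supp]) (use that in auto)
  let ?U = "ball x\<^sub>0 r \<inter> (\<lambda>x. x + t *\<^sub>R w) -` ball x\<^sub>0 r" and ?V = "(\<lambda>x. x + t *\<^sub>R w) -` (- cball x\<^sub>0 \<rho>)"
  have "(shifted x\<^sub>0 \<rho> (t *\<^sub>R w) q has_derivative (\<lambda>v. shifted x\<^sub>0 \<rho> (t *\<^sub>R w) Dq x \<bullet> v)) (at x)" if x: "x \<in> \<Omega>" for x
  proof -
    have "x \<in> closure \<Omega>" using x closure_subset by blast
    then consider "x \<in> ?U" | "x \<in> ?V" using shift_cover by blast
    then show ?thesis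
    proof cases
      case 1
      then have "x + t *\<^sub>R w \<in> \<Omega>" using shift_in_domain x closure_subset[of \<Omega>] by auto
      then have d: "(q has_derivative (\<lambda>v. Dq (x + t *\<^sub>R w) \<bullet> v)) (at (x + t *\<^sub>R w))" by (rule C1_closureD(3)[OF q])
      have "((\<lambda>x. x + t *\<^sub>R w) has_derivative (\<lambda>v. v)) (at x)" by (auto intro!: derivative_eq_intros)
      from has_derivative_compose[OF this d]
      have "((\<lambda>x. q (x + t *\<^sub>R w)) has_derivative (\<lambda>v. Dq (x + t *\<^sub>R w) \<bullet> v)) (at x)" .
      moreover have "shifted x\<^sub>0 \<rho> (t *\<^sub>R w) Dq x = Dq (x + t *\<^sub>R w)"
        using 1 x closure_subset[of \<Omega>] by (intro shifted_eq supp') auto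
      ultimately have "((\<lambda>x. q (x + t *\<^sub>R w)) has_derivative (\<lambda>v. shifted x\<^sub>0 \<rho> (t *\<^sub>R w) Dq x \<bullet> v)) (at x)" by simp
      then show ?thesis
      proof (rule has_derivative_transform_within_open[OF _ open_Int[OF open_domain open_shift_cover(1)]])
        show "x \<in> \<Omega> \<inter> ?U" using x 1 by blast
        show "q (y + t *\<^sub>R w) = shifted x\<^sub>0 \<rho> (t *\<^sub>R w) q y" if "y \<in> \<Omega> \<inter> ?U" for y
          using that closure_subset[of \<Omega>] by (intro shifted_eq[symmetric] supp) auto
      qed
    next
      case 2
      then have "shifted x\<^sub>0 \<rho> (t *\<^sub>R w) Dq x = 0" by (simp add: shifted_def)
      moreover have "(shifted x\<^sub>0 \<rho> (t *\<^sub>R w) q has_derivative (\<lambda>v. 0)) (at x)"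
        by (rule has_derivative_transform_within_open[OF has_derivative_const[of 0] open_shift_cover(2) 2])
          (auto simp: shifted_def)
      ultimately show ?thesis by simp
    qed
  qed
  moreover have "continuous_on (closure \<Omega>) (shifted x\<^sub>0 \<rho> (t *\<^sub>R w) q)"
    by (rule continuous_on_shifted[OF C1_closureD(1)[OF q]]) (use supp in auto)
  moreover have "continuous_on (closure \<Omega>) (shifted x\<^sub>0 \<rho> (t *\<^sub>R w) Dq)"
    by (rule continuous_on_shifted[OF C1_closureD(2)[OF q]]) (use supp' in auto)
  ultimately show ?thesis
    unfolding C1_closure_def by blast
qed

text \<open>Supplies both the uniform bound and the pointwise limit of the difference quotient. The
  value \<open>\<tau> = 0\<close> covers points that miss the support before and after the shift,
  where quotient and gradient both vanish.\<close>

lemma shifted_quotient: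
  assumes q: "C1_closure \<Omega> q Dq"
    and supp: "\<And>x. x \<in> closure \<Omega> \<Longrightarrow> x \<notin> cball x\<^sub>0 \<rho> \<Longrightarrow> q x = 0"
    and x: "x \<in> closure \<Omega>"
  shows "\<exists>\<tau>. 0 \<le> \<tau> \<and> \<tau> < t \<and> x + \<tau> *\<^sub>R w \<in> closure \<Omega> \<and>
    (shifted x\<^sub>0 \<rho> (t *\<^sub>R w) q x - q x) / t = Dq (x + \<tau> *\<^sub>R w) \<bullet> w"
proof (cases "x \<in> ball x\<^sub>0 r \<and> x + t *\<^sub>R w \<in> ball x\<^sub>0 r")
  case True
  then have xb: "x \<in> closure \<Omega> \<inter> ball x\<^sub>0 r" "x + t *\<^sub>R w \<in> ball x\<^sub>0 r" using x by auto
  have 1: "x + \<tau> *\<^sub>R w \<in> closure \<Omega>" if "0 \<le> \<tau>" "\<tau> \<le> t" for \<tau>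
    using segment_in_domain[OF xb, of \<tau>] closure_subset[of \<Omega>] x that by (cases "\<tau> = 0") auto
  have 2: "(q has_derivative (\<lambda>v. Dq (x + \<tau> *\<^sub>R w) \<bullet> v)) (at (x + \<tau> *\<^sub>R w))" if "0 < \<tau>" "\<tau> < t" for \<tau>
    by (rule C1_closureD(3)[OF q segment_in_domain[OF xb]]) (use that in auto)
  obtain \<tau> where "0 < \<tau>" "\<tau> < t" "q (x + t *\<^sub>R w) - q x = t * (Dq (x + \<tau> *\<^sub>R w) \<bullet> w)"
    by (rule mvt_line[OF t_pos 1 C1_closureD(1)[OF q] 2])
  then show ?thesis using t_pos shifted_eq[OF xb supp] 1[of \<tau>] by (intro exI[of _ \<tau>]) auto
next
  case False
  then have "x \<notin> cball x\<^sub>0 \<rho>" "x + t *\<^sub>R w \<notin> cball x\<^sub>0 \<rho>"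
    using back_in_ball[of x] forth_in_ball[of x] in_ball_r by auto
  then have "(shifted x\<^sub>0 \<rho> (t *\<^sub>R w) q x - q x) / t = Dq (x + 0 *\<^sub>R w) \<bullet> w"
    using supp[OF x] C1_closure_gradient_support[OF q open_domain supp x, of x\<^sub>0 \<rho>] by (simp add: shifted_def)
  then show ?thesis using t_pos x by (intro exI[of _ 0]) auto
qed

end

lemma set_integrable_continuous_closure:
  fixes F :: "real^'n \<Rightarrow> real"
  assumes M: "sets M = sets borel" and A: "A \<in> sets borel" "A \<subseteq> closure \<Omega>" "emeasure M A < \<infinity>"
    and "bounded \<Omega>" and F: "continuous_on (closure \<Omega>) F"
  shows "set_integrable M A F"
proof -
  have "compact (closure \<Omega>)" using assms(5) by simp
  from compact_norm_bound[OF this F] obtain B where B: "B \<ge> 0" "\<And>x. x \<in> closure \<Omega> \<Longrightarrow> norm (F x) \<le> B" by blast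
  show ?thesis
    unfolding set_integrable_def
  proof (rule Bochner_Integration.integrable_bound)
    show "integrable M (\<lambda>x. B * indicator A x)"
      by (intro integrable_mult_right integrable_real_indicator) (use A M in auto)
    have "(\<lambda>x. indicator A x *\<^sub>R F x) \<in> borel_measurable borel"
      by (rule borel_measurable_continuous_on_indicator[OF _ continuous_on_subset[OF F A(2)]]) (use A in auto)
    then show "(\<lambda>x. indicator A x *\<^sub>R F x) \<in> borel_measurable M" by (simp add: measurable_cong_sets[OF M])
    have "norm (indicator A x *\<^sub>R F x) \<le> norm (B * indicator A x)" for x
      using B(1) B(2)[of x] A(2) by (auto simp: indicator_def)
    then show "AE x in M. norm (indicator A x *\<^sub>R F x) \<le> norm (B * indicator A x)" by blast
  qed
qed

lemma eventually_inward_shift: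
  assumes "open \<Omega>" "shifts_inward \<Omega> x\<^sub>0 r w" "\<rho> < r" and t: "\<And>n. t n > 0" "t \<longlonglongrightarrow> 0"
  obtains N where "\<And>n. inward_shift \<Omega> x\<^sub>0 r \<rho> w (t (n + N))"
proof -
  have "(\<lambda>n. t n * norm w) \<longlonglongrightarrow> 0" using t tendsto_mult_left_zero by blast
  then have "\<forall>\<^sub>F n in sequentially. t n * norm w < r - \<rho>" using order_tendstoD(2) assms(3) by fastforce
  then obtain N where "\<And>n. n \<ge> N \<Longrightarrow> t n * norm w < r - \<rho>" by (auto simp: eventually_sequentially)
  then show thesis using that[of N] assms by (simp add: inward_shift_def)
qed

text \<open>Here the quotient stays on the differentiable function \<open>q\<close> and nothing is
  translated under the integral. The measure is therefore arbitrary: the result serves Lebesgue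
  measure on the domain and the surface measure on its boundary.\<close>

lemma shifted_quotient_limit:
  fixes \<Omega> :: "(real^'n) set"
  assumes dom: "open \<Omega>" "bounded \<Omega>" and inward: "shifts_inward \<Omega> x\<^sub>0 r w" "\<rho> < r" and t: "\<And>n. t n > 0" "t \<longlonglongrightarrow> 0"
    and q: "C1_closure \<Omega> q Dq" and supp: "\<And>x. x \<in> closure \<Omega> \<Longrightarrow> x \<notin> cball x\<^sub>0 \<rho> \<Longrightarrow> q x = 0"
    and M: "sets M = sets borel" and A: "A \<in> sets borel" "A \<subseteq> closure \<Omega>" "emeasure M A < \<infinity>"
    and F: "continuous_on (closure \<Omega>) F"
  shows "(\<lambda>n. LINT x:A|M. F x * ((shifted x\<^sub>0 \<rho> (t n *\<^sub>R w) q x - q x) / t n)) \<longlonglongrightarrow> (LINT x:A|M. F x * (Dq x \<bullet> w))"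
proof -
  obtain N where N: "\<And>n. inward_shift \<Omega> x\<^sub>0 r \<rho> w (t (n + N))"
    using eventually_inward_shift[OF dom(1) inward t] by blast
  define s where "s n = t (n + N)" for n
  have s: "\<And>n. s n > 0" "s \<longlonglongrightarrow> 0" using t LIMSEQ_ignore_initial_segment[OF t(2), of N] by (auto simp: s_def[abs_def])
  define Q where "Q n x = (shifted x\<^sub>0 \<rho> (s n *\<^sub>R w) q x - q x) / s n" for n x
  have comp: "compact (closure \<Omega>)" using dom by simp
  obtain B where B: "B \<ge> 0" "\<And>x. x \<in> closure \<Omega> \<Longrightarrow> norm (F x) \<le> B" using compact_norm_bound[OF comp F] by blast
  obtain C where C: "C \<ge> 0" "\<And>x. x \<in> closure \<Omega> \<Longrightarrow> norm (Dq x) \<le> C"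
    using compact_norm_bound[OF comp C1_closureD(2)[OF q]] by blast
  have "\<exists>\<tau>. 0 \<le> \<tau> \<and> \<tau> < s n \<and> x + \<tau> *\<^sub>R w \<in> closure \<Omega> \<and> Q n x = Dq (x + \<tau> *\<^sub>R w) \<bullet> w"
    if "x \<in> closure \<Omega>" for n x
    using inward_shift.shifted_quotient[OF N[of n] q supp that] unfolding Q_def s_def by blast
  then have "\<forall>n x. \<exists>\<tau>. x \<in> closure \<Omega> \<longrightarrow> 0 \<le> \<tau> \<and> \<tau> < s n \<and> x + \<tau> *\<^sub>R w \<in> closure \<Omega> \<and> Q n x = Dq (x + \<tau> *\<^sub>R w) \<bullet> w"
    by blast
  then obtain \<tau> where "\<forall>n x. x \<in> closure \<Omega> \<longrightarrow> 0 \<le> \<tau> n x \<and> \<tau> n x < s n \<and> x + \<tau> n x *\<^sub>R w \<in> closure \<Omega> \<and> Q n x = Dq (x + \<tau> n x *\<^sub>R w) \<bullet> w"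
    by metis
  then have \<tau>: "\<And>n x. x \<in> closure \<Omega> \<Longrightarrow> 0 \<le> \<tau> n x" "\<And>n x. x \<in> closure \<Omega> \<Longrightarrow> \<tau> n x < s n"
    "\<And>n x. x \<in> closure \<Omega> \<Longrightarrow> x + \<tau> n x *\<^sub>R w \<in> closure \<Omega>"
    "\<And>n x. x \<in> closure \<Omega> \<Longrightarrow> Q n x = Dq (x + \<tau> n x *\<^sub>R w) \<bullet> w" by blast+
  have Q_lim: "(\<lambda>n. Q n x) \<longlonglongrightarrow> Dq x \<bullet> w" if x: "x \<in> closure \<Omega>" for x
  proof -
    have "(\<lambda>n. \<tau> n x) \<longlonglongrightarrow> 0"
      by (rule tendsto_sandwich[OF _ _ tendsto_const s(2)]) (use \<tau>(1,2)[OF x] in \<open>auto intro!: always_eventually less_imp_le\<close>)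
    then have "(\<lambda>n. x + \<tau> n x *\<^sub>R w) \<longlonglongrightarrow> x + 0 *\<^sub>R w" by (intro tendsto_intros)
    then have "(\<lambda>n. Dq (x + \<tau> n x *\<^sub>R w)) \<longlonglongrightarrow> Dq x"
      using continuous_on_tendsto_compose[OF C1_closureD(2)[OF q] _ x, of "\<lambda>n. x + \<tau> n x *\<^sub>R w" sequentially] \<tau>(3)[OF x] by simp
    then show ?thesis unfolding \<tau>(4)[OF x] by (intro tendsto_intros)
  qed
  have "(\<lambda>n. LINT x:A|M. F x * Q n x) \<longlonglongrightarrow> (LINT x:A|M. F x * (Dq x \<bullet> w))"
    unfolding set_lebesgue_integral_def
  proof (rule integral_dominated_convergence)
    have meas: "(\<lambda>x. indicator A x *\<^sub>R K x) \<in> borel_measurable M" if "continuous_on (closure \<Omega>) K" for K :: "real^'n \<Rightarrow> real"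
    proof -
      have "(\<lambda>x. indicator A x *\<^sub>R K x) \<in> borel_measurable borel"
        by (rule borel_measurable_continuous_on_indicator[OF _ continuous_on_subset[OF that A(2)]]) (use A in auto)
      then show ?thesis by (simp add: measurable_cong_sets[OF M])
    qed
    show "(\<lambda>x. indicator A x *\<^sub>R (F x * (Dq x \<bullet> w))) \<in> borel_measurable M"
      by (intro meas continuous_intros F C1_closureD(2)[OF q])
    have cs: "continuous_on (closure \<Omega>) (shifted x\<^sub>0 \<rho> (s n *\<^sub>R w) q)" for n
      unfolding s_def by (rule inward_shift.continuous_on_shifted[OF N[of n] C1_closureD(1)[OF q]]) (use supp in auto)
    show "(\<lambda>x. indicator A x *\<^sub>R (F x * Q n x)) \<in> borel_measurable M" for n
      unfolding Q_def using s(1)[of n] by (intro meas continuous_intros F C1_closureD(1)[OF q] cs) auto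
    show "integrable M (\<lambda>x. (B * (C * norm w)) * indicator A x)"
      by (intro integrable_mult_right integrable_real_indicator) (use A M in auto)
    show "AE x in M. (\<lambda>n. indicator A x *\<^sub>R (F x * Q n x)) \<longlonglongrightarrow> indicator A x *\<^sub>R (F x * (Dq x \<bullet> w))"
    proof (intro AE_I2)
      fix x show "(\<lambda>n. indicator A x *\<^sub>R (F x * Q n x)) \<longlonglongrightarrow> indicator A x *\<^sub>R (F x * (Dq x \<bullet> w))"
        using Q_lim[of x] A(2) by (cases "x \<in> A") (auto intro!: tendsto_intros)
    qed
    have "norm (indicator A x *\<^sub>R (F x * Q n x)) \<le> (B * (C * norm w)) * indicator A x" for n x
    proof (cases "x \<in> A")
      case True
      then have x: "x \<in> closure \<Omega>" using A(2) by blast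
      have "\<bar>Q n x\<bar> \<le> C * norm w" unfolding \<tau>(4)[OF x] by (rule abs_inner_le[OF C(2)[OF \<tau>(3)[OF x]]])
      then have "\<bar>F x\<bar> * \<bar>Q n x\<bar> \<le> B * (C * norm w)" using B(1) B(2)[OF x] by (intro mult_mono) auto
      then show ?thesis using True by (simp add: abs_mult)
    qed simp
    then show "AE x in M. norm (indicator A x *\<^sub>R (F x * Q n x)) \<le> (B * (C * norm w)) * indicator A x" for n by blast
  qed
  then show ?thesis unfolding Q_def s_def by (rule LIMSEQ_offset)
qed

text \<open>A change of variables moves the difference quotient from \<open>q\<close>, which is
  merely continuous, onto \<open>v\<close>. The points of \<open>\<Omega>\<close> not reached by the
  translation form the boundary layer, and its limit is the surface integral.\<close>

lemma shift_limit:
  fixes \<Omega> :: "(real^'n) set"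
  assumes dom: "open \<Omega>" "bounded \<Omega>" and chart: "shift_chart \<Omega> \<sigma> x\<^sub>0 r w" and \<rho>: "\<rho> < r" and t: "\<And>n. t n > 0" "t \<longlonglongrightarrow> 0"
    and v: "C1_closure \<Omega> v Dv" and q: "continuous_on (closure \<Omega>) q"
    and supp: "\<And>x. x \<in> closure \<Omega> \<Longrightarrow> x \<notin> cball x\<^sub>0 \<rho> \<Longrightarrow> q x = 0"
  shows "(\<lambda>n. LINT x:\<Omega>|lborel. v x * ((shifted x\<^sub>0 \<rho> (t n *\<^sub>R w) q x - q x) / t n)) \<longlonglongrightarrow>
    - (LINT x:\<Omega>|lborel. (Dv x \<bullet> w) * q x) + (LINT x:frontier \<Omega>|\<sigma>. v x * q x * (w \<bullet> outer_normal \<Omega> x))"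
proof -
  have inward: "shifts_inward \<Omega> x\<^sub>0 r w" and layer: "layer_converges \<Omega> \<sigma> x\<^sub>0 r w"
    using chart by (auto simp: shift_chart_def)
  obtain N where N: "\<And>n. inward_shift \<Omega> x\<^sub>0 r \<rho> w (t (n + N))"
    using eventually_inward_shift[OF dom(1) inward \<rho> t] by blast
  define s where "s n = t (n + N)" for n
  have N: "inward_shift \<Omega> x\<^sub>0 r \<rho> w (s n)" for n using N[of n] by (simp add: s_def)
  have s: "\<And>n. s n > 0" "s \<longlonglongrightarrow> 0" using t LIMSEQ_ignore_initial_segment[OF t(2), of N] by (auto simp: s_def[abs_def])
  have comp: "compact (closure \<Omega>)" using dom by simp
  obtain B where B: "B \<ge> 0" "\<And>x. x \<in> closure \<Omega> \<Longrightarrow> norm (q x) \<le> B" using compact_norm_bound[OF comp q] by blast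
  obtain C where C: "C \<ge> 0" "\<And>x. x \<in> closure \<Omega> \<Longrightarrow> norm (Dv x) \<le> C"
    using compact_norm_bound[OF comp C1_closureD(2)[OF v]] by blast
  have vq: "continuous_on (closure \<Omega>) (\<lambda>x. v x * q x)"
    by (intro continuous_intros C1_closureD(1)[OF v] q)
  have emO: "emeasure lborel \<Omega> < \<infinity>" by (rule emeasure_bounded_finite[OF dom(2)])
  have int: "set_integrable lborel \<Omega> K" if "continuous_on (closure \<Omega>) K" for K :: "real^'n \<Rightarrow> real"
    by (rule set_integrable_continuous_closure[OF sets_lborel _ closure_subset emO dom(2) that]) (use dom in auto)
  have cs: "continuous_on (closure \<Omega>) (shifted x\<^sub>0 \<rho> (s n *\<^sub>R w) q)" for n
    by (rule inward_shift.continuous_on_shifted[OF N[of n] q]) (use supp in auto)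
  have c\<Omega>: "\<And>x. x \<in> \<Omega> \<Longrightarrow> x \<in> closure \<Omega>" using closure_subset by blast
  have meas\<Omega>: "(\<lambda>x. indicator \<Omega> x * K x) \<in> borel_measurable borel" if "continuous_on (closure \<Omega>) K" for K :: "real^'n \<Rightarrow> real"
    using borel_measurable_continuous_on_indicator[OF borel_open[OF dom(1)] continuous_on_subset[OF that closure_subset]] by simp
  have [measurable]: "\<Omega> \<in> sets borel" using dom by auto
  \<comment> \<open>\<open>E\<close> collects the points whose backward shift stays in
    \<open>\<Omega>\<close>, with the quotient now on \<open>v\<close>; \<open>Ly\<close> collects
    the layer.\<close>
  define E where "E n x = indicator \<Omega> x * (indicator \<Omega> (x - s n *\<^sub>R w) * ((v (x - s n *\<^sub>R w) - v x) / s n * q x))" for n x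
  define Ly where "Ly n x = indicator {x\<in>\<Omega>. x - s n *\<^sub>R w \<notin> \<Omega>} x * (v x * q x)" for n x
  have mv [measurable]: "(\<lambda>x. indicator \<Omega> x * v x) \<in> borel_measurable borel" and mq [measurable]: "(\<lambda>x. indicator \<Omega> x * q x) \<in> borel_measurable borel"
    by (rule meas\<Omega> C1_closureD(1)[OF v] q)+
  have E_meas: "E n \<in> borel_measurable lborel" for n
  proof -
    have "E n = (\<lambda>x. (indicator \<Omega> (x - s n *\<^sub>R w) * v (x - s n *\<^sub>R w) - (indicator \<Omega> x * v x) * indicator \<Omega> (x - s n *\<^sub>R w)) / s n * (indicator \<Omega> x * q x))"
      by (rule ext) (auto simp: E_def indicator_def)
    moreover have "(\<lambda>x. indicator \<Omega> (x - s n *\<^sub>R w) * v (x - s n *\<^sub>R w)) \<in> borel_measurable borel"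
      using measurable_compose[OF _ mv, of "\<lambda>x. x - s n *\<^sub>R w" borel] by simp
    ultimately show ?thesis by simp
  qed
  \<comment> \<open>Where \<open>E n\<close> is not zero, the backward shift and \<open>x\<close>
    lie in \<open>\<Omega>\<close> and inside the chart. The whole segment between them is then in
    \<open>\<Omega>\<close>, so the mean value theorem applies to \<open>v\<close>.\<close>
  have E_bound: "norm (E n x) \<le> (C * norm w * B) * indicator \<Omega> x" for n x
  proof (cases "x \<in> \<Omega> \<and> x - s n *\<^sub>R w \<in> \<Omega> \<and> x \<in> cball x\<^sub>0 \<rho>")
    case True
    interpret inward_shift \<Omega> x\<^sub>0 r \<rho> w "s n" by (rule N)
    let ?y = "x - s n *\<^sub>R w"
    have y: "?y \<in> closure \<Omega> \<inter> ball x\<^sub>0 r" "?y + s n *\<^sub>R w \<in> ball x\<^sub>0 r"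
      using True back_in_ball[of ?y] in_ball_r[of x] c\<Omega> by auto
    have "?y + \<tau> *\<^sub>R w \<in> closure \<Omega>" if "0 \<le> \<tau>" "\<tau> \<le> s n" for \<tau>
      using segment_in_domain[OF y, of \<tau>] True that c\<Omega> by (cases "\<tau> = 0") auto
    moreover have "(v has_derivative (\<lambda>z. Dv (?y + \<tau> *\<^sub>R w) \<bullet> z)) (at (?y + \<tau> *\<^sub>R w))" if "0 < \<tau>" "\<tau> < s n" for \<tau>
      by (rule C1_closureD(3)[OF v segment_in_domain[OF y]]) (use that in auto)
    ultimately obtain \<tau> where \<tau>: "0 < \<tau>" "\<tau> < s n" "v (?y + s n *\<^sub>R w) - v ?y = s n * (Dv (?y + \<tau> *\<^sub>R w) \<bullet> w)"
      using mvt_line[where x = ?y and w=w and T="closure \<Omega>" and F=v and G=Dv, OF s(1)[of n] _ C1_closureD(1)[OF v]] by blast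
    have "?y + \<tau> *\<^sub>R w \<in> closure \<Omega>" using segment_in_domain[OF y \<tau>(1)] \<tau>(2) c\<Omega> by auto
    from abs_inner_le[OF C(2)[OF this], of w] have D: "\<bar>Dv (?y + \<tau> *\<^sub>R w) \<bullet> w\<bar> \<le> C * norm w" .
    have "v x - v ?y = s n * (Dv (?y + \<tau> *\<^sub>R w) \<bullet> w)" using \<tau>(3) by simp
    then have "(v ?y - v x) / s n = - (Dv (?y + \<tau> *\<^sub>R w) \<bullet> w)" using s(1)[of n] by (simp add: field_simps)
    then have "\<bar>E n x\<bar> = \<bar>Dv (?y + \<tau> *\<^sub>R w) \<bullet> w\<bar> * \<bar>q x\<bar>" using True by (simp add: E_def abs_mult)
    also have "\<dots> \<le> (C * norm w) * B" using D C(1) B(2)[of x] True c\<Omega> by (intro mult_mono) auto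
    finally show ?thesis using True by simp
  next
    case False
    then have "E n x = 0" using supp[of x] c\<Omega>[of x] by (auto simp: E_def indicator_def)
    then show ?thesis using C(1) B(1) by simp
  qed
  have dom_int: "integrable lborel (\<lambda>x. (C * norm w * B) * indicator \<Omega> x)"
    by (intro integrable_mult_right integrable_real_indicator) (use emO dom in auto)
  have E_int: "integrable lborel (E n)" for n
    by (rule Bochner_Integration.integrable_bound[OF dom_int E_meas])
      (use E_bound in \<open>auto intro!: AE_I2 order_trans[OF _ abs_ge_self]\<close>)
  have E_lim: "(\<lambda>n. integral\<^sup>L lborel (E n)) \<longlonglongrightarrow> (\<integral>x. indicator \<Omega> x * (- (Dv x \<bullet> w) * q x) \<partial>lborel)"
  proof (rule integral_dominated_convergence[OF _ E_meas dom_int])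
    have "(\<lambda>x. indicator \<Omega> x * (- (Dv x \<bullet> w) * q x)) \<in> borel_measurable borel"
      by (intro meas\<Omega> continuous_intros C1_closureD(2)[OF v] q)
    then show "(\<lambda>x. indicator \<Omega> x * (- (Dv x \<bullet> w) * q x)) \<in> borel_measurable lborel" by simp
    show "AE x in lborel. norm (E n x) \<le> (C * norm w * B) * indicator \<Omega> x" for n using E_bound by blast
    have "(\<lambda>n. E n x) \<longlonglongrightarrow> indicator \<Omega> x * (- (Dv x \<bullet> w) * q x)" for x
    proof (cases "x \<in> \<Omega>")
      case True
      have "(\<lambda>n. (v (x + s n *\<^sub>R (- w)) - v x) / s n) \<longlonglongrightarrow> Dv x \<bullet> (- w)"
        by (rule difference_quotient_tendsto[OF C1_closureD(3)[OF v True] s])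
      then have "(\<lambda>n. (v (x + s n *\<^sub>R (- w)) - v x) / s n * q x) \<longlonglongrightarrow> (Dv x \<bullet> (- w)) * q x"
        by (rule tendsto_mult_right)
      then have lim: "(\<lambda>n. (v (x - s n *\<^sub>R w) - v x) / s n * q x) \<longlonglongrightarrow> - (Dv x \<bullet> w) * q x"
        by simp
      have "(\<lambda>n. x - s n *\<^sub>R w) \<longlonglongrightarrow> x - 0 *\<^sub>R w" by (intro tendsto_intros s)
      then have "\<forall>\<^sub>F n in sequentially. x - s n *\<^sub>R w \<in> \<Omega>"
        using topological_tendstoD[OF _ dom(1)] True by fastforce
      then have "\<forall>\<^sub>F n in sequentially. (v (x - s n *\<^sub>R w) - v x) / s n * q x = E n x"
        by eventually_elim (use True in \<open>simp add: E_def\<close>)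
      from Lim_transform_eventually[OF lim this] show ?thesis using True by simp
    qed (simp add: E_def)
    then show "AE x in lborel. (\<lambda>n. E n x) \<longlonglongrightarrow> indicator \<Omega> x * (- (Dv x \<bullet> w) * q x)" by blast
  qed
  have L_lim: "(\<lambda>n. integral\<^sup>L lborel (Ly n) / s n) \<longlonglongrightarrow> - (LINT x:frontier \<Omega>|\<sigma>. v x * q x * (w \<bullet> outer_normal \<Omega> x))"
    unfolding Ly_def
    by (rule layer[unfolded layer_converges_def, rule_format, where \<rho>=\<rho>]) (use vq supp \<rho> s in auto)
  have L_int: "integrable lborel (Ly n)" for n
  proof (rule Bochner_Integration.integrable_bound[OF int[OF vq, unfolded set_integrable_def]])
    have "Ly n = (\<lambda>x. (1 - indicator \<Omega> (x - s n *\<^sub>R w)) * ((indicator \<Omega> x * v x) * (indicator \<Omega> x * q x)))"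
      by (rule ext) (auto simp: Ly_def indicator_def)
    then show "Ly n \<in> borel_measurable lborel" by simp
    have "norm (Ly n x) \<le> norm (indicator \<Omega> x *\<^sub>R (v x * q x))" for x by (auto simp: Ly_def indicator_def)
    then show "AE x in lborel. norm (Ly n x) \<le> norm (indicator \<Omega> x *\<^sub>R (v x * q x))" by blast
  qed
  have key: "(LINT x:\<Omega>|lborel. v x * ((shifted x\<^sub>0 \<rho> (s n *\<^sub>R w) q x - q x) / s n)) = integral\<^sup>L lborel (E n) - integral\<^sup>L lborel (Ly n) / s n" for n
  proof -
    interpret inward_shift \<Omega> x\<^sub>0 r \<rho> w "s n" by (rule N)
    define S where "S x = indicator \<Omega> x * (v x * shifted x\<^sub>0 \<rho> (s n *\<^sub>R w) q x)" for x
    have S_cont: "continuous_on (closure \<Omega>) (\<lambda>x. v x * shifted x\<^sub>0 \<rho> (s n *\<^sub>R w) q x)"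
      by (intro continuous_intros C1_closureD(1)[OF v] cs)
    have S_meas: "S \<in> borel_measurable borel" unfolding S_def[abs_def] by (rule meas\<Omega>[OF S_cont])
    have S_int: "integrable lborel S" using int[OF S_cont] by (simp add: set_integrable_def S_def[abs_def])
    have "(\<integral>x. S x \<partial>lborel) = (\<integral>x. S (- (s n *\<^sub>R w) + x) \<partial>lborel)"
      by (subst lborel_distr_plus[symmetric, of "- (s n *\<^sub>R w)"], rule integral_distr) (use S_meas in auto)
    \<comment> \<open>If the shifted point is in \<open>\<Omega>\<close>, the first two terms add up
      to the translated product and the last is 0; on the layer, the last two cancel and the first
      is 0.\<close>
    moreover have "S (- (s n *\<^sub>R w) + x) = s n * E n x + indicator \<Omega> x * (v x * q x) - Ly n x" for x
    proof -
      have "S (x - s n *\<^sub>R w) = indicator \<Omega> x * indicator \<Omega> (x - s n *\<^sub>R w) * (v (x - s n *\<^sub>R w) * q x)"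
      proof (cases "x \<in> cball x\<^sub>0 \<rho>")
        case True
        have "x \<in> \<Omega>" if "x - s n *\<^sub>R w \<in> \<Omega>"
          using shift_in_domain[of "x - s n *\<^sub>R w"] back_in_ball[of "x - s n *\<^sub>R w"] in_ball_r[OF True] True that c\<Omega> by auto
        then show ?thesis using True by (auto simp: S_def shifted_def indicator_def)
      next
        case False
        then show ?thesis using supp[of x] c\<Omega>[of x] by (auto simp: S_def shifted_def indicator_def)
      qed
      also have "\<dots> = s n * E n x + indicator \<Omega> x * (v x * q x) - Ly n x"
        using s(1)[of n] by (auto simp: E_def Ly_def indicator_def field_simps)
      finally show ?thesis by simp
    qed
    ultimately have "(\<integral>x. S x \<partial>lborel) = (\<integral>x. s n * E n x + indicator \<Omega> x * (v x * q x) - Ly n x \<partial>lborel)" by simp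
    also have "\<dots> = s n * integral\<^sup>L lborel (E n) + (\<integral>x. indicator \<Omega> x * (v x * q x) \<partial>lborel) - integral\<^sup>L lborel (Ly n)"
      using E_int[of n] L_int[of n] int[OF vq] by (simp add: set_integrable_def)
    finally have "(\<integral>x. S x \<partial>lborel) - (\<integral>x. indicator \<Omega> x * (v x * q x) \<partial>lborel) = s n * integral\<^sup>L lborel (E n) - integral\<^sup>L lborel (Ly n)" by simp
    moreover have "(LINT x:\<Omega>|lborel. v x * ((shifted x\<^sub>0 \<rho> (s n *\<^sub>R w) q x - q x) / s n))
       = (\<integral>x. (S x - indicator \<Omega> x * (v x * q x)) / s n \<partial>lborel)"
      unfolding set_lebesgue_integral_def S_def
      by (rule Bochner_Integration.integral_cong) (auto simp: right_diff_distrib)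
    moreover have "\<dots> = ((\<integral>x. S x \<partial>lborel) - (\<integral>x. indicator \<Omega> x * (v x * q x) \<partial>lborel)) / s n"
      using S_int int[OF vq] by (simp add: set_integrable_def)
    ultimately show ?thesis using s(1)[of n] by (simp add: field_simps)
  qed
  have "(\<lambda>n. integral\<^sup>L lborel (E n) - integral\<^sup>L lborel (Ly n) / s n) \<longlonglongrightarrow>
      (\<integral>x. indicator \<Omega> x * (- (Dv x \<bullet> w) * q x) \<partial>lborel) - (- (LINT x:frontier \<Omega>|\<sigma>. v x * q x * (w \<bullet> outer_normal \<Omega> x)))"
    by (rule tendsto_diff[OF E_lim L_lim])
  moreover have "(\<integral>x. indicator \<Omega> x * (- (Dv x \<bullet> w) * q x) \<partial>lborel) = - (LINT x:\<Omega>|lborel. (Dv x \<bullet> w) * q x)"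
    by (simp add: set_lebesgue_integral_def)
  ultimately have "(\<lambda>n. LINT x:\<Omega>|lborel. v x * ((shifted x\<^sub>0 \<rho> (s n *\<^sub>R w) q x - q x) / s n)) \<longlonglongrightarrow>
    - (LINT x:\<Omega>|lborel. (Dv x \<bullet> w) * q x) + (LINT x:frontier \<Omega>|\<sigma>. v x * q x * (w \<bullet> outer_normal \<Omega> x))"
    unfolding key by simp
  then show ?thesis unfolding s_def by (rule LIMSEQ_offset)
qed

subsection \<open>Integration by parts and the differentiated equation\<close>

locale regular_domain =
  fixes \<Omega> :: "(real^'n) set" and \<sigma> :: "(real^'n) measure"
  assumes domain: "smooth_bounded_domain \<Omega>" and sigma: "surface_measure (frontier \<Omega>) \<sigma>"
begin

lemma open_\<Omega>: "open \<Omega>" and bounded_\<Omega>: "bounded \<Omega>" and compact_closure: "compact (closure \<Omega>)"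
  using domain by (auto simp: smooth_bounded_domain_def)

lemma sets_surface: "sets \<sigma> = sets borel"
  using sigma by (simp add: surface_measure_def)

lemma compact_frontier: "compact (frontier \<Omega>)"
  using bounded_\<Omega> by (simp add: compact_frontier_bounded)

lemma frontier_sub: "frontier \<Omega> \<subseteq> closure \<Omega>"
  by (simp add: frontier_def)

lemma boundary_chart:
  assumes "x\<^sub>0 \<in> frontier \<Omega>"
  obtains r i g s where "surface_chart \<Omega> x\<^sub>0 r i g s \<sigma>"
proof -
  obtain r i g s where "r > 0" "s \<in> {-1, 1::real}" "smooth_function g" "indep_coord i g"
    "\<Omega> \<inter> ball x\<^sub>0 r = {x \<in> ball x\<^sub>0 r. 0 < s * (x $ i - g x)}"
    using domain[unfolded smooth_bounded_domain_def, THEN conjunct2, THEN conjunct2, THEN conjunct2, THEN conjunct2,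
        THEN bspec[OF _ assms]] by blast
  then have "surface_chart \<Omega> x\<^sub>0 r i g s \<sigma>"
    using open_\<Omega> sigma bounded_\<Omega>
    by (auto simp: surface_chart_def graph_chart_def surface_chart_axioms_def)
  then show thesis by (rule that)
qed

text \<open>Each \<open>e\<^sub>j\<close> is the difference \<open>(p + e\<^sub>j) - p\<close> of two directions pointing into \<open>\<Omega>\<close>.\<close>

definition axis_chart :: "real^'n \<Rightarrow> real \<Rightarrow> bool" where
  "axis_chart x\<^sub>0 r \<longleftrightarrow> (\<exists>p. shift_chart \<Omega> \<sigma> x\<^sub>0 r p \<and> (\<forall>j. shift_chart \<Omega> \<sigma> x\<^sub>0 r (p + axis j 1)))"

lemma axis_chart_boundary:
  assumes "surface_chart \<Omega> x\<^sub>0 r i g s \<sigma>"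
  shows "axis_chart x\<^sub>0 r"
proof -
  interpret surface_chart \<Omega> x\<^sub>0 r i g s \<sigma> by fact
  obtain M where M: "M \<ge> 0" "\<And>x. x \<in> cball x\<^sub>0 r \<Longrightarrow> norm (grad UNIV g x) \<le> M"
    using compact_norm_bound[OF compact_cball continuous_on_g(2)] by blast
  \<comment> \<open>\<open>D\<Phi> x \<bullet> p\<close> is exactly \<open>M + 2\<close>, while
    \<open>D\<Phi> x \<bullet> axis j 1\<close> is at least \<open>- (1 + M)\<close>; so
    \<open>p\<close> and all \<open>p + axis j 1\<close> have a positive product with
    \<open>D\<Phi> x\<close>.\<close>
  define p where "p = (s * (M + 2)) *\<^sub>R (axis i 1 :: real^'n)"
  have comp: "D\<Phi> x \<bullet> axis j 1 = s * ((if j = i then 1 else 0) - grad UNIV g x $ j)" for x j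
    by (simp add: D\<Phi>_def inner_axis, simp add: axis_def)
  have Dp: "D\<Phi> x \<bullet> p = M + 2" for x
  proof -
    have "D\<Phi> x \<bullet> p = s * s * (M + 2)" by (simp add: p_def comp grad_g_i)
    then show ?thesis by (simp only: s_sq mult_1_left)
  qed
  have De: "D\<Phi> x \<bullet> axis j 1 \<ge> - (1 + M)" if "x \<in> ball x\<^sub>0 r" for x j
  proof -
    have "\<bar>grad UNIV g x $ j\<bar> \<le> M" using M(2)[of x] that component_le_norm_cart[of "grad UNIV g x" j] by auto
    then show ?thesis using sign by (auto simp: comp)
  qed
  have "shift_chart \<Omega> \<sigma> x\<^sub>0 r p"
    by (rule shift_chart_graph) (use Dp M in simp)
  moreover have "shift_chart \<Omega> \<sigma> x\<^sub>0 r (p + axis j 1)" for j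
    by (rule shift_chart_graph) (use Dp De[of _ j] M in \<open>force simp: inner_add_right\<close>)
  ultimately show ?thesis unfolding axis_chart_def by blast
qed

lemma axis_chart_exists:
  assumes "x\<^sub>0 \<in> closure \<Omega>"
  obtains r where "r > 0" "axis_chart x\<^sub>0 r"
proof (cases "x\<^sub>0 \<in> \<Omega>")
  case True
  then obtain r where "r > 0" "ball x\<^sub>0 r \<subseteq> \<Omega>" using open_\<Omega> open_contains_ball by blast
  then show thesis using that shift_chart_interior[OF _ open_\<Omega>] unfolding axis_chart_def by blast
next
  case False
  then have "x\<^sub>0 \<in> frontier \<Omega>" using assms open_\<Omega> by (simp add: frontier_def interior_open)
  then obtain r i g s where c: "surface_chart \<Omega> x\<^sub>0 r i g s \<sigma>" using boundary_chart by blast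
  then have "r > 0" by (simp add: surface_chart_def graph_chart_def)
  then show thesis using that axis_chart_boundary[OF c] by blast
qed

lemma emeasure_frontier_finite: "emeasure \<sigma> (frontier \<Omega>) < \<infinity>"
proof -
  have "\<forall>x\<in>frontier \<Omega>. \<exists>r. r > 0 \<and> emeasure \<sigma> (frontier \<Omega> \<inter> cball x r) < \<infinity>"
  proof
    fix x assume "x \<in> frontier \<Omega>"
    then obtain r i g s where "surface_chart \<Omega> x r i g s \<sigma>" using boundary_chart by blast
    then interpret surface_chart \<Omega> x r i g s \<sigma> .
    show "\<exists>r. r > 0 \<and> emeasure \<sigma> (frontier \<Omega> \<inter> cball x r) < \<infinity>"
      using emeasure_surface_finite[of "r / 2"] r_pos by (intro exI[of _ "r / 2"]) auto
  qed
  then obtain R where R: "\<And>x. x \<in> frontier \<Omega> \<Longrightarrow> R x > 0" "\<And>x. x \<in> frontier \<Omega> \<Longrightarrow> emeasure \<sigma> (frontier \<Omega> \<inter> cball x (R x)) < \<infinity>"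
    by metis
  have "frontier \<Omega> \<subseteq> (\<Union>x\<in>frontier \<Omega>. ball x (R x))" using R(1) by force
  from compactE_image[OF compact_frontier _ this]
  obtain C where C: "C \<subseteq> frontier \<Omega>" "finite C" "frontier \<Omega> \<subseteq> (\<Union>x\<in>C. ball x (R x))" by auto
  have "emeasure \<sigma> (frontier \<Omega>) \<le> emeasure \<sigma> (\<Union>x\<in>C. frontier \<Omega> \<inter> cball x (R x))"
  proof (rule emeasure_mono)
    show "frontier \<Omega> \<subseteq> (\<Union>x\<in>C. frontier \<Omega> \<inter> cball x (R x))"
    proof
      fix y assume y: "y \<in> frontier \<Omega>"
      then obtain x where "x \<in> C" "y \<in> ball x (R x)" using C(3) by blast
      then show "y \<in> (\<Union>x\<in>C. frontier \<Omega> \<inter> cball x (R x))" using y ball_subset_cball by blast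
    qed
    show "(\<Union>x\<in>C. frontier \<Omega> \<inter> cball x (R x)) \<in> sets \<sigma>"
      unfolding sets_surface by (intro sets.finite_UN C(2) sets.Int borel_closed) auto
  qed
  also have "\<dots> \<le> (\<Sum>x\<in>C. emeasure \<sigma> (frontier \<Omega> \<inter> cball x (R x)))"
    by (rule emeasure_subadditive_finite[OF C(2)]) (auto simp: sets_surface)
  also have "\<dots> < \<infinity>" using C(1,2) R(2) by (auto simp: less_top)
  finally show ?thesis .
qed

abbreviation "\<nu> \<equiv> outer_normal \<Omega>"

lemma continuous_on_\<nu>: "continuous_on (frontier \<Omega>) \<nu>"
proof (rule continuous_on_locally)
  fix x assume "x \<in> frontier \<Omega>"
  then obtain r i g s where "surface_chart \<Omega> x r i g s \<sigma>" using boundary_chart by blast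
  then interpret surface_chart \<Omega> x r i g s \<sigma> .
  have "continuous_on (frontier \<Omega> \<inter> ball x r) (\<lambda>y. - (D\<Phi> y /\<^sub>R norm (D\<Phi> y)))"
    using norm_D\<Phi>_pos by (intro continuous_intros continuous_on_\<Phi>(2)) auto
  then have "continuous_on (frontier \<Omega> \<inter> ball x r) \<nu>"
    by (rule continuous_on_eq) (use outer_normal_eq in auto)
  then show "\<exists>U. open U \<and> x \<in> U \<and> continuous_on (frontier \<Omega> \<inter> U) \<nu>"
    using r_pos by (intro exI[of _ "ball x r"]) auto
qed

lemma set_integrable_\<Omega>: "continuous_on (closure \<Omega>) F \<Longrightarrow> set_integrable lborel \<Omega> F" for F :: "real^'n \<Rightarrow> real"
  by (rule set_integrable_continuous_closure[where \<Omega>=\<Omega>])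
    (use open_\<Omega> bounded_\<Omega> emeasure_bounded_finite[OF bounded_\<Omega>] closure_subset in auto)

lemma set_integrable_frontier: "continuous_on (frontier \<Omega>) F \<Longrightarrow> set_integrable \<sigma> (frontier \<Omega>) F" for F :: "real^'n \<Rightarrow> real"
  by (rule set_integrable_continuous_closure[where \<Omega>="frontier \<Omega>"])
    (use compact_frontier sets_surface emeasure_frontier_finite in \<open>auto simp: compact_imp_bounded\<close>)

abbreviation dom_int :: "(real^'n \<Rightarrow> real) \<Rightarrow> real" where "dom_int F \<equiv> (LINT x:\<Omega>|lborel. F x)"
abbreviation bd_int :: "(real^'n \<Rightarrow> real) \<Rightarrow> real" where "bd_int F \<equiv> (LINT x:frontier \<Omega>|\<sigma>. F x)"

lemma dom_int_add: "continuous_on (closure \<Omega>) F \<Longrightarrow> continuous_on (closure \<Omega>) G \<Longrightarrow> dom_int (\<lambda>x. F x + G x) = dom_int F + dom_int G"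
  and dom_int_diff: "continuous_on (closure \<Omega>) F \<Longrightarrow> continuous_on (closure \<Omega>) G \<Longrightarrow> dom_int (\<lambda>x. F x - G x) = dom_int F - dom_int G"
  by (auto intro!: set_integral_add set_integral_diff set_integrable_\<Omega>)

lemma bd_int_add: "continuous_on (frontier \<Omega>) F \<Longrightarrow> continuous_on (frontier \<Omega>) G \<Longrightarrow> bd_int (\<lambda>x. F x + G x) = bd_int F + bd_int G"
  and bd_int_diff: "continuous_on (frontier \<Omega>) F \<Longrightarrow> continuous_on (frontier \<Omega>) G \<Longrightarrow> bd_int (\<lambda>x. F x - G x) = bd_int F - bd_int G"
  by (auto intro!: set_integral_add set_integral_diff set_integrable_frontier)

lemma dom_int_sum:
  assumes "finite I" "\<And>i. i \<in> I \<Longrightarrow> continuous_on (closure \<Omega>) (F i)"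
  shows "dom_int (\<lambda>x. \<Sum>i\<in>I. F i x) = (\<Sum>i\<in>I. dom_int (F i))"
  using assms
proof (induction I rule: finite_induct)
  case (insert i I)
  then show ?case by (simp add: dom_int_add continuous_on_sum)
qed simp

lemma bd_int_sum:
  assumes "finite I" "\<And>i. i \<in> I \<Longrightarrow> continuous_on (frontier \<Omega>) (F i)"
  shows "bd_int (\<lambda>x. \<Sum>i\<in>I. F i x) = (\<Sum>i\<in>I. bd_int (F i))"
  using assms
proof (induction I rule: finite_induct)
  case (insert i I)
  then show ?case by (simp add: bd_int_add continuous_on_sum)
qed simp

lemma dom_int_cong: "(\<And>x. x \<in> \<Omega> \<Longrightarrow> F x = G x) \<Longrightarrow> dom_int F = dom_int G"
  by (rule set_lebesgue_integral_cong) (use open_\<Omega> in auto)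

lemma bd_int_cong: "(\<And>x. x \<in> frontier \<Omega> \<Longrightarrow> F x = G x) \<Longrightarrow> bd_int F = bd_int G"
  by (rule set_lebesgue_integral_cong) (auto simp: sets_surface)

lemma C1_continuous_frontier:
  assumes "C1_closure \<Omega> q Dq" shows "continuous_on (frontier \<Omega>) q" "continuous_on (frontier \<Omega>) Dq"
  using C1_closureD(1,2)[OF assms] continuous_on_subset[OF _ frontier_sub] by auto

text \<open>One sequence is evaluated in two ways: with the difference quotient left on
  \<open>q\<close>, and with the quotient moved onto \<open>v\<close>.\<close>

lemma integration_by_parts_inward:
  assumes chart: "shift_chart \<Omega> \<sigma> x\<^sub>0 r w" and \<rho>: "\<rho> < r"
    and v: "C1_closure \<Omega> v Dv" and q: "C1_closure \<Omega> q Dq"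
    and supp: "\<And>x. x \<in> closure \<Omega> \<Longrightarrow> x \<notin> cball x\<^sub>0 \<rho> \<Longrightarrow> q x = 0"
  shows "dom_int (\<lambda>x. v x * (Dq x \<bullet> w)) = - dom_int (\<lambda>x. (Dv x \<bullet> w) * q x) + bd_int (\<lambda>x. v x * q x * (w \<bullet> \<nu> x))"
proof -
  have t: "\<And>n. inverse (real (Suc n)) > 0" "(\<lambda>n. inverse (real (Suc n))) \<longlonglongrightarrow> 0"
    using LIMSEQ_inverse_real_of_nat by auto
  have "(\<lambda>n. dom_int (\<lambda>x. v x * ((shifted x\<^sub>0 \<rho> (inverse (real (Suc n)) *\<^sub>R w) q x - q x) / inverse (real (Suc n)))))
      \<longlonglongrightarrow> dom_int (\<lambda>x. v x * (Dq x \<bullet> w))"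
    by (rule shifted_quotient_limit[OF open_\<Omega> bounded_\<Omega> _ \<rho> t q supp _ _ _ _ C1_closureD(1)[OF v]])
      (use chart open_\<Omega> closure_subset emeasure_bounded_finite[OF bounded_\<Omega>] in \<open>auto simp: shift_chart_def\<close>)
  moreover have "(\<lambda>n. dom_int (\<lambda>x. v x * ((shifted x\<^sub>0 \<rho> (inverse (real (Suc n)) *\<^sub>R w) q x - q x) / inverse (real (Suc n)))))
      \<longlonglongrightarrow> - dom_int (\<lambda>x. (Dv x \<bullet> w) * q x) + bd_int (\<lambda>x. v x * q x * (w \<bullet> \<nu> x))"
    by (rule shift_limit[OF open_\<Omega> bounded_\<Omega> chart \<rho> t v C1_closureD(1)[OF q] supp])
  ultimately show ?thesis by (rule LIMSEQ_unique)
qed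

lemma integration_by_parts_local:
  assumes chart: "axis_chart x\<^sub>0 r" and \<rho>: "\<rho> < r"
    and v: "C1_closure \<Omega> v Dv" and q: "C1_closure \<Omega> q Dq"
    and supp: "\<And>x. x \<in> closure \<Omega> \<Longrightarrow> x \<notin> cball x\<^sub>0 \<rho> \<Longrightarrow> q x = 0"
  shows "dom_int (\<lambda>x. v x * (Dq x $ j)) = - dom_int (\<lambda>x. (Dv x $ j) * q x) + bd_int (\<lambda>x. v x * q x * (\<nu> x $ j))"
proof -
  obtain p where p: "shift_chart \<Omega> \<sigma> x\<^sub>0 r p" "shift_chart \<Omega> \<sigma> x\<^sub>0 r (p + axis j 1)"
    using chart by (auto simp: axis_chart_def)
  note P = integration_by_parts_inward[OF p(1) \<rho> v q supp] integration_by_parts_inward[OF p(2) \<rho> v q supp]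
  note c = C1_closureD(1,2)[OF v] C1_closureD(1,2)[OF q]
  note cf = C1_continuous_frontier[OF v] C1_continuous_frontier[OF q] continuous_on_\<nu>
  have 1: "dom_int (\<lambda>x. v x * (Dq x \<bullet> (p + axis j 1))) = dom_int (\<lambda>x. v x * (Dq x \<bullet> p)) + dom_int (\<lambda>x. v x * (Dq x $ j))"
    by (simp only: inner_add_right distrib_left inner_axis inner_real_def mult_1_right) (intro dom_int_add continuous_intros c)
  have 2: "dom_int (\<lambda>x. (Dv x \<bullet> (p + axis j 1)) * q x) = dom_int (\<lambda>x. (Dv x \<bullet> p) * q x) + dom_int (\<lambda>x. (Dv x $ j) * q x)"
    by (simp only: inner_add_right distrib_right inner_axis inner_real_def mult_1_right) (intro dom_int_add continuous_intros c)
  have 3: "bd_int (\<lambda>x. v x * q x * ((p + axis j 1) \<bullet> \<nu> x)) = bd_int (\<lambda>x. v x * q x * (p \<bullet> \<nu> x)) + bd_int (\<lambda>x. v x * q x * (\<nu> x $ j))"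
    by (simp only: inner_add_left distrib_left inner_axis' inner_real_def mult_1_left) (intro bd_int_add continuous_intros cf)
  show ?thesis using P 1 2 3 by simp
qed

text \<open>
  For a weak solution of \<open>div V + l = 0\<close> with flux \<open>- k\<close> through the boundary, the difference quotient of
  the test function in an inward direction is again a test function. Its limit is the equation
  differentiated in that direction, in a form that involves no second derivative of the test function.
\<close>

definition weak_flux :: "('n \<Rightarrow> real^'n \<Rightarrow> real) \<Rightarrow> (real^'n \<Rightarrow> real) \<Rightarrow> (real^'n \<Rightarrow> real) \<Rightarrow> bool" where
  "weak_flux V k l \<longleftrightarrow> (\<forall>\<psi> D\<psi>. C1_closure \<Omega> \<psi> D\<psi> \<longrightarrow>
     dom_int (\<lambda>x. \<Sum>j\<in>UNIV. V j x * D\<psi> x $ j) + bd_int (\<lambda>x. k x * \<psi> x) - dom_int (\<lambda>x. l x * \<psi> x) = 0)"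

lemma differentiated_equation_inward:
  assumes chart: "shift_chart \<Omega> \<sigma> x\<^sub>0 r w" and \<rho>: "\<rho> < r"
    and weak: "weak_flux V k l"
    and V: "\<And>j. C1_closure \<Omega> (V j) (DV j)" and k: "continuous_on (closure \<Omega>) k" and l: "C1_closure \<Omega> l Dl"
    and \<psi>: "C1_closure \<Omega> \<psi> D\<psi>" and supp: "\<And>x. x \<in> closure \<Omega> \<Longrightarrow> x \<notin> cball x\<^sub>0 \<rho> \<Longrightarrow> \<psi> x = 0"
  shows "dom_int (\<lambda>x. \<Sum>j\<in>UNIV. (DV j x \<bullet> w) * D\<psi> x $ j) - dom_int (\<lambda>x. (Dl x \<bullet> w) * \<psi> x)
    = bd_int (\<lambda>x. (\<Sum>j\<in>UNIV. V j x * D\<psi> x $ j) * (w \<bullet> \<nu> x)) + bd_int (\<lambda>x. k x * (D\<psi> x \<bullet> w)) - bd_int (\<lambda>x. l x * \<psi> x * (w \<bullet> \<nu> x))"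
proof -
  have inward: "shifts_inward \<Omega> x\<^sub>0 r w" using chart by (simp add: shift_chart_def)
  define t0 where "t0 n = inverse (real (Suc n))" for n
  have t0: "\<And>n. t0 n > 0" "t0 \<longlonglongrightarrow> 0"
    using LIMSEQ_inverse_real_of_nat by (auto simp: t0_def[abs_def])
  obtain N where N: "\<And>n. inward_shift \<Omega> x\<^sub>0 r \<rho> w (t0 (n + N))"
    using eventually_inward_shift[OF open_\<Omega> inward \<rho> t0] by blast
  define t where "t n = t0 (n + N)" for n
  have t: "\<And>n. t n > 0" "t \<longlonglongrightarrow> 0" using t0 LIMSEQ_ignore_initial_segment[OF t0(2), of N] by (auto simp: t_def[abs_def])
  have N: "inward_shift \<Omega> x\<^sub>0 r \<rho> w (t n)" for n using N[of n] by (simp add: t_def)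
  have suppD: "D\<psi> x = 0" if "x \<in> closure \<Omega>" "x \<notin> cball x\<^sub>0 \<rho>" for x
    by (rule C1_closure_gradient_support[OF \<psi> open_\<Omega> supp]) (use that in auto)
  define Q where "Q n x = (shifted x\<^sub>0 \<rho> (t n *\<^sub>R w) \<psi> x - \<psi> x) / t n" for n x
  define Q' where "Q' n j x = (shifted x\<^sub>0 \<rho> (t n *\<^sub>R w) (\<lambda>x. D\<psi> x $ j) x - D\<psi> x $ j) / t n" for n j x
  have Q_C1: "C1_closure \<Omega> (Q n) (\<lambda>x. \<chi> j. Q' n j x)" for n
  proof -
    have "C1_closure \<Omega> (shifted x\<^sub>0 \<rho> (t n *\<^sub>R w) \<psi>) (shifted x\<^sub>0 \<rho> (t n *\<^sub>R w) D\<psi>)"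
      by (rule inward_shift.C1_closure_shifted[OF N \<psi> supp])
    from C1_closure_mult[OF C1_closure_const[of \<Omega> "1 / t n"] C1_closure_add[OF this C1_closure_mult[OF C1_closure_const[of \<Omega> "-1"] \<psi>]]]
    show ?thesis
      by (rule C1_closure_cong)
        (auto simp: Q_def Q'_def shifted_def vec_eq_iff open_\<Omega> diff_divide_distrib divide_inverse algebra_simps)
  qed
  have Q'_cont: "continuous_on (closure \<Omega>) (Q' n j)" for n j
    using continuous_on_component[OF C1_closureD(2)[OF Q_C1[of n]], of j] by simp
  have eq: "(\<Sum>j\<in>UNIV. dom_int (\<lambda>x. V j x * Q' n j x)) + bd_int (\<lambda>x. k x * Q n x) - dom_int (\<lambda>x. l x * Q n x) = 0" for n
  proof -
    have "dom_int (\<lambda>x. \<Sum>j\<in>UNIV. V j x * Q' n j x) = (\<Sum>j\<in>UNIV. dom_int (\<lambda>x. V j x * Q' n j x))"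
      by (rule dom_int_sum) (auto intro!: continuous_intros C1_closureD(1)[OF V] Q'_cont)
    then show ?thesis using weak[unfolded weak_flux_def, rule_format, OF Q_C1[of n]] by simp
  qed
  \<comment> \<open>\<open>Q' n j\<close> is the quotient of a component of \<open>D\<psi>\<close>,
    which is merely continuous. \<open>shift_limit\<close> puts the derivative on \<open>V j\<close>
    instead, so no second derivative of \<open>\<psi>\<close> appears.\<close>
  have "(\<lambda>n. dom_int (\<lambda>x. V j x * Q' n j x)) \<longlonglongrightarrow> - dom_int (\<lambda>x. (DV j x \<bullet> w) * D\<psi> x $ j) + bd_int (\<lambda>x. V j x * D\<psi> x $ j * (w \<bullet> \<nu> x))" for j
    unfolding Q'_def
    by (rule shift_limit[OF open_\<Omega> bounded_\<Omega> chart \<rho> t V])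
      (auto simp: suppD intro!: continuous_intros C1_closureD(2)[OF \<psi>])
  then have "(\<lambda>n. \<Sum>j\<in>UNIV. dom_int (\<lambda>x. V j x * Q' n j x)) \<longlonglongrightarrow>
      (\<Sum>j\<in>UNIV. - dom_int (\<lambda>x. (DV j x \<bullet> w) * D\<psi> x $ j) + bd_int (\<lambda>x. V j x * D\<psi> x $ j * (w \<bullet> \<nu> x)))"
    by (intro tendsto_sum)
  \<comment> \<open>On the boundary the quotient has to stay on \<open>\<psi>\<close>, since the
    surface measure is not invariant under translation.\<close>
  moreover have "(\<lambda>n. bd_int (\<lambda>x. k x * Q n x)) \<longlonglongrightarrow> bd_int (\<lambda>x. k x * (D\<psi> x \<bullet> w))"
    unfolding Q_def
    by (rule shifted_quotient_limit[OF open_\<Omega> bounded_\<Omega> inward \<rho> t \<psi> supp sets_surface _ frontier_sub emeasure_frontier_finite k])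
      auto
  moreover have "(\<lambda>n. dom_int (\<lambda>x. l x * Q n x)) \<longlonglongrightarrow> - dom_int (\<lambda>x. (Dl x \<bullet> w) * \<psi> x) + bd_int (\<lambda>x. l x * \<psi> x * (w \<bullet> \<nu> x))"
    unfolding Q_def by (rule shift_limit[OF open_\<Omega> bounded_\<Omega> chart \<rho> t l C1_closureD(1)[OF \<psi>] supp])
  ultimately have "(\<lambda>n. (\<Sum>j\<in>UNIV. dom_int (\<lambda>x. V j x * Q' n j x)) + bd_int (\<lambda>x. k x * Q n x) - dom_int (\<lambda>x. l x * Q n x)) \<longlonglongrightarrow>
      (\<Sum>j\<in>UNIV. - dom_int (\<lambda>x. (DV j x \<bullet> w) * D\<psi> x $ j) + bd_int (\<lambda>x. V j x * D\<psi> x $ j * (w \<bullet> \<nu> x)))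
      + bd_int (\<lambda>x. k x * (D\<psi> x \<bullet> w)) - (- dom_int (\<lambda>x. (Dl x \<bullet> w) * \<psi> x) + bd_int (\<lambda>x. l x * \<psi> x * (w \<bullet> \<nu> x)))"
    by (intro tendsto_add tendsto_diff)
  then have "(\<Sum>j\<in>UNIV. - dom_int (\<lambda>x. (DV j x \<bullet> w) * D\<psi> x $ j) + bd_int (\<lambda>x. V j x * D\<psi> x $ j * (w \<bullet> \<nu> x)))
      + bd_int (\<lambda>x. k x * (D\<psi> x \<bullet> w)) - (- dom_int (\<lambda>x. (Dl x \<bullet> w) * \<psi> x) + bd_int (\<lambda>x. l x * \<psi> x * (w \<bullet> \<nu> x))) = 0"
    unfolding eq using LIMSEQ_unique[OF _ tendsto_const] by blast
  moreover have "dom_int (\<lambda>x. \<Sum>j\<in>UNIV. (DV j x \<bullet> w) * D\<psi> x $ j) = (\<Sum>j\<in>UNIV. dom_int (\<lambda>x. (DV j x \<bullet> w) * D\<psi> x $ j))"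
    by (rule dom_int_sum) (auto intro!: continuous_intros C1_closureD(2)[OF V] C1_closureD(2)[OF \<psi>])
  moreover have "bd_int (\<lambda>x. (\<Sum>j\<in>UNIV. V j x * D\<psi> x $ j) * (w \<bullet> \<nu> x)) = (\<Sum>j\<in>UNIV. bd_int (\<lambda>x. V j x * D\<psi> x $ j * (w \<bullet> \<nu> x)))"
    unfolding sum_distrib_right
    by (rule bd_int_sum) (auto intro!: continuous_intros C1_continuous_frontier[OF V] C1_continuous_frontier[OF \<psi>] continuous_on_\<nu>)
  ultimately show ?thesis by (simp add: sum.distrib sum_negf sum_subtractf)
qed

lemma differentiated_equation:
  assumes chart: "axis_chart x\<^sub>0 r" and \<rho>: "\<rho> < r"
    and weak: "weak_flux V k l"
    and V: "\<And>j. C1_closure \<Omega> (V j) (DV j)" and k: "continuous_on (closure \<Omega>) k" and l: "C1_closure \<Omega> l Dl"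
    and \<psi>: "C1_closure \<Omega> \<psi> D\<psi>" and supp: "\<And>x. x \<in> closure \<Omega> \<Longrightarrow> x \<notin> cball x\<^sub>0 \<rho> \<Longrightarrow> \<psi> x = 0"
  shows "dom_int (\<lambda>x. \<Sum>j\<in>UNIV. DV j x $ m * D\<psi> x $ j) - dom_int (\<lambda>x. Dl x $ m * \<psi> x)
    = bd_int (\<lambda>x. (\<Sum>j\<in>UNIV. V j x * D\<psi> x $ j) * \<nu> x $ m) + bd_int (\<lambda>x. k x * D\<psi> x $ m) - bd_int (\<lambda>x. l x * \<psi> x * \<nu> x $ m)"
proof -
  obtain p where p: "shift_chart \<Omega> \<sigma> x\<^sub>0 r p" "shift_chart \<Omega> \<sigma> x\<^sub>0 r (p + axis m 1)"
    using chart by (auto simp: axis_chart_def)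
  note P = differentiated_equation_inward[OF p(1) \<rho> weak V k l \<psi> supp] differentiated_equation_inward[OF p(2) \<rho> weak V k l \<psi> supp]
  note c = C1_closureD(1,2)[OF V] C1_closureD(1,2)[OF l] C1_closureD(1,2)[OF \<psi>] k
  note cf = C1_continuous_frontier[OF V] C1_continuous_frontier[OF l] C1_continuous_frontier[OF \<psi>] continuous_on_\<nu> continuous_on_subset[OF k frontier_sub]
  note d = inner_add_right inner_add_left distrib_left distrib_right inner_axis inner_axis' inner_real_def mult_1_right mult_1_left sum.distrib
  have 1: "dom_int (\<lambda>x. \<Sum>j\<in>UNIV. (DV j x \<bullet> (p + axis m 1)) * D\<psi> x $ j) = dom_int (\<lambda>x. \<Sum>j\<in>UNIV. (DV j x \<bullet> p) * D\<psi> x $ j) + dom_int (\<lambda>x. \<Sum>j\<in>UNIV. DV j x $ m * D\<psi> x $ j)"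
    by (simp only: d) (intro dom_int_add continuous_intros c)
  have 2: "dom_int (\<lambda>x. (Dl x \<bullet> (p + axis m 1)) * \<psi> x) = dom_int (\<lambda>x. (Dl x \<bullet> p) * \<psi> x) + dom_int (\<lambda>x. Dl x $ m * \<psi> x)"
    by (simp only: d) (intro dom_int_add continuous_intros c)
  have 3: "bd_int (\<lambda>x. (\<Sum>j\<in>UNIV. V j x * D\<psi> x $ j) * ((p + axis m 1) \<bullet> \<nu> x)) = bd_int (\<lambda>x. (\<Sum>j\<in>UNIV. V j x * D\<psi> x $ j) * (p \<bullet> \<nu> x)) + bd_int (\<lambda>x. (\<Sum>j\<in>UNIV. V j x * D\<psi> x $ j) * \<nu> x $ m)"
    by (simp only: d) (intro bd_int_add continuous_intros cf)
  have 4: "bd_int (\<lambda>x. k x * (D\<psi> x \<bullet> (p + axis m 1))) = bd_int (\<lambda>x. k x * (D\<psi> x \<bullet> p)) + bd_int (\<lambda>x. k x * D\<psi> x $ m)"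
    by (simp only: d) (intro bd_int_add continuous_intros cf)
  have 5: "bd_int (\<lambda>x. l x * \<psi> x * ((p + axis m 1) \<bullet> \<nu> x)) = bd_int (\<lambda>x. l x * \<psi> x * (p \<bullet> \<nu> x)) + bd_int (\<lambda>x. l x * \<psi> x * \<nu> x $ m)"
    by (simp only: d) (intro bd_int_add continuous_intros cf)
  show ?thesis using P 1 2 3 4 5 by simp
qed

text \<open>Subtracting the divergence theorem from the weak equation leaves the defect of the
  boundary condition on one side and that of the strong equation on the other. The volume side
  disappears for test functions concentrating on the boundary.\<close>

lemma flux_balance:
  assumes chart: "axis_chart x\<^sub>0 r" and \<rho>: "\<rho> < r"
    and weak: "weak_flux V k l"
    and V: "\<And>j. C1_closure \<Omega> (V j) (DV j)" and k: "continuous_on (closure \<Omega>) k" and l: "continuous_on (closure \<Omega>) l"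
    and \<psi>: "C1_closure \<Omega> \<psi> D\<psi>" and supp: "\<And>x. x \<in> closure \<Omega> \<Longrightarrow> x \<notin> cball x\<^sub>0 \<rho> \<Longrightarrow> \<psi> x = 0"
  shows "bd_int (\<lambda>x. ((\<Sum>j\<in>UNIV. V j x * \<nu> x $ j) + k x) * \<psi> x) = dom_int (\<lambda>x. ((\<Sum>j\<in>UNIV. DV j x $ j) + l x) * \<psi> x)"
proof -
  note c = C1_closureD(1,2)[OF V] C1_closureD(1,2)[OF \<psi>] k l
  note cf = C1_continuous_frontier[OF V] C1_continuous_frontier[OF \<psi>] continuous_on_\<nu> continuous_on_subset[OF k frontier_sub]
  have "dom_int (\<lambda>x. \<Sum>j\<in>UNIV. V j x * D\<psi> x $ j) = (\<Sum>j\<in>UNIV. dom_int (\<lambda>x. V j x * D\<psi> x $ j))"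
    by (rule dom_int_sum) (auto intro!: continuous_intros c)
  also have "\<dots> = (\<Sum>j\<in>UNIV. - dom_int (\<lambda>x. DV j x $ j * \<psi> x) + bd_int (\<lambda>x. V j x * \<psi> x * \<nu> x $ j))"
    by (intro sum.cong refl integration_by_parts_local[OF chart \<rho> V \<psi> supp])
  also have "\<dots> = - dom_int (\<lambda>x. \<Sum>j\<in>UNIV. DV j x $ j * \<psi> x) + bd_int (\<lambda>x. \<Sum>j\<in>UNIV. V j x * \<psi> x * \<nu> x $ j)"
    by (subst dom_int_sum, simp, intro continuous_intros c, subst bd_int_sum, simp, intro continuous_intros cf)
      (simp add: sum.distrib sum_negf sum_subtractf)
  also have "dom_int (\<lambda>x. \<Sum>j\<in>UNIV. DV j x $ j * \<psi> x) = dom_int (\<lambda>x. (\<Sum>j\<in>UNIV. DV j x $ j) * \<psi> x)"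
    by (simp add: sum_distrib_right)
  also have "bd_int (\<lambda>x. \<Sum>j\<in>UNIV. V j x * \<psi> x * \<nu> x $ j) = bd_int (\<lambda>x. (\<Sum>j\<in>UNIV. V j x * \<nu> x $ j) * \<psi> x)"
    by (simp add: sum_distrib_right mult.assoc mult.commute[of "\<psi> _"])
  finally have 1: "dom_int (\<lambda>x. \<Sum>j\<in>UNIV. V j x * D\<psi> x $ j) = - dom_int (\<lambda>x. (\<Sum>j\<in>UNIV. DV j x $ j) * \<psi> x) + bd_int (\<lambda>x. (\<Sum>j\<in>UNIV. V j x * \<nu> x $ j) * \<psi> x)" .
  have 2: "bd_int (\<lambda>x. ((\<Sum>j\<in>UNIV. V j x * \<nu> x $ j) + k x) * \<psi> x) = bd_int (\<lambda>x. (\<Sum>j\<in>UNIV. V j x * \<nu> x $ j) * \<psi> x) + bd_int (\<lambda>x. k x * \<psi> x)"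
    by (simp only: distrib_right) (intro bd_int_add continuous_intros cf)
  have 3: "dom_int (\<lambda>x. ((\<Sum>j\<in>UNIV. DV j x $ j) + l x) * \<psi> x) = dom_int (\<lambda>x. (\<Sum>j\<in>UNIV. DV j x $ j) * \<psi> x) + dom_int (\<lambda>x. l x * \<psi> x)"
    by (simp only: distrib_right) (intro dom_int_add continuous_intros c)
  show ?thesis using weak[unfolded weak_flux_def, rule_format, OF \<psi>] 1 2 3 by simp
qed

end

subsection \<open>The boundary condition and the energy identity\<close>

text \<open>Squaring removes the corner of the positive part. Both the bumps and the cutoffs near
  the boundary are made from this function.\<close>

lemma max_power2_derivative: "((\<lambda>t. (max 0 t)\<^sup>2) has_real_derivative 2 * max 0 t) (at t)" for t :: real
proof -
  consider "t < 0" | "t > 0" | "t = 0" by linarith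
  then show ?thesis
  proof cases
    case 1
    have "((\<lambda>t. 0) has_real_derivative 0) (at t)" by simp
    then have "((\<lambda>t. (max 0 t)\<^sup>2) has_real_derivative 0) (at t)"
      by (rule has_field_derivative_transform_within_open[where S="{..<0}"]) (use 1 in auto)
    then show ?thesis using 1 by simp
  next
    case 2
    have "((\<lambda>t. t\<^sup>2) has_real_derivative 2 * t) (at t)" by (auto intro!: derivative_eq_intros)
    then have "((\<lambda>t. (max 0 t)\<^sup>2) has_real_derivative 2 * t) (at t)"
      by (rule has_field_derivative_transform_within_open[where S="{0<..}"]) (use 2 in auto)
    then show ?thesis using 2 by simp
  next
    case 3
    have "((\<lambda>h. (max 0 h)\<^sup>2 / h) \<longlongrightarrow> 0) (at (0::real))"
    proof (rule Lim_null_comparison)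
      show "\<forall>\<^sub>F h in at (0::real). norm ((max 0 h)\<^sup>2 / h) \<le> norm h"
        by (rule always_eventually) (auto simp: max_def power2_eq_square)
      show "((\<lambda>h. norm h) \<longlongrightarrow> 0) (at (0::real))" by (auto intro!: tendsto_eq_intros)
    qed
    then show ?thesis using 3 by (simp add: DERIV_def)
  qed
qed

lemma C1_closure_max_power2:
  assumes "C1_closure \<Omega> q Dq"
  shows "C1_closure \<Omega> (\<lambda>x. (max 0 (q x))\<^sup>2) (\<lambda>x. (2 * max 0 (q x)) *\<^sub>R Dq x)"
  by (rule C1_closure_compose[OF assms max_power2_derivative]) (intro continuous_intros)

text \<open>A piecewise polynomial cutoff of class \<open>C1_closure\<close>: the inner expression
  is positive exactly in the open ball, and the square makes the derivative vanish continuously on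
  the sphere.\<close>

definition bump :: "real^'n \<Rightarrow> real \<Rightarrow> real^'n \<Rightarrow> real" where
  "bump x\<^sub>0 \<rho> x = (max 0 (\<rho>\<^sup>2 - (x - x\<^sub>0) \<bullet> (x - x\<^sub>0)))\<^sup>2"

lemma C1_closure_bump: "\<exists>G. C1_closure \<Omega> (bump x\<^sub>0 \<rho>) G"
proof -
  have "C1_closure \<Omega> (\<lambda>x. \<rho>\<^sup>2 - (x - x\<^sub>0) \<bullet> (x - x\<^sub>0)) (\<lambda>x. (-2) *\<^sub>R (x - x\<^sub>0))"
    unfolding C1_closure_def
    by (auto intro!: continuous_intros derivative_eq_intros simp: inner_commute algebra_simps)
  from C1_closure_max_power2[OF this] show ?thesis unfolding bump_def[abs_def] by blast
qed

lemma bump_pos: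
  assumes "x \<in> ball x\<^sub>0 \<rho>" shows "bump x\<^sub>0 \<rho> x > 0"
proof -
  have "norm (x - x\<^sub>0) < \<rho>" using assms by (simp add: dist_norm norm_minus_commute)
  then have "(norm (x - x\<^sub>0))\<^sup>2 < \<rho>\<^sup>2" by (intro power_strict_mono) auto
  then show ?thesis by (simp add: bump_def power2_norm_eq_inner)
qed

lemma bump_nonneg: "bump x\<^sub>0 \<rho> x \<ge> 0"
  by (simp add: bump_def)

lemma bump_zero:
  assumes "x \<notin> cball x\<^sub>0 \<rho>" "\<rho> \<ge> 0" shows "bump x\<^sub>0 \<rho> x = 0"
proof -
  have "\<rho> < norm (x - x\<^sub>0)" using assms by (simp add: dist_norm norm_minus_commute)
  then have "\<rho>\<^sup>2 \<le> (norm (x - x\<^sub>0))\<^sup>2" using assms(2) by (intro power_mono) auto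
  then show ?thesis by (simp add: bump_def power2_norm_eq_inner)
qed

context regular_domain
begin

text \<open>
  The test function multiplies the defect \<open>V \<sqdot> \<nu> + k\<close> by a cutoff that is \<open>1\<close> on the boundary and
  lives in a layer of thickness \<open>\<delta>\<close>. As \<open>\<delta> \<rightarrow> 0\<close> only the boundary integral of the squared defect survives.
\<close>

lemma boundary_condition_local:
  assumes weak: "weak_flux V k l"
    and V: "\<And>j. C1_closure \<Omega> (V j) (DV j)" and k: "C1_closure \<Omega> k Dk" and l: "continuous_on (closure \<Omega>) l"
    and x\<^sub>0: "x\<^sub>0 \<in> frontier \<Omega>"
  obtains R where "R > 0" "AE x in \<sigma>. x \<in> frontier \<Omega> \<inter> ball x\<^sub>0 R \<longrightarrow> (\<Sum>j\<in>UNIV. V j x * \<nu> x $ j) + k x = 0"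
proof -
  obtain r i g s where chart: "surface_chart \<Omega> x\<^sub>0 r i g s \<sigma>" using boundary_chart[OF x\<^sub>0] by blast
  interpret surface_chart \<Omega> x\<^sub>0 r i g s \<sigma> by fact
  define \<rho> where "\<rho> = r / 2"
  have \<rho>: "0 < \<rho>" "\<rho> < r" using r_pos by (auto simp: \<rho>_def)
  have b0: "bump x\<^sub>0 \<rho> x = 0" if "x \<notin> cball x\<^sub>0 \<rho>" for x
    using bump_zero[OF that] \<rho>(1) by simp
  define dfc where "dfc x = (\<Sum>j\<in>UNIV. V j x * \<nu> x $ j) + k x" for x
  \<comment> \<open>On the boundary this is \<open>norm (D\<Phi> x) * dfc x\<close>. Using
    \<open>- D\<Phi>\<close> for the unnormalised normal extends it to a function with a continuous
    gradient on the closure, whereas \<open>\<nu>\<close> lives on the frontier only.\<close>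
  define \<beta> where "\<beta> x = k x * norm (D\<Phi> x) + (\<Sum>j\<in>UNIV. V j x * (- D\<Phi> x $ j))" for x
  obtain Db where Db: "C1_closure \<Omega> (bump x\<^sub>0 \<rho>) Db" using C1_closure_bump by blast
  have comp: "\<exists>G. C1_closure \<Omega> (\<lambda>x. - D\<Phi> x $ j) G" for j
  proof -
    have "C1_closure \<Omega> (\<lambda>x. grad UNIV g x $ j) (grad UNIV (pd UNIV j g))"
      by (rule C1_UNIV_imp_C1_closure[OF g_C2])
    from C1_closure_add[OF C1_closure_const[of \<Omega> "- s * (axis i 1 :: real^'n) $ j"] C1_closure_mult[OF C1_closure_const[of \<Omega> s] this]]
    show ?thesis by (simp add: D\<Phi>_def algebra_simps) blast
  qed
  then obtain DN where DN: "\<And>j. C1_closure \<Omega> (\<lambda>x. - D\<Phi> x $ j) (DN j)" by metis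
  have "\<exists>G. C1_closure \<Omega> (\<lambda>x. norm (D\<Phi> x)) G"
  proof -
    define q where "q x = (\<Sum>j\<in>UNIV. (- D\<Phi> x $ j) * (- D\<Phi> x $ j))" for x
    have n: "norm (D\<Phi> x) = sqrt (q x)" for x
      by (simp add: q_def norm_eq_sqrt_inner inner_vec_def)
    have pos: "q x > 0" for x using norm_D\<Phi>_pos(1)[of x] unfolding n by simp
    have "C1_closure \<Omega> q (\<lambda>x. \<Sum>j\<in>UNIV. (- D\<Phi> x $ j) *\<^sub>R DN j x + (- D\<Phi> x $ j) *\<^sub>R DN j x)"
      unfolding q_def[abs_def] by (rule C1_closure_sum[OF finite C1_closure_mult[OF DN DN]])
    then have "C1_closure \<Omega> (\<lambda>x. sqrt (q x))
       (\<lambda>x. (inverse (sqrt (q x)) / 2) *\<^sub>R (\<Sum>j\<in>UNIV. (- D\<Phi> x $ j) *\<^sub>R DN j x + (- D\<Phi> x $ j) *\<^sub>R DN j x))"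
    proof (rule C1_closure_compose)
      show "(sqrt has_real_derivative inverse (sqrt (q x)) / 2) (at (q x))" for x by (rule DERIV_real_sqrt[OF pos])
      have "t \<noteq> 0" if "t \<in> q ` closure \<Omega>" for t
      proof -
        from that obtain y where "t = q y" by blast
        then show ?thesis using pos[of y] by simp
      qed
      then show "continuous_on (q ` closure \<Omega>) (\<lambda>t. inverse (sqrt t) / 2)" by (intro continuous_intros) auto
    qed
    then show ?thesis unfolding n by blast
  qed
  then obtain Dn where Dn: "C1_closure \<Omega> (\<lambda>x. norm (D\<Phi> x)) Dn" by blast
  have "\<exists>G. C1_closure \<Omega> \<beta> G"
    unfolding \<beta>_def[abs_def]
    by (rule exI, rule C1_closure_add[OF C1_closure_mult[OF k Dn] C1_closure_sum[OF finite C1_closure_mult[OF V DN]]])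
  then obtain D\<beta> where D\<beta>: "C1_closure \<Omega> \<beta> D\<beta>" by blast
  have \<Phi>_C1: "C1_closure \<Omega> \<Phi> D\<Phi>"
    unfolding C1_closure_def using continuous_on_\<Phi> \<Phi>_has_derivative by blast
  \<comment> \<open>Equal to 1 where \<open>\<Phi> = 0\<close> and to 0 where
    \<open>\<Phi> \<ge> 1 / real (Suc n)\<close>; the square makes it differentiable.\<close>
  define m where "m n x = (max 0 (1 + - real (Suc n) * \<Phi> x))\<^sup>2" for n x
  have m_C1: "\<exists>G. C1_closure \<Omega> (m n) G" for n
    unfolding m_def[abs_def]
    by (rule exI, rule C1_closure_max_power2, rule C1_closure_add[OF C1_closure_const C1_closure_mult[OF C1_closure_const \<Phi>_C1]])
  define \<psi> where "\<psi> n x = bump x\<^sub>0 \<rho> x * \<beta> x * m n x" for n x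
  have \<psi>_C1: "\<exists>G. C1_closure \<Omega> (\<psi> n) G" for n
  proof -
    obtain G where G: "C1_closure \<Omega> (m n) G" using m_C1 by blast
    show ?thesis unfolding \<psi>_def by (rule exI, rule C1_closure_mult[OF C1_closure_mult[OF Db D\<beta>] G])
  qed
  define Z where "Z x = (\<Sum>j\<in>UNIV. DV j x $ j) + l x" for x
  have Z: "continuous_on (closure \<Omega>) Z"
    unfolding Z_def[abs_def] by (intro continuous_intros C1_closureD(2)[OF V] l)
  have balance: "bd_int (\<lambda>x. dfc x * \<psi> n x) = dom_int (\<lambda>x. Z x * \<psi> n x)" for n
  proof -
    obtain G where G: "C1_closure \<Omega> (\<psi> n) G" using \<psi>_C1 by blast
    show ?thesis unfolding dfc_def Z_def
      by (rule flux_balance[OF axis_chart_boundary[OF chart] \<rho>(2) weak V C1_closureD(1)[OF k] l G])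
        (use b0 in \<open>simp_all add: \<psi>_def\<close>)
  qed
  have bd: "dfc x * \<psi> n x = bump x\<^sub>0 \<rho> x * norm (D\<Phi> x) * (dfc x)\<^sup>2" if x: "x \<in> frontier \<Omega>" for n x
  proof (cases "x \<in> ball x\<^sub>0 r")
    case True
    have N: "norm (D\<Phi> x) * \<nu> x $ j = - D\<Phi> x $ j" for j
      using outer_normal_eq[of x] True x norm_D\<Phi>_pos[of x] by simp
    have "norm (D\<Phi> x) * (\<Sum>j\<in>UNIV. V j x * \<nu> x $ j) = (\<Sum>j\<in>UNIV. V j x * (norm (D\<Phi> x) * \<nu> x $ j))"
      by (simp only: sum_distrib_left mult.left_commute)
    then have "\<beta> x = k x * norm (D\<Phi> x) + norm (D\<Phi> x) * (\<Sum>j\<in>UNIV. V j x * \<nu> x $ j)"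
      unfolding \<beta>_def N by simp
    then have "\<beta> x = norm (D\<Phi> x) * dfc x" by (simp add: dfc_def algebra_simps)
    moreover have "m n x = 1" using in_frontier_iff[OF True] x by (simp add: m_def)
    ultimately show ?thesis by (simp add: \<psi>_def power2_eq_square)
  next
    case False
    then have "x \<notin> cball x\<^sub>0 \<rho>" using \<rho> by auto
    then show ?thesis using b0 by (simp add: \<psi>_def)
  qed
  have lim: "(\<lambda>n. dom_int (\<lambda>x. Z x * \<psi> n x)) \<longlonglongrightarrow> integral\<^sup>L (lborel :: (real^'n) measure) (\<lambda>x. 0)"
    unfolding set_lebesgue_integral_def
  proof (rule integral_dominated_convergence)
    show "integrable lborel (\<lambda>x. norm (indicator \<Omega> x *\<^sub>R (Z x * (bump x\<^sub>0 \<rho> x * \<beta> x))))"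
      by (intro integrable_norm set_integrable_\<Omega>[unfolded set_integrable_def]
         continuous_intros Z C1_closureD(1)[OF Db] C1_closureD(1)[OF D\<beta>])
    show "(\<lambda>x. indicator \<Omega> x *\<^sub>R (Z x * \<psi> n x)) \<in> borel_measurable lborel" for n
    proof (rule borel_measurable_integrable, rule set_integrable_\<Omega>[unfolded set_integrable_def])
      obtain G where G: "C1_closure \<Omega> (\<psi> n) G" using \<psi>_C1 by blast
      show "continuous_on (closure \<Omega>) (\<lambda>x. Z x * \<psi> n x)" by (intro continuous_intros Z C1_closureD(1)[OF G])
    qed
    have in_ball: "x \<in> ball x\<^sub>0 r" if "bump x\<^sub>0 \<rho> x \<noteq> 0" for x
      using that b0[of x] \<rho> by (cases "x \<in> cball x\<^sub>0 \<rho>") auto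
    have "norm (indicator \<Omega> x *\<^sub>R (Z x * \<psi> n x)) \<le> norm (indicator \<Omega> x *\<^sub>R (Z x * (bump x\<^sub>0 \<rho> x * \<beta> x)))" for n x
    proof (cases "x \<in> \<Omega> \<and> bump x\<^sub>0 \<rho> x \<noteq> 0")
      case True
      then have "\<Phi> x > 0" using in_domain_iff in_ball by blast
      then have "0 \<le> real (Suc n) * \<Phi> x" by (intro mult_nonneg_nonneg) auto
      then have le: "1 + - real (Suc n) * \<Phi> x \<le> 1" unfolding mult_minus_left by linarith
      have "max 0 (1 + - real (Suc n) * \<Phi> x) \<le> 1" by (rule max.boundedI[OF zero_le_one le])
      then have "m n x \<le> 1" unfolding m_def by (intro power_le_one max.cobounded1)
      moreover have "0 \<le> m n x" by (simp add: m_def)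
      ultimately have "\<bar>Z x * (bump x\<^sub>0 \<rho> x * \<beta> x)\<bar> * m n x \<le> \<bar>Z x * (bump x\<^sub>0 \<rho> x * \<beta> x)\<bar>" by (intro mult_left_le) auto
      then show ?thesis using True \<open>0 \<le> m n x\<close> by (simp add: \<psi>_def abs_mult mult.assoc)
    qed (auto simp: \<psi>_def)
    then show "AE x in lborel. norm (indicator \<Omega> x *\<^sub>R (Z x * \<psi> n x)) \<le> norm (indicator \<Omega> x *\<^sub>R (Z x * (bump x\<^sub>0 \<rho> x * \<beta> x)))" for n
      by blast
    have "(\<lambda>n. indicator \<Omega> x *\<^sub>R (Z x * \<psi> n x)) \<longlonglongrightarrow> 0" for x
    proof (cases "x \<in> \<Omega> \<and> bump x\<^sub>0 \<rho> x \<noteq> 0")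
      case True
      then have \<Phi>: "\<Phi> x > 0" using in_domain_iff in_ball by blast
      obtain N where N: "1 / \<Phi> x < real N" using reals_Archimedean2 by blast
      have "indicator \<Omega> x *\<^sub>R (Z x * \<psi> n x) = 0" if "n \<ge> N" for n
      proof -
        have "1 / \<Phi> x < real (Suc n)" using N that by simp
        then have "1 < real (Suc n) * \<Phi> x" using \<Phi> by (simp add: pos_divide_less_eq)
        then have le: "1 + - real (Suc n) * \<Phi> x \<le> 0" unfolding mult_minus_left by linarith
        have "m n x = 0" unfolding m_def max_absorb1[OF le] by simp
        then show ?thesis by (simp add: \<psi>_def)
      qed
      then show ?thesis by (intro tendsto_eventually) (auto simp: eventually_sequentially)
    qed (auto simp: \<psi>_def)
    then show "AE x in lborel. (\<lambda>n. indicator \<Omega> x *\<^sub>R (Z x * \<psi> n x)) \<longlonglongrightarrow> 0" by blast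
  qed simp
  have "bd_int (\<lambda>x. dfc x * \<psi> n x) = bd_int (\<lambda>x. bump x\<^sub>0 \<rho> x * norm (D\<Phi> x) * (dfc x)\<^sup>2)" for n
    by (rule bd_int_cong) (rule bd)
  then have "(\<lambda>n::nat. bd_int (\<lambda>x. bump x\<^sub>0 \<rho> x * norm (D\<Phi> x) * (dfc x)\<^sup>2)) \<longlonglongrightarrow> 0"
    using lim unfolding balance[symmetric] by simp
  then have J: "bd_int (\<lambda>x. bump x\<^sub>0 \<rho> x * norm (D\<Phi> x) * (dfc x)\<^sup>2) = 0"
    using LIMSEQ_unique tendsto_const by blast
  have "continuous_on (frontier \<Omega>) dfc"
    unfolding dfc_def[abs_def]
    by (intro continuous_intros C1_continuous_frontier[OF V] C1_continuous_frontier[OF k] continuous_on_\<nu>)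
  then have "set_integrable \<sigma> (frontier \<Omega>) (\<lambda>x. bump x\<^sub>0 \<rho> x * norm (D\<Phi> x) * (dfc x)\<^sup>2)"
    by (intro set_integrable_frontier continuous_intros C1_continuous_frontier(1)[OF Db] continuous_on_\<Phi>)
  then have "AE x in \<sigma>. indicator (frontier \<Omega>) x *\<^sub>R (bump x\<^sub>0 \<rho> x * norm (D\<Phi> x) * (dfc x)\<^sup>2) = 0"
    using J unfolding set_integrable_def set_lebesgue_integral_def
    by (subst integral_nonneg_eq_0_iff_AE[symmetric]) (auto simp: bump_nonneg)
  then have "AE x in \<sigma>. x \<in> frontier \<Omega> \<inter> ball x\<^sub>0 \<rho> \<longrightarrow> dfc x = 0"
  proof eventually_elim
    case (elim x)
    then show ?case using bump_pos[of x x\<^sub>0 \<rho>] norm_D\<Phi>_pos[of x] by (auto simp: indicator_def)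
  qed
  then show thesis using that[OF \<rho>(1)] by (simp add: dfc_def)
qed

text \<open>Finitely many of the local balls cover the compact frontier. A statement almost
  everywhere suffices, since the defect is used only under a boundary integral.\<close>

lemma boundary_condition:
  assumes weak: "weak_flux V k l"
    and V: "\<And>j. C1_closure \<Omega> (V j) (DV j)" and k: "C1_closure \<Omega> k Dk" and l: "continuous_on (closure \<Omega>) l"
  shows "AE x in \<sigma>. x \<in> frontier \<Omega> \<longrightarrow> (\<Sum>j\<in>UNIV. V j x * \<nu> x $ j) + k x = 0"
proof -
  have "\<forall>y\<in>frontier \<Omega>. \<exists>R. R > 0 \<and> (AE x in \<sigma>. x \<in> frontier \<Omega> \<inter> ball y R \<longrightarrow> (\<Sum>j\<in>UNIV. V j x * \<nu> x $ j) + k x = 0)"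
  proof
    fix y assume "y \<in> frontier \<Omega>"
    from boundary_condition_local[OF weak V k l this] show "\<exists>R. R > 0 \<and> (AE x in \<sigma>. x \<in> frontier \<Omega> \<inter> ball y R \<longrightarrow> (\<Sum>j\<in>UNIV. V j x * \<nu> x $ j) + k x = 0)"
      by blast
  qed
  then obtain R where R: "\<forall>y\<in>frontier \<Omega>. R y > 0 \<and> (AE x in \<sigma>. x \<in> frontier \<Omega> \<inter> ball y (R y) \<longrightarrow> (\<Sum>j\<in>UNIV. V j x * \<nu> x $ j) + k x = 0)"
    unfolding bchoice_iff by blast
  have "frontier \<Omega> \<subseteq> (\<Union>x\<in>frontier \<Omega>. ball x (R x))" using R by force
  from compactE_image[OF compact_frontier _ this]
  obtain C where C: "C \<subseteq> frontier \<Omega>" "finite C" "frontier \<Omega> \<subseteq> (\<Union>x\<in>C. ball x (R x))" by auto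
  have "AE x in \<sigma>. \<forall>y\<in>C. x \<in> frontier \<Omega> \<inter> ball y (R y) \<longrightarrow> (\<Sum>j\<in>UNIV. V j x * \<nu> x $ j) + k x = 0"
    unfolding AE_finite_all[OF C(2)] using C(1) R by blast
  then show ?thesis
  proof eventually_elim
    case (elim x)
    then show ?case using C(3) by blast
  qed
qed

text \<open>With \<open>V = a(\<bar>\<nabla>u\<bar>) \<nabla>u\<close>, \<open>k = h(u)\<close>,
  \<open>l = f(u)\<close>, \<open>p = \<nabla>u\<close> and \<open>D\<close> the Hessian rows, this
  is the negative of the first three terms of the boundary integrand in the theorem; see
  \<open>boundary_term_eq\<close>.\<close>

definition boundary_term :: "('n \<Rightarrow> real^'n \<Rightarrow> real) \<Rightarrow> (real^'n \<Rightarrow> real) \<Rightarrow> (real^'n \<Rightarrow> real) \<Rightarrow>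
    ('n \<Rightarrow> real^'n \<Rightarrow> real) \<Rightarrow> ('n \<Rightarrow> real^'n \<Rightarrow> real^'n) \<Rightarrow> real^'n \<Rightarrow> real" where
  "boundary_term V k l p D x = (\<Sum>m\<in>UNIV. (\<Sum>j\<in>UNIV. V j x * D m x $ j) * \<nu> x $ m)
     + k x * (\<Sum>m\<in>UNIV. D m x $ m) - l x * (\<Sum>m\<in>UNIV. p m x * \<nu> x $ m)"

lemma continuous_boundary_term:
  assumes V: "\<And>j. C1_closure \<Omega> (V j) (DV j)" and k: "continuous_on (closure \<Omega>) k"
    and l: "C1_closure \<Omega> l Dl" and p: "\<And>m. C1_closure \<Omega> (p m) (D m)"
  shows "continuous_on (frontier \<Omega>) (boundary_term V k l p D)"
  unfolding boundary_term_def[abs_def]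
  by (intro continuous_intros C1_continuous_frontier[OF V] C1_continuous_frontier[OF l]
      C1_continuous_frontier[OF p] continuous_on_\<nu> continuous_on_subset[OF k frontier_sub])

text \<open>
  The terms with \<open>D\<eta>\<close> on the boundary add up to a multiple of \<open>V \<sqdot> \<nu> + k\<close>, because \<open>V\<close> is parallel to \<open>p\<close>.
\<close>

lemma differentiated_energy_local:
  assumes chart: "axis_chart x\<^sub>0 r" and \<rho>: "\<rho> < r"
    and weak: "weak_flux V k l"
    and V: "\<And>j. C1_closure \<Omega> (V j) (DV j)" and k: "C1_closure \<Omega> k Dk" and l: "C1_closure \<Omega> l Dl"
    and p: "\<And>m. C1_closure \<Omega> (p m) (D m)" and par: "\<And>j x. x \<in> closure \<Omega> \<Longrightarrow> V j x = \<alpha> x * p j x"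
    and \<eta>: "C1_closure \<Omega> \<eta> D\<eta>" and supp: "\<And>x. x \<in> closure \<Omega> \<Longrightarrow> x \<notin> cball x\<^sub>0 \<rho> \<Longrightarrow> \<eta> x = 0"
  shows "dom_int (\<lambda>x. (\<Sum>m\<in>UNIV. \<Sum>j\<in>UNIV. DV j x $ m * (\<eta> x * D m x $ j + p m x * D\<eta> x $ j)) - (\<Sum>m\<in>UNIV. Dl x $ m * p m x) * \<eta> x)
    = bd_int (\<lambda>x. \<eta> x * boundary_term V k l p D x)"
proof -
  note c = C1_closureD(1,2)[OF V] C1_closureD(1,2)[OF k] C1_closureD(1,2)[OF l] C1_closureD(1,2)[OF p] C1_closureD(1,2)[OF \<eta>]
  note cf = C1_continuous_frontier[OF V] C1_continuous_frontier[OF k] C1_continuous_frontier[OF l] C1_continuous_frontier[OF p]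
    C1_continuous_frontier[OF \<eta>] continuous_on_\<nu>
  define T where "T m j x = \<eta> x * D m x $ j + p m x * D\<eta> x $ j" for m j x
  have each: "dom_int (\<lambda>x. \<Sum>j\<in>UNIV. DV j x $ m * T m j x) - dom_int (\<lambda>x. Dl x $ m * (\<eta> x * p m x))
    = bd_int (\<lambda>x. (\<Sum>j\<in>UNIV. V j x * T m j x) * \<nu> x $ m) + bd_int (\<lambda>x. k x * T m m x) - bd_int (\<lambda>x. l x * (\<eta> x * p m x) * \<nu> x $ m)" for m
    using differentiated_equation[OF chart \<rho> weak V C1_closureD(1)[OF k] l C1_closure_mult[OF \<eta> p[of m]], of m] supp
    by (simp add: T_def)
  have cT: "continuous_on (closure \<Omega>) (T m j)" "continuous_on (frontier \<Omega>) (T m j)" for m j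
    unfolding T_def[abs_def] by (intro continuous_intros c, intro continuous_intros cf)
  have "dom_int (\<lambda>x. \<Sum>m\<in>UNIV. \<Sum>j\<in>UNIV. DV j x $ m * T m j x) - dom_int (\<lambda>x. \<Sum>m\<in>UNIV. Dl x $ m * (\<eta> x * p m x))
    = (\<Sum>m\<in>UNIV. dom_int (\<lambda>x. \<Sum>j\<in>UNIV. DV j x $ m * T m j x) - dom_int (\<lambda>x. Dl x $ m * (\<eta> x * p m x)))"
    by (subst dom_int_sum, simp, intro continuous_intros c cT, subst dom_int_sum, simp, intro continuous_intros c) (simp add: sum_subtractf)
  also have "\<dots> = (\<Sum>m\<in>UNIV. bd_int (\<lambda>x. (\<Sum>j\<in>UNIV. V j x * T m j x) * \<nu> x $ m) + bd_int (\<lambda>x. k x * T m m x) - bd_int (\<lambda>x. l x * (\<eta> x * p m x) * \<nu> x $ m))"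
    by (intro sum.cong refl each)
  also have "\<dots> = (\<Sum>m\<in>UNIV. bd_int (\<lambda>x. (\<Sum>j\<in>UNIV. V j x * T m j x) * \<nu> x $ m + k x * T m m x - l x * (\<eta> x * p m x) * \<nu> x $ m))"
    by (subst bd_int_diff, (intro continuous_intros cf cT)+, subst bd_int_add, (intro continuous_intros cf cT)+) simp
  also have "\<dots> = bd_int (\<lambda>x. \<Sum>m\<in>UNIV. (\<Sum>j\<in>UNIV. V j x * T m j x) * \<nu> x $ m + k x * T m m x - l x * (\<eta> x * p m x) * \<nu> x $ m)"
    by (rule bd_int_sum[symmetric], simp, intro continuous_intros cf cT)
  also have "\<dots> = bd_int (\<lambda>x. \<eta> x * boundary_term V k l p D x + (\<Sum>m\<in>UNIV. p m x * D\<eta> x $ m) * ((\<Sum>j\<in>UNIV. V j x * \<nu> x $ j) + k x))"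
  proof (rule bd_int_cong)
    fix x assume "x \<in> frontier \<Omega>"
    then have par: "V j x = \<alpha> x * p j x" for j using par frontier_sub by blast
    have 1: "(\<Sum>m\<in>UNIV. (\<Sum>j\<in>UNIV. V j x * T m j x) * \<nu> x $ m)
      = \<eta> x * (\<Sum>m\<in>UNIV. (\<Sum>j\<in>UNIV. V j x * D m x $ j) * \<nu> x $ m) + (\<Sum>m\<in>UNIV. p m x * D\<eta> x $ m) * (\<Sum>j\<in>UNIV. V j x * \<nu> x $ j)"
    proof -
      define A where "A m = (\<Sum>j\<in>UNIV. V j x * D m x $ j)" for m
      define B where "B = (\<Sum>j\<in>UNIV. V j x * D\<eta> x $ j)"
      have "(\<Sum>j\<in>UNIV. V j x * T m j x) = \<eta> x * A m + p m x * B" for m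
        by (simp add: T_def A_def B_def distrib_left sum.distrib sum_distrib_left mult.left_commute)
      then have "(\<Sum>m\<in>UNIV. (\<Sum>j\<in>UNIV. V j x * T m j x) * \<nu> x $ m) = \<eta> x * (\<Sum>m\<in>UNIV. A m * \<nu> x $ m) + B * (\<Sum>m\<in>UNIV. p m x * \<nu> x $ m)"
        by (simp add: distrib_right sum.distrib sum_distrib_left mult.assoc mult.left_commute)
      \<comment> \<open>Both sides equal \<open>\<alpha> x\<close> times the product of the inner
        products of \<open>p\<close> with \<open>D\<eta>\<close> and with
        \<open>\<nu>\<close>.\<close>
      also have "B * (\<Sum>m\<in>UNIV. p m x * \<nu> x $ m) = (\<Sum>m\<in>UNIV. p m x * D\<eta> x $ m) * (\<Sum>j\<in>UNIV. V j x * \<nu> x $ j)"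
        by (simp add: B_def par mult.assoc sum_distrib_left[symmetric])
      finally show ?thesis by (simp add: A_def)
    qed
    have 2: "(\<Sum>m\<in>UNIV. k x * T m m x) = k x * \<eta> x * (\<Sum>m\<in>UNIV. D m x $ m) + k x * (\<Sum>m\<in>UNIV. p m x * D\<eta> x $ m)"
      by (simp add: T_def distrib_left sum.distrib sum_distrib_left mult.assoc)
    have 3: "(\<Sum>m\<in>UNIV. l x * (\<eta> x * p m x) * \<nu> x $ m) = l x * \<eta> x * (\<Sum>m\<in>UNIV. p m x * \<nu> x $ m)"
      by (simp add: sum_distrib_left mult.assoc)
    show "(\<Sum>m\<in>UNIV. (\<Sum>j\<in>UNIV. V j x * T m j x) * \<nu> x $ m + k x * T m m x - l x * (\<eta> x * p m x) * \<nu> x $ m)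
      = \<eta> x * boundary_term V k l p D x + (\<Sum>m\<in>UNIV. p m x * D\<eta> x $ m) * ((\<Sum>j\<in>UNIV. V j x * \<nu> x $ j) + k x)"
      unfolding sum.distrib sum_subtractf 1 2 3 boundary_term_def by (simp add: algebra_simps)
  qed
  also have "\<dots> = bd_int (\<lambda>x. \<eta> x * boundary_term V k l p D x) + bd_int (\<lambda>x. (\<Sum>m\<in>UNIV. p m x * D\<eta> x $ m) * ((\<Sum>j\<in>UNIV. V j x * \<nu> x $ j) + k x))"
    by (rule bd_int_add) (intro continuous_intros cf continuous_boundary_term[OF V C1_closureD(1)[OF k] l p])+
  also have "bd_int (\<lambda>x. (\<Sum>m\<in>UNIV. p m x * D\<eta> x $ m) * ((\<Sum>j\<in>UNIV. V j x * \<nu> x $ j) + k x)) = 0"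
    unfolding set_lebesgue_integral_def
  proof (rule integral_eq_zero_AE)
    show "AE x in \<sigma>. indicator (frontier \<Omega>) x *\<^sub>R ((\<Sum>m\<in>UNIV. p m x * D\<eta> x $ m) * ((\<Sum>j\<in>UNIV. V j x * \<nu> x $ j) + k x)) = 0"
      using boundary_condition[OF weak V k C1_closureD(1)[OF l]] by eventually_elim (auto simp: indicator_def)
  qed
  finally have A: "dom_int (\<lambda>x. \<Sum>m\<in>UNIV. \<Sum>j\<in>UNIV. DV j x $ m * T m j x) - dom_int (\<lambda>x. \<Sum>m\<in>UNIV. Dl x $ m * (\<eta> x * p m x))
    = bd_int (\<lambda>x. \<eta> x * boundary_term V k l p D x)" by simp
  have "dom_int (\<lambda>x. (\<Sum>m\<in>UNIV. \<Sum>j\<in>UNIV. DV j x $ m * T m j x) - (\<Sum>m\<in>UNIV. Dl x $ m * (\<eta> x * p m x)))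
    = bd_int (\<lambda>x. \<eta> x * boundary_term V k l p D x)"
    unfolding A[symmetric] by (rule dom_int_diff) (intro continuous_intros c cT)+
  then show ?thesis by (simp add: T_def sum_distrib_right mult.assoc mult.commute[of "\<eta> _"])
qed

text \<open>Both sides are linear in \<open>\<eta>\<close> and its gradient, so a partition of unity
  subordinate to finitely many charts reduces the claim to the local one.\<close>

lemma differentiated_energy:
  assumes weak: "weak_flux V k l"
    and V: "\<And>j. C1_closure \<Omega> (V j) (DV j)" and k: "C1_closure \<Omega> k Dk" and l: "C1_closure \<Omega> l Dl"
    and p: "\<And>m. C1_closure \<Omega> (p m) (D m)" and par: "\<And>j x. x \<in> closure \<Omega> \<Longrightarrow> V j x = \<alpha> x * p j x"
    and \<eta>: "C1_closure \<Omega> \<eta> D\<eta>"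
  shows "dom_int (\<lambda>x. (\<Sum>m\<in>UNIV. \<Sum>j\<in>UNIV. DV j x $ m * (\<eta> x * D m x $ j + p m x * D\<eta> x $ j)) - (\<Sum>m\<in>UNIV. Dl x $ m * p m x) * \<eta> x)
    = bd_int (\<lambda>x. \<eta> x * boundary_term V k l p D x)"
proof -
  have "\<forall>x\<in>closure \<Omega>. \<exists>r. r > 0 \<and> axis_chart x r"
  proof
    fix x assume "x \<in> closure \<Omega>"
    from axis_chart_exists[OF this] show "\<exists>r. r > 0 \<and> axis_chart x r" by blast
  qed
  then obtain r where r: "\<forall>x\<in>closure \<Omega>. r x > 0 \<and> axis_chart x (r x)"
    unfolding bchoice_iff by blast
  have "closure \<Omega> \<subseteq> (\<Union>x\<in>closure \<Omega>. ball x (r x / 2))" using r by force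
  from compactE_image[OF compact_closure _ this]
  obtain C where C: "C \<subseteq> closure \<Omega>" "finite C" "closure \<Omega> \<subseteq> (\<Union>x\<in>C. ball x (r x / 2))" by auto
  define b where "b y = bump y (r y / 2)" for y
  have "\<forall>y. \<exists>G. C1_closure \<Omega> (b y) G" unfolding b_def using C1_closure_bump by blast
  then obtain Db where Db: "\<And>y. C1_closure \<Omega> (b y) (Db y)" by metis
  \<comment> \<open>The sum of the bumps is positive on the compact closure, so dividing by it
    normalises them without loss of regularity.\<close>
  define S where "S x = (\<Sum>y\<in>C. b y x)" for x
  have S_C1: "C1_closure \<Omega> S (\<lambda>x. \<Sum>y\<in>C. Db y x)"
    unfolding S_def[abs_def] by (rule C1_closure_sum[OF C(2) Db])
  have S_pos: "S x > 0" if "x \<in> closure \<Omega>" for x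
  proof -
    obtain y where "y \<in> C" "x \<in> ball y (r y / 2)" using C(3) \<open>x \<in> closure \<Omega>\<close> by blast
    then show ?thesis unfolding S_def b_def
      by (intro sum_pos2[OF C(2)] bump_pos bump_nonneg)
  qed
  have inv_S: "C1_closure \<Omega> (\<lambda>x. inverse (S x)) (\<lambda>x. (- (inverse (S x) ^ Suc (Suc 0))) *\<^sub>R (\<Sum>y\<in>C. Db y x))"
  proof (rule C1_closure_compose[OF S_C1 DERIV_inverse])
    show "S x \<noteq> 0" if "x \<in> closure \<Omega>" for x using S_pos[OF that] by simp
    then have "\<forall>t\<in>S ` closure \<Omega>. t \<noteq> 0" by simp
    then show "continuous_on (S ` closure \<Omega>) (\<lambda>t. - (inverse t ^ Suc (Suc 0)))" by (intro continuous_intros)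
  qed
  have "\<exists>G. C1_closure \<Omega> (\<lambda>x. \<eta> x * inverse (S x)) G" by (rule exI, rule C1_closure_mult[OF \<eta> inv_S])
  then obtain D\<zeta> where \<zeta>: "C1_closure \<Omega> (\<lambda>x. \<eta> x * inverse (S x)) D\<zeta>" by blast
  define e where "e y x = b y x * (\<eta> x * inverse (S x))" for y x
  define De where "De y x = b y x *\<^sub>R D\<zeta> x + (\<eta> x * inverse (S x)) *\<^sub>R Db y x" for y x
  have e: "C1_closure \<Omega> (e y) (De y)" for y
    unfolding e_def De_def by (rule C1_closure_mult[OF Db \<zeta>])
  have sum_e: "(\<Sum>y\<in>C. e y x) = \<eta> x" if "x \<in> closure \<Omega>" for x
    using S_pos[OF that] by (simp add: e_def sum_distrib_right[symmetric] S_def[symmetric])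
  \<comment> \<open>The pieces add up to \<open>\<eta>\<close>, and the gradient is determined by
    the function even at boundary points, so no derivative of the cutoffs has to be
    computed.\<close>
  have sum_De: "(\<Sum>y\<in>C. De y x) = D\<eta> x" if x: "x \<in> closure \<Omega>" for x
  proof -
    have "C1_closure \<Omega> \<eta> (\<lambda>x. \<Sum>y\<in>C. De y x)"
      by (rule C1_closure_cong[OF C1_closure_sum[OF C(2) e]]) (use sum_e open_\<Omega> in auto)
    from C1_closure_grad_eq[OF this x] C1_closure_grad_eq[OF \<eta> x] show ?thesis by simp
  qed
  define LH where "LH \<eta> D\<eta> x = (\<Sum>m\<in>UNIV. \<Sum>j\<in>UNIV. DV j x $ m * (\<eta> x * D m x $ j + p m x * D\<eta> x $ j)) - (\<Sum>m\<in>UNIV. Dl x $ m * p m x) * \<eta> x"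
    for \<eta> :: "real^'n \<Rightarrow> real" and D\<eta> :: "real^'n \<Rightarrow> real^'n" and x
  have each: "dom_int (LH (e y) (De y)) = bd_int (\<lambda>x. e y x * boundary_term V k l p D x)" if "y \<in> C" for y
    unfolding LH_def
  proof (rule differentiated_energy_local[OF _ _ weak V k l p par e])
    show "axis_chart y (r y)" "r y / 2 < r y" using r C(1) that by auto
    show "e y x = 0" if "x \<notin> cball y (r y / 2)" for x
      using that bump_zero[OF that] r C(1) \<open>y \<in> C\<close> by (force simp: e_def b_def)
  qed auto
  have LH_sum: "LH \<eta> D\<eta> x = (\<Sum>y\<in>C. LH (e y) (De y) x)" if x: "x \<in> closure \<Omega>" for x
  proof -
    have "D\<eta> x $ j = (\<Sum>y\<in>C. De y x $ j)" for j by (simp add: sum_De[OF x, symmetric])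
    moreover have "\<eta> x = (\<Sum>y\<in>C. e y x)" using sum_e[OF x] by simp
    moreover have "(\<Sum>y\<in>C. LH (e y) (De y) x) = (\<Sum>m\<in>UNIV. \<Sum>j\<in>UNIV. DV j x $ m * ((\<Sum>y\<in>C. e y x) * D m x $ j + p m x * (\<Sum>y\<in>C. De y x $ j)))
        - (\<Sum>m\<in>UNIV. Dl x $ m * p m x) * (\<Sum>y\<in>C. e y x)"
    proof -
      have "(\<Sum>y\<in>C. DV j x $ m * (e y x * D m x $ j + p m x * De y x $ j))
          = DV j x $ m * ((\<Sum>y\<in>C. e y x) * D m x $ j + p m x * (\<Sum>y\<in>C. De y x $ j))" for m j
        by (simp add: sum_distrib_left sum_distrib_right sum.distrib distrib_left)
      moreover have "(\<Sum>y\<in>C. \<Sum>m\<in>UNIV. \<Sum>j\<in>UNIV. F y m j) = (\<Sum>m\<in>UNIV. \<Sum>j\<in>UNIV. \<Sum>y\<in>C. F y m j)"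
        for F :: "real^'n \<Rightarrow> 'n \<Rightarrow> 'n \<Rightarrow> real"
        by (subst sum.swap, intro sum.cong refl, rule sum.swap)
      ultimately show ?thesis
        unfolding LH_def sum_subtractf by (simp only: sum_distrib_left[symmetric])
    qed
    ultimately show ?thesis by (simp add: LH_def)
  qed
  have "dom_int (LH \<eta> D\<eta>) = dom_int (\<lambda>x. \<Sum>y\<in>C. LH (e y) (De y) x)"
    by (rule dom_int_cong) (use LH_sum closure_subset in blast)
  also have "\<dots> = (\<Sum>y\<in>C. dom_int (LH (e y) (De y)))"
    by (rule dom_int_sum[OF C(2)], unfold LH_def)
      (intro continuous_intros C1_closureD(1,2)[OF V] C1_closureD(1,2)[OF l] C1_closureD(1,2)[OF p] C1_closureD(1,2)[OF e])
  also have "\<dots> = (\<Sum>y\<in>C. bd_int (\<lambda>x. e y x * boundary_term V k l p D x))"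
    by (intro sum.cong refl each)
  also have "\<dots> = bd_int (\<lambda>x. \<Sum>y\<in>C. e y x * boundary_term V k l p D x)"
    by (rule bd_int_sum[symmetric, OF C(2)])
      (intro continuous_intros C1_continuous_frontier[OF e] continuous_boundary_term[OF V C1_closureD(1)[OF k] l p])
  also have "\<dots> = bd_int (\<lambda>x. \<eta> x * boundary_term V k l p D x)"
    by (rule bd_int_cong) (use sum_e frontier_sub in \<open>auto simp: sum_distrib_right[symmetric]\<close>)
  finally show ?thesis unfolding LH_def .
qed

end

subsection \<open>The coefficient matrix\<close>

lemma C1_differentiable_on_real:
  fixes g :: "real \<Rightarrow> real"
  assumes "g C1_differentiable_on S"
  shows "\<And>t. t \<in> S \<Longrightarrow> (g has_real_derivative deriv g t) (at t)" "continuous_on S (deriv g)"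
proof -
  obtain D where D: "\<And>t. t \<in> S \<Longrightarrow> (g has_vector_derivative D t) (at t)" "continuous_on S D"
    using assms unfolding C1_differentiable_on_def by blast
  then have d: "(g has_real_derivative D t) (at t)" if "t \<in> S" for t
    using that by (simp add: has_real_derivative_iff_has_vector_derivative)
  then have eq: "deriv g t = D t" if "t \<in> S" for t using that by (blast intro: DERIV_imp_deriv)
  then show "\<And>t. t \<in> S \<Longrightarrow> (g has_real_derivative deriv g t) (at t)" using d by simp
  show "continuous_on S (deriv g)" by (rule continuous_on_eq[OF D(2)]) (use eq in auto)
qed

lemma A_matrix_row:
  "A_matrix a \<xi> $ j = (if \<xi> = 0 then a 0 *\<^sub>R axis j 1
     else (deriv a (norm \<xi>) / norm \<xi> * \<xi> $ j) *\<^sub>R \<xi> + a (norm \<xi>) *\<^sub>R axis j 1)"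
  by (auto simp: A_matrix_def vec_eq_iff mat_def axis_def algebra_simps)

lemma A_matrix_mult:
  "A_matrix a \<xi> *v v = (if \<xi> = 0 then a 0 *\<^sub>R v
     else (deriv a (norm \<xi>) / norm \<xi> * (\<xi> \<bullet> v)) *\<^sub>R \<xi> + a (norm \<xi>) *\<^sub>R v)"
proof -
  have "(A_matrix a \<xi> *v v) $ j = A_matrix a \<xi> $ j \<bullet> v" for j
    by (simp add: matrix_vector_mult_def inner_vec_def)
  then show ?thesis
    by (auto simp: vec_eq_iff A_matrix_row inner_add_left inner_axis' mult.commute mult.left_commute)
qed

lemma A_matrix_symmetric: "(A_matrix a \<xi> *v v) \<bullet> w = (A_matrix a \<xi> *v w) \<bullet> v"
  by (simp add: A_matrix_mult inner_add_left inner_commute[of v w])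

lemma A_matrix_linear: "A_matrix a \<xi> *v (v + w) = A_matrix a \<xi> *v v + A_matrix a \<xi> *v w"
  "A_matrix a \<xi> *v (c *\<^sub>R v) = c *\<^sub>R (A_matrix a \<xi> *v v)"
  by (simp_all add: matrix_vector_right_distrib matrix_vector_mult_scaleR)

text \<open>\<open>A\<close> has eigenvalue \<open>a + a' t\<close> in direction
  \<open>\<xi>\<close> and \<open>a\<close> on its orthogonal complement, where
  \<open>t = norm \<xi>\<close>; \<open>c\<close> below is the component of \<open>v\<close> along
  \<open>\<xi>\<close>.\<close>

lemma A_matrix_nonneg:
  assumes "\<xi> \<noteq> 0" and a: "a (norm \<xi>) > 0" "a (norm \<xi>) + deriv a (norm \<xi>) * norm \<xi> > 0"
  shows "(A_matrix a \<xi> *v v) \<bullet> v \<ge> 0"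
proof -
  define t where "t = norm \<xi>"
  have t: "t > 0" using assms(1) by (simp add: t_def)
  define c where "c = (\<xi> \<bullet> v) / t"
  have "\<bar>\<xi> \<bullet> v\<bar> \<le> t * norm v" unfolding t_def by (rule Cauchy_Schwarz_ineq2)
  then have "\<bar>c\<bar> \<le> norm v" using t by (simp add: c_def abs_divide divide_le_eq mult.commute)
  then have c2: "c\<^sup>2 \<le> (norm v)\<^sup>2" by (metis abs_norm_cancel abs_le_square_iff)
  have "(A_matrix a \<xi> *v v) \<bullet> v = deriv a t / t * (\<xi> \<bullet> v)\<^sup>2 + a t * (norm v)\<^sup>2"
    using assms(1) by (simp add: A_matrix_mult inner_add_left t_def power2_norm_eq_inner, simp add: power2_eq_square)
  also have "\<dots> = a t * ((norm v)\<^sup>2 - c\<^sup>2) + (a t + deriv a t * t) * c\<^sup>2"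
    using t by (simp add: c_def field_simps power2_eq_square)
  also have "\<dots> \<ge> 0" using c2 a by (simp add: t_def)
  finally show ?thesis .
qed

text \<open>Identifies \<open>A\<close> as the Jacobian matrix of the flux map sending
  \<open>\<xi>\<close> to \<open>a (norm \<xi>) *\<^sub>R \<xi>\<close>.\<close>

lemma flux_component_derivative:
  fixes \<xi> :: "real^'n"
  assumes "\<xi> \<noteq> 0" and a: "(a has_real_derivative deriv a (norm \<xi>)) (at (norm \<xi>))"
  shows "((\<lambda>\<xi>. a (norm \<xi>) * \<xi> $ j) has_derivative (\<lambda>v. A_matrix a \<xi> $ j \<bullet> v)) (at \<xi>)"
proof -
  have n: "(norm has_derivative (\<lambda>h. h \<bullet> sgn \<xi>)) (at \<xi>)" using has_derivative_norm[OF assms(1)] by simp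
  have an: "((\<lambda>\<xi>. a (norm \<xi>)) has_derivative (\<lambda>h. deriv a (norm \<xi>) * (h \<bullet> sgn \<xi>))) (at \<xi>)"
    by (rule has_derivative_compose[OF n a[unfolded has_field_derivative_def]])
  have c: "((\<lambda>\<xi>. \<xi> $ j) has_derivative (\<lambda>h. h $ j)) (at \<xi>)"
    by (intro bounded_linear_imp_has_derivative bounded_linear_vec_nth)
  have "a (norm \<xi>) * h $ j + deriv a (norm \<xi>) * (h \<bullet> sgn \<xi>) * \<xi> $ j = A_matrix a \<xi> $ j \<bullet> h" for h
    using assms(1) by (simp add: A_matrix_row inner_add_left inner_axis' sgn_div_norm inner_commute[of h] divide_inverse)
  then have "(\<lambda>h. a (norm \<xi>) * h $ j + deriv a (norm \<xi>) * (h \<bullet> sgn \<xi>) * \<xi> $ j) = (\<lambda>v. A_matrix a \<xi> $ j \<bullet> v)"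
    by (rule ext)
  with has_derivative_mult[OF an c] show ?thesis by simp
qed

text \<open>\<open>E\<close> is the derivative of \<open>t * a t\<close> minus \<open>a\<close>. It
  vanishes at 0 because the difference quotient of \<open>t * a t\<close> at 0 is \<open>a t\<close>
  itself, which tends to \<open>a 0\<close>.\<close>

lemma cond_A2_derivative:
  assumes "cond_A2 a" and a: "\<And>t. t > 0 \<Longrightarrow> (a has_real_derivative deriv a t) (at t)"
  obtains E where "continuous_on {0..} E" "E 0 = 0" "\<And>t. t > 0 \<Longrightarrow> E t = deriv a t * t"
proof -
  have ca: "continuous_on {0..} a" using assms(1) by (simp add: cond_A2_def)
  obtain D where D: "continuous_on {0..} D"
    "\<And>t. t \<ge> 0 \<Longrightarrow> ((\<lambda>t. t * a t) has_real_derivative D t) (at t within {0..})"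
    using assms(1) unfolding cond_A2_def by auto
  have 1: "D t - a t = deriv a t * t" if "t > 0" for t
  proof -
    have "at t within {0..} = at t"
      by (rule at_within_nhd[where S="{0<..}"]) (use that in auto)
    then have "((\<lambda>t. t * a t) has_real_derivative D t) (at t)" using D(2)[of t] that by simp
    moreover have "((\<lambda>t. t * a t) has_real_derivative (a t + t * deriv a t)) (at t)"
      by (rule derivative_eq_intros a that refl | simp)+
    ultimately have "D t = a t + t * deriv a t" by (rule DERIV_unique)
    then show ?thesis by simp
  qed
  have "((\<lambda>t. t * a t) has_real_derivative D 0) (at 0 within {0..})" using D(2)[of 0] by simp
  then have "((\<lambda>t. (t * a t - 0) / (t - 0)) \<longlongrightarrow> D 0) (at 0 within {0..})"
    by (simp add: has_field_derivative_iff)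
  moreover have "\<forall>\<^sub>F t in at (0::real) within {0..}. (t * a t - 0) / (t - 0) = a t"
    unfolding eventually_at_filter by (rule always_eventually) simp
  ultimately have "(a \<longlongrightarrow> D 0) (at 0 within {0..})" by (rule Lim_transform_eventually)
  moreover have "(a \<longlongrightarrow> a 0) (at 0 within {0..})" using ca by (simp add: continuous_on_def)
  moreover have "at (0::real) within {0..} \<noteq> bot"
  proof -
    have "at (0::real) within {0..} = at_right 0" by (rule at_within_nhd[where S=UNIV]) auto
    then show ?thesis by simp
  qed
  ultimately have "D 0 = a 0" using tendsto_unique by blast
  then show thesis using that[of "\<lambda>t. D t - a t"] 1 by (auto intro!: continuous_intros D ca)
qed

text \<open>
  Under condition (A2) the flux \<open>\<xi> \<mapsto> a(\<bar>\<xi>\<bar>) \<xi>\<close> is \<open>C\<^sup>1\<close> across \<open>\<xi> = 0\<close>, because \<open>t a'(t) \<rightarrow> 0\<close> as \<open>t \<rightarrow> 0\<close>.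
\<close>

lemma flux_C1_at_zero:
  fixes j :: "'n::finite"
  assumes "cond_A2 a" and a: "\<And>t. t > 0 \<Longrightarrow> (a has_real_derivative deriv a t) (at t)"
  shows "((\<lambda>\<xi>::real^'n. a (norm \<xi>) * \<xi> $ j) has_derivative (\<lambda>v. A_matrix a 0 $ j \<bullet> v)) (at 0)"
    and "isCont (\<lambda>\<xi>::real^'n. A_matrix a \<xi> $ j) 0"
proof -
  have ca: "continuous_on {0..} a" using assms(1) by (simp add: cond_A2_def)
  obtain E where E: "continuous_on {0..} E" "E 0 = 0" "\<And>t. t > 0 \<Longrightarrow> E t = deriv a t * t"
    using cond_A2_derivative[OF assms] by blast
  have cn: "isCont (\<lambda>\<xi>::real^'n. F (norm \<xi>)) 0" if "continuous_on {0..} F" for F :: "real \<Rightarrow> real"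
  proof -
    have "continuous_on UNIV (\<lambda>\<xi>::real^'n. F (norm \<xi>))"
      by (rule continuous_on_compose2[OF that]) (auto intro!: continuous_intros)
    then show ?thesis by (simp add: continuous_on_eq_continuous_at)
  qed
  have a_lim: "((\<lambda>\<xi>::real^'n. a (norm \<xi>)) \<longlongrightarrow> a 0) (at 0)" using cn[OF ca] by (simp add: isCont_def)
  have E_lim: "((\<lambda>\<xi>::real^'n. E (norm \<xi>)) \<longlongrightarrow> 0) (at 0)" using cn[OF E(1)] E(2) by (simp add: isCont_def)
  show "((\<lambda>\<xi>::real^'n. a (norm \<xi>) * \<xi> $ j) has_derivative (\<lambda>v. A_matrix a 0 $ j \<bullet> v)) (at 0)"
    unfolding has_derivative_at
  proof (intro conjI)
    show "bounded_linear (\<lambda>v. A_matrix a 0 $ j \<bullet> v)" by (rule bounded_linear_inner_right)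
    have "((\<lambda>h::real^'n. \<bar>a (norm h) - a 0\<bar>) \<longlongrightarrow> 0) (at 0)"
      using tendsto_rabs_zero[OF LIM_zero[OF a_lim]] .
    then show "((\<lambda>h::real^'n. norm (a (norm (0 + h)) * (0 + h) $ j - a (norm (0::real^'n)) * (0::real^'n) $ j - A_matrix a 0 $ j \<bullet> h) / norm h) \<longlongrightarrow> 0) (at 0)"
    proof (rule Lim_null_comparison[rotated])
      have "norm (norm (a (norm (0 + h)) * (0 + h) $ j - a (norm (0::real^'n)) * (0::real^'n) $ j - A_matrix a 0 $ j \<bullet> h) / norm h)
          \<le> \<bar>a (norm h) - a 0\<bar>" for h :: "real^'n"
      proof (cases "h = 0")
        case False
        have "norm (a (norm (0 + h)) * (0 + h) $ j - a (norm (0::real^'n)) * (0::real^'n) $ j - A_matrix a 0 $ j \<bullet> h) = \<bar>a (norm h) - a 0\<bar> * \<bar>h $ j\<bar>"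
          by (simp add: A_matrix_row inner_axis' abs_mult[symmetric] left_diff_distrib)
        also have "\<dots> \<le> \<bar>a (norm h) - a 0\<bar> * norm h" by (intro mult_left_mono component_le_norm_cart) simp
        finally show ?thesis using False by (simp add: divide_le_eq)
      qed simp
      then show "\<forall>\<^sub>F h in at (0::real^'n). norm (norm (a (norm (0 + h)) * (0 + h) $ j - a (norm (0::real^'n)) * (0::real^'n) $ j - A_matrix a 0 $ j \<bullet> h) / norm h)
          \<le> \<bar>a (norm h) - a 0\<bar>" by (rule always_eventually[OF allI])
    qed
  qed
  show "isCont (\<lambda>\<xi>::real^'n. A_matrix a \<xi> $ j) 0"
    unfolding isCont_def
  proof (rule LIM_zero_cancel, rule Lim_null_comparison)
    have "((\<lambda>\<xi>::real^'n. \<bar>E (norm \<xi>)\<bar> + \<bar>a (norm \<xi>) - a 0\<bar>) \<longlongrightarrow> \<bar>0\<bar> + \<bar>a 0 - a 0\<bar>) (at 0)"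
      by (intro tendsto_intros E_lim a_lim)
    then show "((\<lambda>\<xi>::real^'n. \<bar>E (norm \<xi>)\<bar> + \<bar>a (norm \<xi>) - a 0\<bar>) \<longlongrightarrow> 0) (at 0)" by simp
    have "norm (A_matrix a \<xi> $ j - A_matrix a 0 $ j) \<le> \<bar>E (norm \<xi>)\<bar> + \<bar>a (norm \<xi>) - a 0\<bar>" for \<xi> :: "real^'n"
    proof (cases "\<xi> = 0")
      case False
      have "A_matrix a \<xi> $ j - A_matrix a 0 $ j
        = (deriv a (norm \<xi>) / norm \<xi> * \<xi> $ j) *\<^sub>R \<xi> + (a (norm \<xi>) - a 0) *\<^sub>R axis j 1"
        using False by (simp add: A_matrix_row algebra_simps)
      also have "norm \<dots> \<le> norm ((deriv a (norm \<xi>) / norm \<xi> * \<xi> $ j) *\<^sub>R \<xi>) + norm ((a (norm \<xi>) - a 0) *\<^sub>R (axis j 1 :: real^'n))"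
        by (rule norm_triangle_ineq)
      also have "norm ((deriv a (norm \<xi>) / norm \<xi> * \<xi> $ j) *\<^sub>R \<xi>) = \<bar>deriv a (norm \<xi>)\<bar> * \<bar>\<xi> $ j\<bar>"
        using False by (simp add: abs_mult abs_divide)
      also have "\<dots> \<le> \<bar>deriv a (norm \<xi>)\<bar> * norm \<xi>" by (intro mult_left_mono component_le_norm_cart) simp
      also have "\<dots> = \<bar>E (norm \<xi>)\<bar>" using False E(3)[of "norm \<xi>"] by (simp add: abs_mult)
      finally show ?thesis by simp
    qed simp
    then show "\<forall>\<^sub>F \<xi> in at 0. norm (A_matrix a \<xi> $ j - A_matrix a 0 $ j) \<le> \<bar>E (norm \<xi>)\<bar> + \<bar>a (norm \<xi>) - a 0\<bar>"
      by (rule always_eventually[OF allI])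
  qed
qed

lemma A_matrix_row_isCont:
  fixes \<xi> :: "real^'n"
  assumes "\<xi> \<noteq> 0" and a: "\<And>t. t > 0 \<Longrightarrow> isCont a t" "\<And>t. t > 0 \<Longrightarrow> isCont (deriv a) t"
  shows "isCont (\<lambda>\<xi>. A_matrix a \<xi> $ j) \<xi>"
proof -
  have n: "norm \<xi> > 0" using assms(1) by simp
  have 1: "isCont (\<lambda>\<xi>::real^'n. a (norm \<xi>)) \<xi>" "isCont (\<lambda>\<xi>::real^'n. deriv a (norm \<xi>)) \<xi>"
    using isCont_o2[where f=norm and g=a, OF _ a(1)[OF n]] isCont_o2[where f=norm and g="deriv a", OF _ a(2)[OF n]] by auto
  have c: "isCont (\<lambda>\<xi>. (deriv a (norm \<xi>) / norm \<xi> * \<xi> $ j) *\<^sub>R \<xi> + a (norm \<xi>) *\<^sub>R axis j 1) \<xi>"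
    using assms(1) by (intro continuous_intros 1) auto
  have "\<forall>\<^sub>F \<eta> in nhds \<xi>. A_matrix a \<eta> $ j = (deriv a (norm \<eta>) / norm \<eta> * \<eta> $ j) *\<^sub>R \<eta> + a (norm \<eta>) *\<^sub>R axis j 1"
    unfolding eventually_nhds
    by (rule exI[of _ "- {0}"]) (use assms(1) in \<open>auto simp: A_matrix_row\<close>)
  then show ?thesis by (rule iffD2[OF isCont_cong c])
qed

lemma C1_closure_compose_vec:
  fixes P :: "real^'n \<Rightarrow> real^'m"
  assumes P: "\<And>k. C1_closure \<Omega> (\<lambda>x. P x $ k) (D k)"
    and F: "\<And>\<xi>. \<xi> \<in> P ` closure \<Omega> \<Longrightarrow> (F has_derivative (\<lambda>v. A \<xi> \<bullet> v)) (at \<xi>)"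
    and A: "continuous_on (P ` closure \<Omega>) A"
  shows "C1_closure \<Omega> (\<lambda>x. F (P x)) (\<lambda>x. \<Sum>k\<in>UNIV. A (P x) $ k *\<^sub>R D k x)"
proof -
  have cP: "continuous_on (closure \<Omega>) P"
    using continuous_on_vec_lambda[of "closure \<Omega>" "\<lambda>k x. P x $ k"] C1_closureD(1)[OF P] by simp
  have "continuous_on (P ` closure \<Omega>) F"
    by (rule continuous_at_imp_continuous_on) (use F has_derivative_continuous in blast)
  then have 1: "continuous_on (closure \<Omega>) (\<lambda>x. F (P x))"
    by (rule continuous_on_compose2) (use cP in auto)
  have cA: "continuous_on (closure \<Omega>) (\<lambda>x. A (P x))"
    by (rule continuous_on_compose2[OF A]) (use cP in auto)
  have 2: "continuous_on (closure \<Omega>) (\<lambda>x. \<Sum>k\<in>UNIV. A (P x) $ k *\<^sub>R D k x)"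
    by (intro continuous_intros cA C1_closureD(2)[OF P])
  have 3: "((\<lambda>x. F (P x)) has_derivative (\<lambda>v. (\<Sum>k\<in>UNIV. A (P x) $ k *\<^sub>R D k x) \<bullet> v)) (at x)" if x: "x \<in> \<Omega>" for x
  proof -
    have "(P has_derivative (\<lambda>v. \<chi> k. D k x \<bullet> v)) (at x)"
      unfolding has_derivative_componentwise_within[of P]
      by (auto simp: Basis_vec_def inner_axis intro!: C1_closureD(3)[OF P x])
    from has_derivative_compose[OF this F] x closure_subset
    have "((\<lambda>x. F (P x)) has_derivative (\<lambda>v. A (P x) \<bullet> (\<chi> k. D k x \<bullet> v))) (at x)" by blast
    then show ?thesis by (simp add: inner_vec_def[of "A (P x)"] inner_sum_left)
  qed
  show ?thesis unfolding C1_closure_def using 1 2 3 by blast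
qed

text \<open>The vectors \<open>e i\<close> together with \<open>n\<close> are orthonormal and as
  many as the dimension, hence a basis of the whole space.\<close>

lemma parseval:
  fixes e :: "nat \<Rightarrow> real^'n" and n v :: "real^'n"
  assumes n: "norm n = 1" and en: "\<And>i. i \<in> {1..CARD('n) - 1} \<Longrightarrow> e i \<bullet> n = 0"
    and e: "\<And>i j. i \<in> {1..CARD('n) - 1} \<Longrightarrow> j \<in> {1..CARD('n) - 1} \<Longrightarrow> e i \<bullet> e j = (if i = j then 1 else 0)"
  shows "(v \<bullet> n)\<^sup>2 + (\<Sum>i=1..CARD('n) - 1. (v \<bullet> e i)\<^sup>2) = v \<bullet> v"
proof -
  let ?I = "{1..CARD('n) - 1}"
  have inj: "inj_on e ?I"
  proof (rule inj_onI)
    fix i j assume ij: "i \<in> ?I" "j \<in> ?I" "e i = e j"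
    then have "e i \<bullet> e j = 1" using e[of i i] by simp
    then show "i = j" using e[OF ij(1,2)] by (simp split: if_splits)
  qed
  have n1: "n \<bullet> n = 1" using n by (simp add: norm_eq_1)
  have n_notin: "n \<notin> e ` ?I" using en n1 by auto
  define B where "B = insert n (e ` ?I)"
  have fin: "finite B" by (simp add: B_def)
  have norm1: "norm b = 1" if "b \<in> B" for b using that n e by (auto simp: B_def norm_eq_1)
  have orth: "pairwise orthogonal B"
    unfolding pairwise_def orthogonal_def B_def
  proof (intro ballI impI)
    fix x y assume "x \<in> insert n (e ` ?I)" "y \<in> insert n (e ` ?I)" "x \<noteq> y"
    then consider "x = n" "y \<in> e ` ?I" | "y = n" "x \<in> e ` ?I" | "x \<in> e ` ?I" "y \<in> e ` ?I" by auto
    then show "x \<bullet> y = 0"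
    proof cases
      case 3
      then obtain i j where "i \<in> ?I" "j \<in> ?I" "x = e i" "y = e j" by blast
      then show ?thesis using e[of i j] \<open>x \<noteq> y\<close> by auto
    qed (use en in \<open>auto simp: inner_commute[of n]\<close>)
  qed
  have ind: "independent B"
    by (rule pairwise_orthogonal_independent[OF orth]) (use norm1 in force)
  have "card B = CARD('n)" using n_notin inj by (simp add: B_def card_image)
  then have "UNIV \<subseteq> span B" using ind by (intro card_ge_dim_independent) (auto simp: dim_UNIV)
  then have "(\<Sum>b\<in>B. (v \<bullet> b) *\<^sub>R b) = v"
    by (intro orthonormal_basis_expand[OF orth norm1 _ fin]) auto
  then have "v \<bullet> v = v \<bullet> (\<Sum>b\<in>B. (v \<bullet> b) *\<^sub>R b)" by simp
  also have "\<dots> = (\<Sum>b\<in>B. (v \<bullet> b)\<^sup>2)" by (simp add: inner_sum_right power2_eq_square)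
  also have "\<dots> = (v \<bullet> n)\<^sup>2 + (\<Sum>i\<in>?I. (v \<bullet> e i)\<^sup>2)"
    using n_notin inj by (simp add: B_def sum.reindex)
  finally show ?thesis by simp
qed

subsection \<open>Curvature of level sets\<close>

text \<open>The derivative of the normalised gradient in direction \<open>e i\<close> is the
  projection of the Hessian applied to \<open>e i\<close> off the normal, divided by
  \<open>norm (grad \<Omega> u x)\<close>. It agrees up to sign with the derivative of the given
  normal field, hence the absolute value of \<open>\<kappa> i\<close>.\<close>

lemma level_set_curvature:
  fixes \<Omega> :: "(real^'n) set" and D :: "'n \<Rightarrow> real^'n \<Rightarrow> real^'n"
  assumes "open \<Omega>" and u: "C1_closure \<Omega> u (grad \<Omega> u)" and D: "\<And>m. C1_closure \<Omega> (pd \<Omega> m u) (D m)"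
    and x: "x \<in> \<Omega>" and G0: "grad \<Omega> u x \<noteq> 0"
    and pc: "principal_curvatures (regular_level_set \<Omega> u x) x \<kappa>"
  obtains e :: "nat \<Rightarrow> real^'n"
  where "\<And>i j. i \<in> {1..CARD('n) - 1} \<Longrightarrow> j \<in> {1..CARD('n) - 1} \<Longrightarrow> e i \<bullet> e j = (if i = j then 1 else 0)"
    "\<And>i. i \<in> {1..CARD('n) - 1} \<Longrightarrow> grad \<Omega> u x \<bullet> e i = 0"
    "\<And>i. i \<in> {1..CARD('n) - 1} \<Longrightarrow>
      norm ((\<chi> m. D m x \<bullet> e i) - ((\<chi> m. D m x \<bullet> e i) \<bullet> sgn (grad \<Omega> u x)) *\<^sub>R sgn (grad \<Omega> u x)) = norm (grad \<Omega> u x) * \<bar>\<kappa> i\<bar>"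
proof -
  define G where "G = grad \<Omega> u x"
  define H where "H v = (\<chi> m. D m x \<bullet> v)" for v :: "real^'n"
  define nn where "nn y = inverse (norm (grad \<Omega> u y)) *\<^sub>R grad \<Omega> u y" for y
  define S where "S = regular_level_set \<Omega> u x"
  define U where "U = \<Omega> \<inter> grad \<Omega> u -` (- {0})"
  have U: "open U"
    unfolding U_def
    by (rule continuous_open_preimage[OF continuous_on_subset[OF C1_closureD(2)[OF u] closure_subset] assms(1)]) auto
  have tangent: "tangent_space S y = {w. grad \<Omega> u y \<bullet> w = 0}" if y: "y \<in> S" for y
  proof (rule tangent_space_level_set[where U=U and F="\<lambda>z. u z - u x", OF U])
    have y': "y \<in> \<Omega>" "u y = u x" "grad \<Omega> u y \<noteq> 0" using y by (auto simp: S_def regular_level_set_def)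
    then show "y \<in> U" "u y - u x = 0" "grad \<Omega> u y \<noteq> 0" by (auto simp: U_def)
    show "S \<inter> U = {y \<in> U. u y - u x = 0}" by (auto simp: S_def U_def regular_level_set_def)
    have "continuous_on U u"
      by (rule continuous_on_subset[OF C1_closureD(1)[OF u]]) (use closure_subset in \<open>auto simp: U_def\<close>)
    then show "continuous_on U (\<lambda>z. u z - u x)" by (intro continuous_intros)
    have "((\<lambda>z. u z - u x) has_derivative (\<lambda>v. grad \<Omega> u y \<bullet> v - 0)) (at y)"
      by (intro has_derivative_diff C1_closureD(3)[OF u y'(1)] has_derivative_const)
    then show "((\<lambda>z. u z - u x) has_derivative (\<lambda>v. grad \<Omega> u y \<bullet> v)) (at y)" by simp
  qed
  have xS: "x \<in> S" using x G0 by (simp add: S_def regular_level_set_def)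
  have g: "norm G > 0" using G0 by (simp add: G_def)
  have dG: "(grad \<Omega> u has_derivative H) (at x)"
    unfolding has_derivative_componentwise_within[of "grad \<Omega> u"]
    by (auto simp: Basis_vec_def inner_axis grad_def H_def intro!: C1_closureD(3)[OF D x])
  have dn: "((\<lambda>y. norm (grad \<Omega> u y)) has_derivative (\<lambda>v. H v \<bullet> sgn G)) (at x)"
    using has_derivative_compose[OF dG has_derivative_norm[OF G0]] by (simp add: G_def)
  have "((\<lambda>y. inverse (norm (grad \<Omega> u y))) has_derivative (\<lambda>v. - (inverse (norm G) * (H v \<bullet> sgn G) * inverse (norm G)))) (at x)"
    using Deriv.has_derivative_inverse[OF _ dn] g by (simp add: G_def)
  from has_derivative_scaleR[OF this dG]
  have dnn: "(nn has_derivative (\<lambda>v. inverse (norm G) *\<^sub>R (H v - (H v \<bullet> sgn G) *\<^sub>R sgn G))) (at x)"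
    by (simp add: nn_def[abs_def] G_def[symmetric] sgn_div_norm algebra_simps)
  define Dn where "Dn v = inverse (norm G) *\<^sub>R (H v - (H v \<bullet> sgn G) *\<^sub>R sgn G)" for v
  have dnn: "(nn has_derivative Dn) (at x)" using dnn by (simp add: Dn_def[abs_def])
  obtain N W e where N: "unit_normal_field_near S x N" "(N has_derivative W) (at x within S)"
    and eS: "\<And>i. i \<in> {1..CARD('n) - 1} \<Longrightarrow> e i \<in> tangent_space S x \<and> W (e i) = - \<kappa> i *\<^sub>R e i"
    and orth: "\<And>i j. i \<in> {1..CARD('n) - 1} \<Longrightarrow> j \<in> {1..CARD('n) - 1} \<Longrightarrow> e i \<bullet> e j = (if i = j then 1 else 0)"
    using pc unfolding principal_curvatures_def S_def[symmetric] by blast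
  obtain \<epsilon> where \<epsilon>: "\<epsilon> > 0" "\<And>y. y \<in> S \<inter> ball x \<epsilon> \<Longrightarrow> norm (N y) = 1 \<and> (\<forall>w\<in>tangent_space S y. N y \<bullet> w = 0)"
    using N(1) unfolding unit_normal_field_near_def by blast
  \<comment> \<open>The sign relating the given normal field to the normalised gradient. It takes
    the values 1 and -1 and is continuous along curves at \<open>x\<close>, so it is locally
    constant there.\<close>
  define \<tau> where "\<tau> y = N y \<bullet> nn y" for y
  have N_eq: "N y = \<tau> y *\<^sub>R nn y \<and> (\<tau> y = 1 \<or> \<tau> y = -1)" if y: "y \<in> S \<inter> ball x \<epsilon>" for y
  proof -
    have G': "grad \<Omega> u y \<noteq> 0" using y by (auto simp: S_def regular_level_set_def)
    then have n1: "nn y \<bullet> nn y = 1" by (simp add: nn_def dot_square_norm power2_eq_square)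
    have "N y = nn y \<or> N y = - nn y"
      unfolding nn_def by (rule unit_orthogonal_to_complement) (use \<epsilon>(2)[OF y] tangent[of y] y G' in auto)
    then show ?thesis using n1 by (auto simp: \<tau>_def)
  qed
  have main: "norm (Dn (e i)) = \<bar>\<kappa> i\<bar>" if i: "i \<in> {1..CARD('n) - 1}" for i
  proof -
    \<comment> \<open>The derivative of \<open>N\<close> within \<open>S\<close> is determined on
      tangent vectors only, so the two normal fields are compared along a curve in \<open>S\<close>
      with velocity \<open>e i\<close>.\<close>
    obtain \<gamma> \<delta> where \<gamma>: "0 < \<delta>" "\<gamma> 0 = x" "\<And>t. \<bar>t\<bar> < \<delta> \<Longrightarrow> \<gamma> t \<in> S" "(\<gamma> has_vector_derivative e i) (at 0)"
      using eS[OF i] unfolding tangent_space_def by blast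
    define T where "T = {-\<delta><..<\<delta>}"
    have T: "open T" "0 \<in> T" "\<gamma> ` T \<subseteq> S" using \<gamma>(1,3) by (auto simp: T_def)
    have dg: "(\<gamma> has_derivative (\<lambda>h. h *\<^sub>R e i)) (at 0)" using \<gamma>(4) by (simp add: has_vector_derivative_def)
    have "(N has_derivative W) (at (\<gamma> 0) within \<gamma> ` T)"
      unfolding \<gamma>(2) by (rule has_derivative_subset[OF N(2) T(3)])
    from has_derivative_in_compose[OF has_derivative_at_withinI[OF dg] this]
    have dN: "((\<lambda>t. N (\<gamma> t)) has_derivative (\<lambda>h. W (h *\<^sub>R e i))) (at 0)"
      by (simp add: at_within_open[OF T(2,1)])
    have dnng: "((\<lambda>t. nn (\<gamma> t)) has_derivative (\<lambda>h. Dn (h *\<^sub>R e i))) (at 0)"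
      by (rule has_derivative_compose[OF dg]) (simp add: \<gamma>(2) dnn)
    have "isCont (\<lambda>t. \<tau> (\<gamma> t)) 0"
      unfolding \<tau>_def by (intro continuous_intros has_derivative_continuous[OF dN] has_derivative_continuous[OF dnng])
    then have "((\<lambda>t. \<tau> (\<gamma> t)) \<longlongrightarrow> \<tau> (\<gamma> 0)) (nhds 0)" by (simp add: continuous_at_imp_continuous_at_within isCont_def tendsto_nhds_iff)
    then have ev1: "\<forall>\<^sub>F t in nhds 0. dist (\<tau> (\<gamma> t)) (\<tau> (\<gamma> 0)) < 1" using tendstoD zero_less_one by blast
    have "isCont \<gamma> 0" by (rule has_derivative_continuous[OF dg])
    then have "(\<gamma> \<longlongrightarrow> x) (nhds 0)" using \<gamma>(2) by (simp add: isCont_def tendsto_nhds_iff)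
    then have ev2: "\<forall>\<^sub>F t in nhds 0. \<gamma> t \<in> ball x \<epsilon>" by (rule topological_tendstoD) (use \<epsilon> in auto)
    have ev3: "\<forall>\<^sub>F t in nhds 0. t \<in> T" by (rule eventually_nhds_in_open[OF T(1,2)])
    have ev: "\<forall>\<^sub>F t in nhds 0. \<tau> x *\<^sub>R nn (\<gamma> t) = N (\<gamma> t)"
      using ev1 ev2 ev3
    proof eventually_elim
      case (elim t)
      then have "\<gamma> t \<in> S \<inter> ball x \<epsilon>" "x \<in> S \<inter> ball x \<epsilon>" using T(3) xS \<epsilon>(1) by auto
      from N_eq[OF this(1)] N_eq[OF this(2)] elim(1) \<gamma>(2) show ?case by (auto simp: dist_real_def)
    qed
    have "((\<lambda>t. \<tau> x *\<^sub>R nn (\<gamma> t)) has_derivative (\<lambda>h. \<tau> x *\<^sub>R Dn (h *\<^sub>R e i))) (at 0)"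
      by (rule has_derivative_scaleR_right[OF dnng])
    then have "((\<lambda>t. N (\<gamma> t)) has_derivative (\<lambda>h. \<tau> x *\<^sub>R Dn (h *\<^sub>R e i))) (at 0)"
      by (rule has_derivative_transform_eventually)
        (use ev eventually_nhds_x_imp_x[OF ev] in \<open>auto simp: eventually_at_filter elim: eventually_mono\<close>)
    from has_derivative_unique[OF dN this] have "W (1 *\<^sub>R e i) = \<tau> x *\<^sub>R Dn (1 *\<^sub>R e i)" by metis
    then have "norm (\<tau> x *\<^sub>R Dn (e i)) = norm (- \<kappa> i *\<^sub>R e i)" using eS[OF i] by simp
    moreover have "\<bar>\<tau> x\<bar> = 1" using N_eq[of x] xS \<epsilon>(1) by auto
    moreover have "norm (e i) = 1" using orth[OF i i] by (simp add: norm_eq_1)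
    ultimately show ?thesis by simp
  qed
  show thesis
  proof (rule that[OF orth])
    fix i assume i: "i \<in> {1..CARD('n) - 1}"
    show "grad \<Omega> u x \<bullet> e i = 0" using eS[OF i] tangent[OF xS] by auto
    have "norm (Dn (e i)) = inverse (norm G) * norm (H (e i) - (H (e i) \<bullet> sgn G) *\<^sub>R sgn G)"
      by (simp add: Dn_def)
    then have "norm (H (e i) - (H (e i) \<bullet> sgn G) *\<^sub>R sgn G) = norm G * \<bar>\<kappa> i\<bar>"
      using main[OF i] g by (simp add: field_simps)
    then show "norm ((\<chi> m. D m x \<bullet> e i) - ((\<chi> m. D m x \<bullet> e i) \<bullet> sgn (grad \<Omega> u x)) *\<^sub>R sgn (grad \<Omega> u x)) = norm (grad \<Omega> u x) * \<bar>\<kappa> i\<bar>"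
      by (simp add: H_def G_def)
  qed
qed

text \<open>The Hessian is expanded in the frame of principal directions and normal. Here
  \<open>w\<close> is the Hessian applied to the gradient, so dividing it by the norm of the
  gradient gives the gradient of that norm. Both sides reduce to expressions in \<open>g\<close>,
  \<open>ww\<close>, \<open>wn\<close> and \<open>K\<close>.\<close>

lemma geometric_identity:
  fixes \<Omega> :: "(real^'n) set" and D :: "'n \<Rightarrow> real^'n \<Rightarrow> real^'n"
  assumes "open \<Omega>" and u: "C1_closure \<Omega> u (grad \<Omega> u)" and D: "\<And>m. C1_closure \<Omega> (pd \<Omega> m u) (D m)"
    and x: "x \<in> \<Omega>" and G0: "grad \<Omega> u x \<noteq> 0" and sym: "\<And>m j. D m x $ j = D j x $ m"
    and pc: "principal_curvatures (regular_level_set \<Omega> u x) x \<kappa>"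
    and w: "w = (\<Sum>m\<in>UNIV. pd \<Omega> m u x *\<^sub>R D m x)"
  shows "lambda1 a (norm (grad \<Omega> u x)) * (norm (tangential_grad \<Omega> u (\<lambda>y. norm (grad \<Omega> u y)) x))\<^sup>2
      + a (norm (grad \<Omega> u x)) * (norm (grad \<Omega> u x))\<^sup>2 * (\<Sum>j=1..CARD('n) - 1. (\<kappa> j)\<^sup>2)
    = (\<Sum>m\<in>UNIV. (A_matrix a (grad \<Omega> u x) *v D m x) \<bullet> D m x)
      - ((A_matrix a (grad \<Omega> u x) *v w) \<bullet> w) / (norm (grad \<Omega> u x))\<^sup>2"
proof -
  define G where "G = grad \<Omega> u x"
  define g where "g = norm G"
  define n where "n = sgn G"
  define H where "H v = (\<chi> m. D m x \<bullet> v)" for v :: "real^'n"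
  let ?I = "{1..CARD('n) - 1}"
  have g: "g > 0" using G0 by (simp add: g_def G_def)
  have G_n: "G = g *\<^sub>R n" using g by (simp add: g_def n_def sgn_div_norm)
  have n1: "norm n = 1" "n \<bullet> n = 1" using g by (simp_all add: n_def g_def norm_sgn norm_eq_1[symmetric])
  have Gm: "pd \<Omega> m u x = G $ m" for m by (simp add: G_def grad_def)
  obtain e where e: "\<And>i j. i \<in> ?I \<Longrightarrow> j \<in> ?I \<Longrightarrow> e i \<bullet> e j = (if i = j then 1 else 0)"
    "\<And>i. i \<in> ?I \<Longrightarrow> G \<bullet> e i = 0"
    "\<And>i. i \<in> ?I \<Longrightarrow> norm (H (e i) - (H (e i) \<bullet> n) *\<^sub>R n) = g * \<bar>\<kappa> i\<bar>"
    using level_set_curvature[OF assms(1) u D x G0 pc] unfolding G_def[symmetric] H_def[symmetric] g_def[symmetric] n_def[symmetric] by blast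
  have en: "e i \<bullet> n = 0" if "i \<in> ?I" for i using e(2)[OF that] g by (simp add: G_n inner_commute)
  note parseval = parseval[where e=e and n=n, OF n1(1) en e(1)]
  have wv: "w \<bullet> v = G \<bullet> H v" for v
    unfolding w Gm by (simp add: inner_sum_left inner_vec_def[of G] H_def)
  have wm: "w $ m = G \<bullet> D m x" for m
    unfolding w Gm by (simp add: inner_vec_def[of G] sym[of m])
  have HG: "H G = w" by (simp add: vec_eq_iff wm H_def inner_commute)
  have Hn: "H n = inverse g *\<^sub>R w"
  proof -
    have "H G = g *\<^sub>R H n" unfolding G_n by (simp add: H_def vec_eq_iff)
    then show ?thesis using HG g by simp
  qed
  have HH: "H v \<bullet> H v = (\<Sum>m\<in>UNIV. (D m x \<bullet> v)\<^sup>2)" for v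
    by (simp add: H_def inner_vec_def[of "vec_lambda _"] power2_eq_square)
  have Hn_e: "H (e i) \<bullet> n = (w \<bullet> e i) / g" for i
    using wv[of "e i"] g by (simp add: G_n inner_commute)
  have He: "H (e i) \<bullet> H (e i) = g\<^sup>2 * (\<kappa> i)\<^sup>2 + ((w \<bullet> e i) / g)\<^sup>2" if i: "i \<in> ?I" for i
  proof -
    have "(norm (H (e i) - (H (e i) \<bullet> n) *\<^sub>R n))\<^sup>2 = H (e i) \<bullet> H (e i) - (H (e i) \<bullet> n)\<^sup>2"
      using n1(2) by (simp add: power2_norm_eq_inner inner_diff_left inner_diff_right inner_commute, simp add: power2_eq_square)
    then show ?thesis using e(3)[OF i] by (simp add: Hn_e power_mult_distrib)
  qed
  define K where "K = (\<Sum>i\<in>?I. (\<kappa> i)\<^sup>2)"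
  define ww where "ww = w \<bullet> w"
  define wn where "wn = w \<bullet> n"
  have P2: "(\<Sum>i\<in>?I. (w \<bullet> e i)\<^sup>2) = ww - wn\<^sup>2" using parseval[of w] by (simp add: ww_def wn_def)
  \<comment> \<open>\<open>ww / g\<^sup>2\<close> comes from the Hessian applied to the normal. For
    the principal directions, the tangential parts give \<open>g\<^sup>2 * K\<close>; the normal
    parts repeat the mixed entries, by symmetry, and give the last summand.\<close>
  have S1: "(\<Sum>m\<in>UNIV. D m x \<bullet> D m x) = ww / g\<^sup>2 + g\<^sup>2 * K + (ww - wn\<^sup>2) / g\<^sup>2"
  proof -
    have "(\<Sum>m\<in>UNIV. D m x \<bullet> D m x) = (\<Sum>m\<in>UNIV. (D m x \<bullet> n)\<^sup>2 + (\<Sum>i\<in>?I. (D m x \<bullet> e i)\<^sup>2))"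
      by (simp only: parseval)
    also have "\<dots> = H n \<bullet> H n + (\<Sum>i\<in>?I. H (e i) \<bullet> H (e i))"
      by (simp only: sum.distrib HH) (simp only: sum.swap[of _ ?I])
    also have "H n \<bullet> H n = ww / g\<^sup>2" by (simp add: Hn ww_def power2_eq_square divide_inverse)
    also have "(\<Sum>i\<in>?I. H (e i) \<bullet> H (e i)) = (\<Sum>i\<in>?I. g\<^sup>2 * (\<kappa> i)\<^sup>2 + ((w \<bullet> e i) / g)\<^sup>2)"
      by (intro sum.cong refl He)
    also have "\<dots> = g\<^sup>2 * K + (ww - wn\<^sup>2) / g\<^sup>2"
      by (simp only: sum.distrib power_divide sum_divide_distrib[symmetric] P2 sum_distrib_left[symmetric] K_def)
    finally show ?thesis by simp
  qed
  define c where "c = deriv a g / g"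
  have Av: "(A_matrix a G *v v) \<bullet> v = c * (G \<bullet> v)\<^sup>2 + a g * (v \<bullet> v)" for v
    using G0 by (simp add: A_matrix_mult G_def[symmetric] g_def[symmetric] c_def inner_add_left power2_eq_square)
  have A1: "(\<Sum>m\<in>UNIV. (A_matrix a G *v D m x) \<bullet> D m x) = c * ww + a g * (ww / g\<^sup>2 + g\<^sup>2 * K + (ww - wn\<^sup>2) / g\<^sup>2)"
  proof -
    have "ww = (\<Sum>m\<in>UNIV. (w $ m)\<^sup>2)" by (simp add: ww_def inner_vec_def power2_eq_square)
    then have "(\<Sum>m\<in>UNIV. (G \<bullet> D m x)\<^sup>2) = ww" by (simp only: wm)
    then show ?thesis by (simp only: Av sum.distrib sum_distrib_left[symmetric] S1)
  qed
  have A2: "(A_matrix a G *v w) \<bullet> w = c * (g * wn)\<^sup>2 + a g * ww"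
  proof -
    have "G \<bullet> w = g * wn" by (simp add: G_n wn_def inner_commute)
    then show ?thesis by (simp only: Av ww_def)
  qed
  have tg: "(norm (tangential_grad \<Omega> u (\<lambda>y. norm (grad \<Omega> u y)) x))\<^sup>2 = (ww - wn\<^sup>2) / g\<^sup>2"
  proof -
    have dG: "(grad \<Omega> u has_derivative H) (at x)"
      unfolding has_derivative_componentwise_within[of "grad \<Omega> u"]
      by (auto simp: Basis_vec_def inner_axis grad_def H_def intro!: C1_closureD(3)[OF D x])
    have "((\<lambda>y. norm (grad \<Omega> u y)) has_derivative (\<lambda>v. H v \<bullet> n)) (at x)"
      using has_derivative_compose[OF dG has_derivative_norm[OF G0]] by (simp add: n_def G_def)
    moreover have "H v \<bullet> n = (inverse g *\<^sub>R w) \<bullet> v" for v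
      using wv[of v] g by (simp add: G_n inner_commute)
    ultimately have "((\<lambda>y. norm (grad \<Omega> u y)) has_derivative (\<lambda>v. (inverse g *\<^sub>R w) \<bullet> v)) (at x)" by simp
    from grad_in[OF this x] have "tangential_grad \<Omega> u (\<lambda>y. norm (grad \<Omega> u y)) x = inverse g *\<^sub>R (w - wn *\<^sub>R n)"
      by (simp add: tangential_grad_def Let_def G_def[symmetric] g_def[symmetric] wn_def n_def sgn_div_norm scaleR_diff_right)
    moreover have "(norm (w - wn *\<^sub>R n))\<^sup>2 = ww - wn\<^sup>2"
      using n1(2) by (simp add: power2_norm_eq_inner inner_diff_left inner_diff_right wn_def ww_def inner_commute, simp add: power2_eq_square)
    ultimately show ?thesis by (simp add: power_mult_distrib divide_inverse power_inverse)
  qed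
  \<comment> \<open>Puts the coefficient over the denominator \<open>g\<^sup>2\<close>, in which
    form it combines with \<open>a g\<close> to \<open>lambda1 a g\<close>.\<close>
  have c: "c = deriv a g * g / g\<^sup>2" using g by (simp add: c_def power2_eq_square)
  show ?thesis
    unfolding tg G_def[symmetric] g_def[symmetric] A1 A2 K_def[symmetric] lambda1_def c
    using g by (simp add: field_simps) (simp add: power2_eq_square algebra_simps)?
qed

subsection \<open>Stability\<close>

locale stable_solution = regular_domain \<Omega> \<sigma>
  for \<Omega> :: "(real^'n) set" and \<sigma> +
  fixes a f h :: "real \<Rightarrow> real" and u \<phi> :: "real^'n \<Rightarrow> real" and k :: "real^'n \<Rightarrow> nat \<Rightarrow> real"
  assumes f_C1: "f C1_differentiable_on UNIV"
    and h_C1: "h C1_differentiable_on UNIV"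
    and a_reg: "C11_loc_pos a"
    and a_pos: "\<And>t. t > 0 \<Longrightarrow> a t > 0"
    and a_ell: "\<And>t. t > 0 \<Longrightarrow> a t + deriv a t * t > 0"
    and u_C2: "Ck_closure 2 \<Omega> u"
    and u_sol: "stable_weak_solution \<Omega> \<sigma> a f h u"
    and curv: "\<And>x. x \<in> \<Omega> \<Longrightarrow> grad \<Omega> u x \<noteq> 0 \<Longrightarrow> principal_curvatures (regular_level_set \<Omega> u x) x (k x)"
    and phi_C1: "Ck_closure 1 \<Omega> \<phi>"
begin

abbreviation "G \<equiv> grad \<Omega> u"
abbreviation "p m \<equiv> pd \<Omega> m u"
abbreviation "D m \<equiv> grad \<Omega> (pd \<Omega> m u)"
abbreviation "A x \<equiv> A_matrix a (G x)"
abbreviation "D\<phi> \<equiv> grad \<Omega> \<phi>"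

lemma u_C1: "C1_closure \<Omega> u G" and p_C1: "C1_closure \<Omega> (p m) (D m)"
  using u_C2 Ck_closure_2[OF open_\<Omega>, of u] by blast+

lemma phi_closure: "C1_closure \<Omega> \<phi> D\<phi>"
  using phi_C1 Ck_closure_1[OF open_\<Omega>, of \<phi>] by blast

lemma G_component: "G x $ m = p m x"
  by (simp add: grad_def)

lemma a_derivative: "t > 0 \<Longrightarrow> (a has_real_derivative deriv a t) (at t)" and a'_isCont: "t > 0 \<Longrightarrow> isCont (deriv a) t"
proof -
  have a: "a C1_differentiable_on {0<..}" using a_reg by (simp add: C11_loc_pos_def)
  show "t > 0 \<Longrightarrow> (a has_real_derivative deriv a t) (at t)" using C1_differentiable_on_real(1)[OF a] by simp
  show "t > 0 \<Longrightarrow> isCont (deriv a) t"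
    using C1_differentiable_on_real(2)[OF a] continuous_on_eq_continuous_at[of "{0<..}" "deriv a"] by simp
qed

text \<open>The interior identity extends by continuity; the boundary case is used in
  \<open>boundary_term_eq\<close>.\<close>

lemma hessian_symmetric:
  assumes "x \<in> closure \<Omega>" shows "D m x $ j = D j x $ m"
proof -
  have in\<Omega>: "D m y $ j - D j y $ m = 0" if "y \<in> \<Omega>" for y
  proof -
    have "D m y $ j = D j y $ m"
    proof (rule second_derivative_symmetric[where G=G and H=D, OF open_\<Omega> that])
      show "(u has_derivative (\<lambda>v. G y \<bullet> v)) (at y)" if "y \<in> \<Omega>" for y by (rule C1_closureD(3)[OF u_C1 that])
      show "((\<lambda>y. G y $ i) has_derivative (\<lambda>v. D i y \<bullet> v)) (at y)" if "y \<in> \<Omega>" for y i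
        unfolding G_component by (rule C1_closureD(3)[OF p_C1 that])
      show "continuous_on \<Omega> (D i)" for i
        by (rule continuous_on_subset[OF C1_closureD(2)[OF p_C1] closure_subset])
    qed
    then show ?thesis by simp
  qed
  have "continuous_on (closure \<Omega>) (\<lambda>y. D m y $ j - D j y $ m)"
    by (intro continuous_intros C1_closureD(2)[OF p_C1])
  then have "D m x $ j - D j x $ m = 0"
    using continuous_constant_on_closure[of \<Omega> "\<lambda>y. D m y $ j - D j y $ m" 0 x] in\<Omega> assms by blast
  then show ?thesis by simp
qed

text \<open>A critical point in the closure contradicts (A1), so the remaining alternative gives
  regularity of the flux at 0 exactly when 0 is a value of the gradient.\<close>

lemma gradient_zero_imp_A2: "x \<in> closure \<Omega> \<Longrightarrow> G x = 0 \<Longrightarrow> cond_A2 a"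
  using u_sol unfolding stable_weak_solution_def weak_solution_def cond_A1_def by blast

lemma flux_derivative:
  assumes "\<xi> \<in> G ` closure \<Omega>"
  shows "((\<lambda>\<xi>. a (norm \<xi>) * \<xi> $ j) has_derivative (\<lambda>v. A_matrix a \<xi> $ j \<bullet> v)) (at \<xi>)"
    and "isCont (\<lambda>\<xi>. A_matrix a \<xi> $ j) \<xi>"
proof -
  show "((\<lambda>\<xi>. a (norm \<xi>) * \<xi> $ j) has_derivative (\<lambda>v. A_matrix a \<xi> $ j \<bullet> v)) (at \<xi>)"
  proof (cases "\<xi> = 0")
    case True
    then have "cond_A2 a" using assms gradient_zero_imp_A2 by force
    then show ?thesis using flux_C1_at_zero(1)[of a j] a_derivative True by simp
  next
    case False
    then show ?thesis by (intro flux_component_derivative a_derivative) auto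
  qed
  show "isCont (\<lambda>\<xi>. A_matrix a \<xi> $ j) \<xi>"
  proof (cases "\<xi> = 0")
    case True
    then have "cond_A2 a" using assms gradient_zero_imp_A2 by force
    then show ?thesis using flux_C1_at_zero(2)[of a j] a_derivative True by simp
  next
    case False
    then show ?thesis by (intro A_matrix_row_isCont DERIV_isCont[OF a_derivative] a'_isCont) auto
  qed
qed

lemma A_row_continuous: "continuous_on (G ` closure \<Omega>) (\<lambda>\<xi>. A_matrix a \<xi> $ j)"
  by (rule continuous_at_imp_continuous_on) (use flux_derivative(2) in blast)

lemma A_mult_component: "(A x *v v) $ j = A x $ j \<bullet> v"
  by (simp add: matrix_vector_mult_def inner_vec_def)

lemma continuous_on_A_mult:
  assumes "continuous_on (closure \<Omega>) F"
  shows "continuous_on (closure \<Omega>) (\<lambda>x. A x *v F x)"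
proof -
  have cA: "continuous_on (closure \<Omega>) (\<lambda>x. A x $ j)" for j
    by (rule continuous_on_compose2[OF A_row_continuous C1_closureD(2)[OF u_C1]]) auto
  have "continuous_on (closure \<Omega>) (\<lambda>x. \<chi> j. A x $ j \<bullet> F x)"
    by (intro continuous_on_vec_lambda continuous_on_inner assms cA)
  moreover have "A x *v F x = (\<chi> j. A x $ j \<bullet> F x)" for x by (simp add: vec_eq_iff A_mult_component)
  ultimately show ?thesis by simp
qed

text \<open>At a critical point \<open>A\<close> is \<open>a 0\<close> times the identity, and
  positivity of \<open>a\<close> on the open half-line passes to the limit as
  \<open>0 \<le> a 0\<close>.\<close>

lemma A_nonneg:
  assumes "x \<in> closure \<Omega>" shows "(A x *v v) \<bullet> v \<ge> 0"
proof (cases "G x = 0")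
  case True
  then have "continuous_on {0..} a" using gradient_zero_imp_A2[OF assms] by (simp add: cond_A2_def)
  then have "(a \<longlongrightarrow> a 0) (at 0 within {0..})" by (simp add: continuous_on_def)
  then have "(a \<longlongrightarrow> a 0) (at_right 0)" by (rule tendsto_within_subset) auto
  then have "0 \<le> a 0"
  proof (rule tendsto_lowerbound)
    show "\<forall>\<^sub>F t in at_right 0. 0 \<le> a t"
      unfolding eventually_at_filter by (rule always_eventually) (auto intro: less_imp_le a_pos)
  qed simp
  then show ?thesis using True by (simp add: A_matrix_mult)
next
  case False
  then show ?thesis by (intro A_matrix_nonneg a_pos a_ell) auto
qed

definition V :: "'n \<Rightarrow> real^'n \<Rightarrow> real" where "V j x = a (norm (G x)) * p j x"
definition DV :: "'n \<Rightarrow> real^'n \<Rightarrow> real^'n" where "DV j x = (\<Sum>m\<in>UNIV. A x $ j $ m *\<^sub>R D m x)"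

lemma V_C1: "C1_closure \<Omega> (V j) (DV j)"
proof -
  have "C1_closure \<Omega> (\<lambda>x. a (norm (G x)) * G x $ j) (\<lambda>x. \<Sum>m\<in>UNIV. A x $ j $ m *\<^sub>R D m x)"
    by (rule C1_closure_compose_vec[where P=G and F="\<lambda>\<xi>. a (norm \<xi>) * \<xi> $ j" and A="\<lambda>\<xi>. A_matrix a \<xi> $ j"])
      (simp_all add: G_component p_C1 flux_derivative(1) A_row_continuous)
  then show ?thesis by (simp add: V_def[abs_def] DV_def[abs_def] G_component)
qed

text \<open>The chain rule gives rows of \<open>A\<close> contracted with
  \<open>\<nabla>u_k\<close>; symmetry of the Hessian turns this into the matrix applied to
  \<open>\<nabla>u_m\<close>.\<close>

lemma DV_component:
  assumes "x \<in> closure \<Omega>" shows "DV j x $ m = (A x *v D m x) $ j"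
  by (simp add: DV_def matrix_vector_mult_def hessian_symmetric[OF assms, of _ m])

lemma hu_C1: "C1_closure \<Omega> (\<lambda>x. h (u x)) (\<lambda>x. deriv h (u x) *\<^sub>R G x)"
  and fu_C1: "C1_closure \<Omega> (\<lambda>x. f (u x)) (\<lambda>x. deriv f (u x) *\<^sub>R G x)"
  by (rule C1_closure_compose[OF u_C1];
      use C1_differentiable_on_real[OF h_C1] C1_differentiable_on_real[OF f_C1] in \<open>auto intro: continuous_on_subset\<close>)+

lemma deriv_hu_continuous: "continuous_on (closure \<Omega>) (\<lambda>x. deriv h (u x))"
  and deriv_fu_continuous: "continuous_on (closure \<Omega>) (\<lambda>x. deriv f (u x))"
  using continuous_on_compose2[OF C1_differentiable_on_real(2)[OF h_C1] C1_closureD(1)[OF u_C1]]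
    continuous_on_compose2[OF C1_differentiable_on_real(2)[OF f_C1] C1_closureD(1)[OF u_C1]] by auto

lemma V_weak_flux: "weak_flux V (\<lambda>x. h (u x)) (\<lambda>x. f (u x))"
  unfolding weak_flux_def
proof (intro allI impI)
  fix \<psi> D\<psi> assume \<psi>: "C1_closure \<Omega> \<psi> D\<psi>"
  have "dom_int (\<lambda>x. a (norm (G x)) * (G x \<bullet> grad \<Omega> \<psi> x)) + bd_int (\<lambda>x. h (u x) * \<psi> x) - dom_int (\<lambda>x. f (u x) * \<psi> x) = 0"
    using u_sol C1_closure_imp_Ck[OF open_\<Omega> \<psi>] unfolding stable_weak_solution_def weak_solution_def by blast
  moreover have "dom_int (\<lambda>x. a (norm (G x)) * (G x \<bullet> grad \<Omega> \<psi> x)) = dom_int (\<lambda>x. \<Sum>j\<in>UNIV. V j x * D\<psi> x $ j)"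
  proof (rule dom_int_cong)
    fix x assume "x \<in> \<Omega>"
    then have "grad \<Omega> \<psi> x = D\<psi> x" using C1_closure_grad_eq[OF \<psi>] closure_subset by blast
    then show "a (norm (G x)) * (G x \<bullet> grad \<Omega> \<psi> x) = (\<Sum>j\<in>UNIV. V j x * D\<psi> x $ j)"
      by (simp add: V_def inner_vec_def[of "G x"] G_component sum_distrib_left mult.assoc)
  qed
  ultimately show "dom_int (\<lambda>x. \<Sum>j\<in>UNIV. V j x * D\<psi> x $ j) + bd_int (\<lambda>x. h (u x) * \<psi> x) - dom_int (\<lambda>x. f (u x) * \<psi> x) = 0" by simp
qed

text \<open>Half the gradient of \<open>\<bar>\<nabla>u\<bar>\<^sup>2\<close>, that is,
  \<open>\<bar>\<nabla>u\<bar> \<nabla>\<bar>\<nabla>u\<bar>\<close> at regular points; unlike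
  \<open>\<nabla>\<bar>\<nabla>u\<bar>\<close> it is continuous on the whole closure.\<close>

definition w :: "real^'n \<Rightarrow> real^'n" where "w x = (\<Sum>m\<in>UNIV. p m x *\<^sub>R D m x)"
definition S :: "real^'n \<Rightarrow> real" where "S x = (\<Sum>m\<in>UNIV. (A x *v D m x) \<bullet> D m x)"
text \<open>The form of \<open>A\<close> at \<open>\<nabla>\<bar>\<nabla>u\<bar>\<close> where the
  gradient is not zero. At critical points the value is 0 by division by zero, and \<open>q\<close>
  may be discontinuous there.\<close>

definition q :: "real^'n \<Rightarrow> real" where "q x = ((A x *v w x) \<bullet> w x) / (norm (G x))\<^sup>2"

abbreviation "geo x \<equiv> lambda1 a (norm (G x)) * (norm (tangential_grad \<Omega> u (\<lambda>y. norm (G y)) x))\<^sup>2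
  + a (norm (G x)) * (norm (G x))\<^sup>2 * (\<Sum>j=1..CARD('n) - 1. (k x j)\<^sup>2)"
abbreviation "int_q \<equiv> dom_int (\<lambda>x. (\<phi> x)\<^sup>2 * q x)"
abbreviation "int_S \<equiv> dom_int (\<lambda>x. (\<phi> x)\<^sup>2 * S x)"
abbreviation "int_cross \<equiv> dom_int (\<lambda>x. 2 * \<phi> x * ((A x *v w x) \<bullet> D\<phi> x))"
abbreviation "int_reaction \<equiv> dom_int (\<lambda>x. deriv f (u x) * (norm (G x))\<^sup>2 * (\<phi> x)\<^sup>2)"
abbreviation "int_boundary \<equiv> bd_int (\<lambda>x. deriv h (u x) * (norm (G x))\<^sup>2 * (\<phi> x)\<^sup>2)"
abbreviation "int_\<phi> \<equiv> dom_int (\<lambda>x. (norm (G x))\<^sup>2 * ((A x *v D\<phi> x) \<bullet> D\<phi> x))"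
abbreviation "bterm \<equiv> boundary_term V (\<lambda>x. h (u x)) (\<lambda>x. f (u x)) p D"

lemma w_continuous: "continuous_on (closure \<Omega>) w"
  unfolding w_def[abs_def] by (intro continuous_intros C1_closureD[OF p_C1])

lemma S_continuous: "continuous_on (closure \<Omega>) S"
  unfolding S_def[abs_def] by (intro continuous_intros continuous_on_A_mult C1_closureD[OF p_C1])

lemmas cont = continuous_on_A_mult w_continuous S_continuous C1_closureD(1,2)[OF u_C1] C1_closureD(1,2)[OF p_C1]
  C1_closureD(1,2)[OF phi_closure] deriv_hu_continuous deriv_fu_continuous C1_closureD(1)[OF hu_C1] C1_closureD(1)[OF fu_C1]

lemmas cont_frontier = continuous_on_subset[OF _ frontier_sub]

text \<open>This is \<open>differentiated_energy\<close> for \<open>\<eta> = \<phi>\<^sup>2\<close>;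
  \<open>int_cross\<close> arises from the gradient of \<open>\<phi>\<^sup>2\<close>.\<close>

lemma energy_identity:
  "int_S + int_cross
      - int_reaction
    = bd_int (\<lambda>x. \<phi> x * \<phi> x * bterm x)"
proof -
  let ?D\<eta> = "\<lambda>x. \<phi> x *\<^sub>R D\<phi> x + \<phi> x *\<^sub>R D\<phi> x"
  have "dom_int (\<lambda>x. (\<Sum>m\<in>UNIV. \<Sum>j\<in>UNIV. DV j x $ m * (\<phi> x * \<phi> x * D m x $ j + p m x * ?D\<eta> x $ j))
      - (\<Sum>m\<in>UNIV. (deriv f (u x) *\<^sub>R G x) $ m * p m x) * (\<phi> x * \<phi> x))
    = bd_int (\<lambda>x. \<phi> x * \<phi> x * bterm x)"
    by (rule differentiated_energy[where \<alpha>="\<lambda>x. a (norm (G x))", OF V_weak_flux V_C1 hu_C1 fu_C1 p_C1 _ C1_closure_mult[OF phi_closure phi_closure]])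
      (simp add: V_def)
  moreover have "dom_int (\<lambda>x. (\<Sum>m\<in>UNIV. \<Sum>j\<in>UNIV. DV j x $ m * (\<phi> x * \<phi> x * D m x $ j + p m x * ?D\<eta> x $ j))
      - (\<Sum>m\<in>UNIV. (deriv f (u x) *\<^sub>R G x) $ m * p m x) * (\<phi> x * \<phi> x))
    = dom_int (\<lambda>x. (\<phi> x)\<^sup>2 * S x + 2 * \<phi> x * ((A x *v w x) \<bullet> D\<phi> x) - deriv f (u x) * (norm (G x))\<^sup>2 * (\<phi> x)\<^sup>2)"
  proof (rule dom_int_cong)
    fix x assume "x \<in> \<Omega>"
    then have x: "x \<in> closure \<Omega>" using closure_subset by blast
    have "(\<Sum>m\<in>UNIV. \<Sum>j\<in>UNIV. DV j x $ m * (\<phi> x * \<phi> x * D m x $ j + p m x * ?D\<eta> x $ j))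
        = (\<Sum>m\<in>UNIV. (A x *v D m x) \<bullet> ((\<phi> x * \<phi> x) *\<^sub>R D m x + p m x *\<^sub>R ?D\<eta> x))"
      by (simp add: DV_component[OF x] inner_vec_def[of "A x *v _"] mult.assoc)
    also have "\<dots> = (\<phi> x * \<phi> x) * S x + (\<Sum>m\<in>UNIV. p m x *\<^sub>R (A x *v D m x)) \<bullet> ?D\<eta> x"
    proof -
      have "(\<Sum>m\<in>UNIV. (A x *v D m x) \<bullet> (c *\<^sub>R D m x + p m x *\<^sub>R e)) = c * S x + (\<Sum>m\<in>UNIV. p m x *\<^sub>R (A x *v D m x)) \<bullet> e" for c e
        by (simp add: inner_add_right sum.distrib S_def sum_distrib_left inner_sum_left)
      then show ?thesis .
    qed
    also have "(\<Sum>m\<in>UNIV. p m x *\<^sub>R (A x *v D m x)) = A x *v w x"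
      by (simp add: vec_eq_iff A_mult_component w_def inner_sum_right)
    finally have 1: "(\<Sum>m\<in>UNIV. \<Sum>j\<in>UNIV. DV j x $ m * (\<phi> x * \<phi> x * D m x $ j + p m x * ?D\<eta> x $ j))
      = (\<phi> x)\<^sup>2 * S x + 2 * \<phi> x * ((A x *v w x) \<bullet> D\<phi> x)"
      unfolding inner_add_right inner_scaleR_right power2_eq_square by simp
    have 2: "(\<Sum>m\<in>UNIV. (deriv f (u x) *\<^sub>R G x) $ m * p m x) = deriv f (u x) * (norm (G x))\<^sup>2"
      by (simp add: power2_norm_eq_inner inner_vec_def[of "G x"] G_component sum_distrib_left mult.assoc)
    show "(\<Sum>m\<in>UNIV. \<Sum>j\<in>UNIV. DV j x $ m * (\<phi> x * \<phi> x * D m x $ j + p m x * ?D\<eta> x $ j))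
      - (\<Sum>m\<in>UNIV. (deriv f (u x) *\<^sub>R G x) $ m * p m x) * (\<phi> x * \<phi> x)
      = (\<phi> x)\<^sup>2 * S x + 2 * \<phi> x * ((A x *v w x) \<bullet> D\<phi> x) - deriv f (u x) * (norm (G x))\<^sup>2 * (\<phi> x)\<^sup>2"
      unfolding 1 2 by (simp add: power2_eq_square)
  qed
  moreover have "dom_int (\<lambda>x. (\<phi> x)\<^sup>2 * S x + 2 * \<phi> x * ((A x *v w x) \<bullet> D\<phi> x) - deriv f (u x) * (norm (G x))\<^sup>2 * (\<phi> x)\<^sup>2)
    = int_S + int_cross
      - int_reaction"
    by (subst dom_int_diff, (intro continuous_intros cont)+, subst dom_int_add, (intro continuous_intros cont)+, simp)
  ultimately show ?thesis by simp
qed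

lemma geometric_density:
  assumes "x \<in> \<Omega>" "G x \<noteq> 0"
  shows "geo x = S x - q x"
  unfolding S_def q_def
  by (rule geometric_identity[OF open_\<Omega> u_C1 p_C1 assms hessian_symmetric curv[OF assms] w_def])
    (use assms(1) closure_subset in blast)

lemma q_nonneg: "x \<in> closure \<Omega> \<Longrightarrow> 0 \<le> q x"
  using A_nonneg[of x "w x"] by (simp add: q_def)

lemma S_nonneg: "x \<in> closure \<Omega> \<Longrightarrow> 0 \<le> S x"
  unfolding S_def by (intro sum_nonneg A_nonneg)

text \<open>At regular points the difference is the geometric density, visibly a sum of nonnegative
  terms; at critical points \<open>q\<close> is 0 and \<open>S\<close> is nonnegative.\<close>

lemma q_le_S:
  assumes x: "x \<in> \<Omega>" shows "q x \<le> S x"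
proof (cases "G x = 0")
  case True
  then show ?thesis using S_nonneg[of x] x closure_subset by (auto simp: q_def)
next
  case False
  have "0 \<le> geo x"
    using a_ell[of "norm (G x)"] a_pos[of "norm (G x)"] False
    by (intro add_nonneg_nonneg mult_nonneg_nonneg sum_nonneg) (auto simp: lambda1_def)
  then show ?thesis using geometric_density[OF x False] by simp
qed

text \<open>Continuity may fail at critical points, so integrability comes from domination by the
  continuous \<open>S\<close>, and measurability from writing the function as a quotient of
  measurable ones.\<close>

lemma phi_q_integrable: "set_integrable lborel \<Omega> (\<lambda>x. (\<phi> x)\<^sup>2 * q x)"
  unfolding set_integrable_def
proof (rule Bochner_Integration.integrable_bound)
  show "integrable lborel (\<lambda>x. indicator \<Omega> x *\<^sub>R ((\<phi> x)\<^sup>2 * S x))"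
    by (rule set_integrable_\<Omega>[unfolded set_integrable_def]) (intro continuous_intros cont)
  have m: "(\<lambda>x. indicator \<Omega> x *\<^sub>R F x) \<in> borel_measurable lborel" if "continuous_on (closure \<Omega>) F" for F :: "real^'n \<Rightarrow> real"
    by (rule borel_measurable_integrable, rule set_integrable_\<Omega>[unfolded set_integrable_def, OF that])
  have "(\<lambda>x. (indicator \<Omega> x *\<^sub>R ((\<phi> x)\<^sup>2 * ((A x *v w x) \<bullet> w x))) / (indicator \<Omega> x *\<^sub>R (norm (G x))\<^sup>2)) \<in> borel_measurable lborel"
    by (intro borel_measurable_divide m continuous_intros cont)
  moreover have "(\<lambda>x. (indicator \<Omega> x *\<^sub>R ((\<phi> x)\<^sup>2 * ((A x *v w x) \<bullet> w x))) / (indicator \<Omega> x *\<^sub>R (norm (G x))\<^sup>2))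
      = (\<lambda>x. indicator \<Omega> x *\<^sub>R ((\<phi> x)\<^sup>2 * q x))"
    by (rule ext) (auto simp: q_def indicator_def)
  ultimately show "(\<lambda>x. indicator \<Omega> x *\<^sub>R ((\<phi> x)\<^sup>2 * q x)) \<in> borel_measurable lborel" by simp
  have "norm (indicator \<Omega> x *\<^sub>R ((\<phi> x)\<^sup>2 * q x)) \<le> norm (indicator \<Omega> x *\<^sub>R ((\<phi> x)\<^sup>2 * S x))" for x
  proof (cases "x \<in> \<Omega>")
    case True
    then have "0 \<le> q x" "q x \<le> S x" using q_nonneg q_le_S closure_subset by blast+
    then show ?thesis using True by (simp add: abs_mult mult_left_mono)
  qed simp
  then show "AE x in lborel. norm (indicator \<Omega> x *\<^sub>R ((\<phi> x)\<^sup>2 * q x)) \<le> norm (indicator \<Omega> x *\<^sub>R ((\<phi> x)\<^sup>2 * S x))" by blast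
qed

text \<open>
  Stability with the test function \<open>\<phi> (\<epsilon> + \<bar>\<nabla>u\<bar>\<^sup>2)\<^sup>1\<^sup>/\<^sup>2\<close>, which is \<open>C\<^sup>1\<close> also where \<open>\<nabla>u = 0\<close>.
  Since \<open>A\<close> is nonnegative, the error is linear in \<open>\<epsilon>\<close>.
\<close>

lemma stability_regularized:
  assumes \<epsilon>: "\<epsilon> > 0"
  shows "0 \<le> int_q + int_cross
      + int_\<phi>
      + int_boundary - int_reaction
      + \<epsilon> * (dom_int (\<lambda>x. (A x *v D\<phi> x) \<bullet> D\<phi> x) + bd_int (\<lambda>x. deriv h (u x) * (\<phi> x)\<^sup>2) - dom_int (\<lambda>x. deriv f (u x) * (\<phi> x)\<^sup>2))"
proof -
  define r2 where "r2 x = \<epsilon> + (\<Sum>m\<in>UNIV. p m x * p m x)" for x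
  have r2: "r2 x = \<epsilon> + (norm (G x))\<^sup>2" for x
    by (simp add: r2_def power2_norm_eq_inner inner_vec_def[of "G x"] G_component)
  have r2_pos: "r2 x > 0" for x using \<epsilon> by (simp add: r2 add_pos_nonneg)
  have r2_C1: "C1_closure \<Omega> r2 (\<lambda>x. 0 + (\<Sum>m\<in>UNIV. p m x *\<^sub>R D m x + p m x *\<^sub>R D m x))"
    unfolding r2_def[abs_def]
    by (rule C1_closure_add[OF C1_closure_const C1_closure_sum[OF finite C1_closure_mult[OF p_C1 p_C1]]])
  have "C1_closure \<Omega> (\<lambda>x. sqrt (r2 x)) (\<lambda>x. (inverse (sqrt (r2 x)) / 2) *\<^sub>R (0 + (\<Sum>m\<in>UNIV. p m x *\<^sub>R D m x + p m x *\<^sub>R D m x)))"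
  proof (rule C1_closure_compose[OF r2_C1])
    show "(sqrt has_real_derivative inverse (sqrt (r2 x)) / 2) (at (r2 x))" for x by (rule DERIV_real_sqrt[OF r2_pos])
    have "t \<noteq> 0" if "t \<in> r2 ` closure \<Omega>" for t
    proof -
      from that obtain y where "t = r2 y" by blast
      then show ?thesis using r2_pos[of y] by simp
    qed
    then show "continuous_on (r2 ` closure \<Omega>) (\<lambda>t. inverse (sqrt t) / 2)" by (intro continuous_intros) auto
  qed
  moreover have "(inverse (sqrt (r2 x)) / 2) *\<^sub>R (0 + (\<Sum>m\<in>UNIV. p m x *\<^sub>R D m x + p m x *\<^sub>R D m x)) = inverse (sqrt (r2 x)) *\<^sub>R w x" for x
  proof -
    have "(\<Sum>m\<in>UNIV. p m x *\<^sub>R D m x + p m x *\<^sub>R D m x) = 2 *\<^sub>R w x"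
      unfolding w_def sum.distrib scaleR_2 ..
    then show ?thesis by simp
  qed
  ultimately have rt: "C1_closure \<Omega> (\<lambda>x. sqrt (r2 x)) (\<lambda>x. inverse (sqrt (r2 x)) *\<^sub>R w x)" by simp
  define \<zeta> where "\<zeta> x = \<phi> x * sqrt (r2 x)" for x
  define D\<zeta> where "D\<zeta> x = \<phi> x *\<^sub>R (inverse (sqrt (r2 x)) *\<^sub>R w x) + sqrt (r2 x) *\<^sub>R D\<phi> x" for x
  have \<zeta>: "C1_closure \<Omega> \<zeta> D\<zeta>"
    unfolding \<zeta>_def[abs_def] D\<zeta>_def[abs_def] by (rule C1_closure_mult[OF phi_closure rt])
  have \<zeta>2: "(\<zeta> x)\<^sup>2 = (\<phi> x)\<^sup>2 * (\<epsilon> + (norm (G x))\<^sup>2)" for x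
    using r2_pos[of x] by (simp add: \<zeta>_def power_mult_distrib r2[symmetric] less_imp_le)
  have "0 \<le> dom_int (\<lambda>x. (A x *v grad \<Omega> \<zeta> x) \<bullet> grad \<Omega> \<zeta> x) + bd_int (\<lambda>x. deriv h (u x) * (\<zeta> x)\<^sup>2) - dom_int (\<lambda>x. deriv f (u x) * (\<zeta> x)\<^sup>2)"
    using u_sol C1_closure_imp_Ck[OF open_\<Omega> \<zeta>] unfolding stable_weak_solution_def by auto
  moreover have "dom_int (\<lambda>x. (A x *v grad \<Omega> \<zeta> x) \<bullet> grad \<Omega> \<zeta> x) = dom_int (\<lambda>x. (A x *v D\<zeta> x) \<bullet> D\<zeta> x)"
  proof (rule dom_int_cong)
    fix x assume "x \<in> \<Omega>"
    then have "grad \<Omega> \<zeta> x = D\<zeta> x" using C1_closure_grad_eq[OF \<zeta>] closure_subset by blast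
    then show "(A x *v grad \<Omega> \<zeta> x) \<bullet> grad \<Omega> \<zeta> x = (A x *v D\<zeta> x) \<bullet> D\<zeta> x" by simp
  qed
  moreover have "bd_int (\<lambda>x. deriv h (u x) * (\<zeta> x)\<^sup>2) = int_boundary + \<epsilon> * bd_int (\<lambda>x. deriv h (u x) * (\<phi> x)\<^sup>2)"
  proof -
    have "bd_int (\<lambda>x. deriv h (u x) * (\<zeta> x)\<^sup>2) = bd_int (\<lambda>x. deriv h (u x) * (norm (G x))\<^sup>2 * (\<phi> x)\<^sup>2 + \<epsilon> * (deriv h (u x) * (\<phi> x)\<^sup>2))"
      by (rule bd_int_cong) (simp add: \<zeta>2 algebra_simps)
    then show ?thesis
      by (subst (asm) bd_int_add, (intro cont_frontier continuous_intros cont)+) simp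
  qed
  moreover have "dom_int (\<lambda>x. deriv f (u x) * (\<zeta> x)\<^sup>2) = int_reaction + \<epsilon> * dom_int (\<lambda>x. deriv f (u x) * (\<phi> x)\<^sup>2)"
  proof -
    have "dom_int (\<lambda>x. deriv f (u x) * (\<zeta> x)\<^sup>2) = dom_int (\<lambda>x. deriv f (u x) * (norm (G x))\<^sup>2 * (\<phi> x)\<^sup>2 + \<epsilon> * (deriv f (u x) * (\<phi> x)\<^sup>2))"
      by (rule dom_int_cong) (simp add: \<zeta>2 algebra_simps)
    then show ?thesis
      by (subst (asm) dom_int_add, (intro continuous_intros cont)+) simp
  qed
  moreover have "dom_int (\<lambda>x. (A x *v D\<zeta> x) \<bullet> D\<zeta> x) \<le> int_q
      + (int_cross + (int_\<phi>
      + \<epsilon> * dom_int (\<lambda>x. (A x *v D\<phi> x) \<bullet> D\<phi> x)))"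
  proof -
    let ?R = "\<lambda>x. 2 * \<phi> x * ((A x *v w x) \<bullet> D\<phi> x) + ((norm (G x))\<^sup>2 * ((A x *v D\<phi> x) \<bullet> D\<phi> x) + \<epsilon> * ((A x *v D\<phi> x) \<bullet> D\<phi> x))"
    have R_int: "set_integrable lborel \<Omega> ?R"
      by (rule set_integrable_\<Omega>) (intro continuous_intros cont)
    have "dom_int (\<lambda>x. (A x *v D\<zeta> x) \<bullet> D\<zeta> x) \<le> dom_int (\<lambda>x. (\<phi> x)\<^sup>2 * q x + ?R x)"
    proof (rule set_integral_mono)
      show "set_integrable lborel \<Omega> (\<lambda>x. (A x *v D\<zeta> x) \<bullet> D\<zeta> x)"
        by (rule set_integrable_\<Omega>) (intro continuous_intros cont C1_closureD(2)[OF \<zeta>])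
      show "set_integrable lborel \<Omega> (\<lambda>x. (\<phi> x)\<^sup>2 * q x + ?R x)"
        by (rule set_integral_add(1)[OF phi_q_integrable R_int])
      fix x assume "x \<in> \<Omega>"
      then have x: "x \<in> closure \<Omega>" using closure_subset by blast
      define s where "s = sqrt (r2 x)"
      have s: "s > 0" "s\<^sup>2 = \<epsilon> + (norm (G x))\<^sup>2" using r2_pos[of x] by (auto simp: s_def r2[symmetric] less_imp_le)
      have D\<zeta>: "D\<zeta> x = (\<phi> x / s) *\<^sub>R w x + s *\<^sub>R D\<phi> x" by (simp add: D\<zeta>_def s_def divide_inverse)
      have "(A x *v D\<zeta> x) \<bullet> D\<zeta> x = (\<phi> x / s)\<^sup>2 * ((A x *v w x) \<bullet> w x)
          + (\<phi> x / s * s) * ((A x *v w x) \<bullet> D\<phi> x) + (s * (\<phi> x / s)) * ((A x *v D\<phi> x) \<bullet> w x) + s\<^sup>2 * ((A x *v D\<phi> x) \<bullet> D\<phi> x)"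
        unfolding D\<zeta> A_matrix_linear by (simp add: inner_add_left inner_add_right power2_eq_square algebra_simps)
      also have "\<dots> = (\<phi> x)\<^sup>2 * (((A x *v w x) \<bullet> w x) / s\<^sup>2) + 2 * \<phi> x * ((A x *v w x) \<bullet> D\<phi> x) + s\<^sup>2 * ((A x *v D\<phi> x) \<bullet> D\<phi> x)"
        using s(1) by (simp add: A_matrix_symmetric[of a "G x" "D\<phi> x" "w x"] power_divide)
      finally have expand: "(A x *v D\<zeta> x) \<bullet> D\<zeta> x = (\<phi> x)\<^sup>2 * (((A x *v w x) \<bullet> w x) / s\<^sup>2)
          + 2 * \<phi> x * ((A x *v w x) \<bullet> D\<phi> x) + s\<^sup>2 * ((A x *v D\<phi> x) \<bullet> D\<phi> x)" .
      \<comment> \<open>The regularised denominator is larger than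
        \<open>(norm (G x))\<^sup>2\<close> and the numerator is nonnegative. At critical points
        \<open>w x = 0\<close>, so both sides vanish.\<close>
      have "((A x *v w x) \<bullet> w x) / s\<^sup>2 \<le> q x"
      proof (cases "G x = 0")
        case True
        then have "w x = 0" by (simp add: w_def G_component[symmetric])
        then show ?thesis by (simp add: q_def)
      next
        case False
        then show ?thesis unfolding q_def using A_nonneg[OF x, of "w x"] s \<epsilon>
          by (intro divide_left_mono mult_pos_pos) (auto intro: add_pos_nonneg)
      qed
      from mult_left_mono[OF this zero_le_power2, of "\<phi> x"]
      have "(\<phi> x)\<^sup>2 * (((A x *v w x) \<bullet> w x) / s\<^sup>2) \<le> (\<phi> x)\<^sup>2 * q x" .
      moreover have "s\<^sup>2 * ((A x *v D\<phi> x) \<bullet> D\<phi> x) = (norm (G x))\<^sup>2 * ((A x *v D\<phi> x) \<bullet> D\<phi> x) + \<epsilon> * ((A x *v D\<phi> x) \<bullet> D\<phi> x)"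
        unfolding s(2) by (simp add: algebra_simps)
      ultimately show "(A x *v D\<zeta> x) \<bullet> D\<zeta> x \<le> (\<phi> x)\<^sup>2 * q x + ?R x"
        using expand by linarith
    qed
    also have "\<dots> = int_q + dom_int ?R"
      by (rule set_integral_add(2)[OF phi_q_integrable R_int])
    also have "dom_int ?R = int_cross + (int_\<phi>
      + \<epsilon> * dom_int (\<lambda>x. (A x *v D\<phi> x) \<bullet> D\<phi> x))"
      by (subst dom_int_add, (intro continuous_intros cont)+, subst dom_int_add, (intro continuous_intros cont)+, simp)
    finally show ?thesis .
  qed
  ultimately show ?thesis by (simp add: algebra_simps)
qed

text \<open>Carries out the limit of vanishing \<open>\<epsilon>\<close> in
  \<open>stability_regularized\<close>.\<close>

lemma nonneg_of_affine:
  fixes P Q :: real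
  assumes "\<And>\<epsilon>. \<epsilon> > 0 \<Longrightarrow> 0 \<le> P + \<epsilon> * Q"
  shows "0 \<le> P"
proof (rule field_le_epsilon)
  fix e :: real assume e: "e > 0"
  define \<epsilon> where "\<epsilon> = e / (\<bar>Q\<bar> + 1)"
  have "\<epsilon> > 0" using e by (simp add: \<epsilon>_def)
  then have "\<epsilon> * Q \<le> \<epsilon> * (\<bar>Q\<bar> + 1)" by (intro mult_left_mono) auto
  also have "\<dots> = e" by (simp add: \<epsilon>_def add_nonneg_eq_0_iff)
  finally show "0 \<le> P + e" using assms[OF \<open>\<epsilon> > 0\<close>] by linarith
qed

text \<open>Symmetry of the Hessian on the boundary moves the contraction with \<open>\<nu>\<close>
  onto the derivative index, which produces the normal derivative of the gradient.\<close>

lemma boundary_term_eq: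
  assumes x: "x \<in> frontier \<Omega>"
  shows "bterm x
    = a (norm (G x)) * (G x \<bullet> normal_deriv_grad \<Omega> u x) + h (u x) * laplacian \<Omega> u x - f (u x) * normal_deriv \<Omega> u x"
proof -
  have c: "x \<in> closure \<Omega>" using x frontier_sub by blast
  have "(\<Sum>m\<in>UNIV. (\<Sum>j\<in>UNIV. V j x * D m x $ j) * \<nu> x $ m) = (\<Sum>m\<in>UNIV. \<Sum>j\<in>UNIV. a (norm (G x)) * (p j x * (D j x $ m * \<nu> x $ m)))"
    by (simp add: V_def sum_distrib_right hessian_symmetric[OF c, of _ _] mult.assoc hessian_symmetric[OF c])
  also have "\<dots> = (\<Sum>j\<in>UNIV. \<Sum>m\<in>UNIV. a (norm (G x)) * (p j x * (D j x $ m * \<nu> x $ m)))" by (rule sum.swap)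
  also have "\<dots> = a (norm (G x)) * (G x \<bullet> normal_deriv_grad \<Omega> u x)"
    by (simp add: inner_vec_def[of "G x"] normal_deriv_grad_def normal_deriv_def inner_vec_def[of "D _ x"] G_component sum_distrib_left)
  finally have 1: "(\<Sum>m\<in>UNIV. (\<Sum>j\<in>UNIV. V j x * D m x $ j) * \<nu> x $ m) = a (norm (G x)) * (G x \<bullet> normal_deriv_grad \<Omega> u x)" .
  have 2: "(\<Sum>m\<in>UNIV. D m x $ m) = laplacian \<Omega> u x" by (simp add: laplacian_def grad_def)
  have 3: "(\<Sum>m\<in>UNIV. p m x * \<nu> x $ m) = normal_deriv \<Omega> u x"
    by (simp add: normal_deriv_def inner_vec_def[of "G x"] G_component)
  show ?thesis unfolding boundary_term_def 1 2 3 ..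
qed

text \<open>The terms \<open>int_cross\<close> and \<open>int_reaction\<close> occur alike in the
  energy identity and in the stability inequality, so subtraction removes them; what remains in the
  domain is \<open>S - q\<close>.\<close>

lemma geometric_inequality:
  "(LINT x:(\<Omega> \<inter> {x. G x \<noteq> 0})|lborel.
        geo x * (\<phi> x)\<^sup>2)
     + bd_int (\<lambda>x. (f (u x) * normal_deriv \<Omega> u x - a (norm (G x)) * (G x \<bullet> normal_deriv_grad \<Omega> u x)
         - h (u x) * laplacian \<Omega> u x - deriv h (u x) * (norm (G x))\<^sup>2) * (\<phi> x)\<^sup>2)
     \<le> int_\<phi>"
proof -
  define R where "R = \<Omega> \<inter> {x. G x \<noteq> 0}"
  have "open (\<Omega> \<inter> G -` (- {0}))"
    by (rule continuous_open_preimage[OF continuous_on_subset[OF C1_closureD(2)[OF u_C1] closure_subset] open_\<Omega>]) auto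
  moreover have "R = \<Omega> \<inter> G -` (- {0})" by (auto simp: R_def)
  ultimately have R: "R \<in> sets lborel" "R \<subseteq> \<Omega>" by auto
  have S_int: "set_integrable lborel \<Omega> (\<lambda>x. (\<phi> x)\<^sup>2 * S x)"
    by (rule set_integrable_\<Omega>) (intro continuous_intros cont)
  have d_int: "set_integrable lborel \<Omega> (\<lambda>x. (\<phi> x)\<^sup>2 * S x - (\<phi> x)\<^sup>2 * q x)"
    by (rule set_integral_diff(1)[OF S_int phi_q_integrable])
  have geo: "(LINT x:R|lborel. geo x * (\<phi> x)\<^sup>2)
      \<le> int_S - int_q"
  proof -
    have "(LINT x:R|lborel. geo x * (\<phi> x)\<^sup>2)
      = (LINT x:R|lborel. (\<phi> x)\<^sup>2 * S x - (\<phi> x)\<^sup>2 * q x)"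
    proof (rule set_lebesgue_integral_cong[OF R(1)], intro allI impI)
      fix x assume "x \<in> R"
      then have "x \<in> \<Omega>" "G x \<noteq> 0" by (auto simp: R_def)
      then show "geo x * (\<phi> x)\<^sup>2 = (\<phi> x)\<^sup>2 * S x - (\<phi> x)\<^sup>2 * q x"
        unfolding geometric_density[OF \<open>x \<in> \<Omega>\<close> \<open>G x \<noteq> 0\<close>] by (simp add: algebra_simps)
    qed
    \<comment> \<open>Enlarging the set from \<open>R\<close> to \<open>\<Omega>\<close> adds the
      critical set, where the integrand is nonnegative by \<open>q_le_S\<close>.\<close>
    also have "\<dots> \<le> dom_int (\<lambda>x. (\<phi> x)\<^sup>2 * S x - (\<phi> x)\<^sup>2 * q x)"
      unfolding set_lebesgue_integral_def
    proof (rule integral_mono)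
      show "integrable lborel (\<lambda>x. indicator R x *\<^sub>R ((\<phi> x)\<^sup>2 * S x - (\<phi> x)\<^sup>2 * q x))"
        using set_integrable_subset[OF d_int R] by (simp add: set_integrable_def)
      show "integrable lborel (\<lambda>x. indicator \<Omega> x *\<^sub>R ((\<phi> x)\<^sup>2 * S x - (\<phi> x)\<^sup>2 * q x))"
        using d_int by (simp add: set_integrable_def)
      fix x
      have "0 \<le> (\<phi> x)\<^sup>2 * S x - (\<phi> x)\<^sup>2 * q x" if "x \<in> \<Omega>"
        using mult_left_mono[OF q_le_S[OF that], of "(\<phi> x)\<^sup>2"] by simp
      then show "indicator R x *\<^sub>R ((\<phi> x)\<^sup>2 * S x - (\<phi> x)\<^sup>2 * q x) \<le> indicator \<Omega> x *\<^sub>R ((\<phi> x)\<^sup>2 * S x - (\<phi> x)\<^sup>2 * q x)"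
        using R(2) by (auto simp: indicator_def)
    qed
    also have "\<dots> = int_S - int_q"
      by (rule set_integral_diff(2)[OF S_int phi_q_integrable])
    finally show ?thesis .
  qed
  have bd: "bd_int (\<lambda>x. (f (u x) * normal_deriv \<Omega> u x - a (norm (G x)) * (G x \<bullet> normal_deriv_grad \<Omega> u x)
         - h (u x) * laplacian \<Omega> u x - deriv h (u x) * (norm (G x))\<^sup>2) * (\<phi> x)\<^sup>2)
    = - bd_int (\<lambda>x. \<phi> x * \<phi> x * bterm x)
      - int_boundary"
  proof -
    have "bd_int (\<lambda>x. (f (u x) * normal_deriv \<Omega> u x - a (norm (G x)) * (G x \<bullet> normal_deriv_grad \<Omega> u x)
         - h (u x) * laplacian \<Omega> u x - deriv h (u x) * (norm (G x))\<^sup>2) * (\<phi> x)\<^sup>2)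
      = bd_int (\<lambda>x. (-1) * (\<phi> x * \<phi> x * bterm x) - deriv h (u x) * (norm (G x))\<^sup>2 * (\<phi> x)\<^sup>2)"
      by (rule bd_int_cong) (simp add: boundary_term_eq power2_eq_square algebra_simps)
    also have "\<dots> = bd_int (\<lambda>x. (-1) * (\<phi> x * \<phi> x * bterm x)) - int_boundary"
    proof (rule bd_int_diff)
      show "continuous_on (frontier \<Omega>) (\<lambda>x. (-1) * (\<phi> x * \<phi> x * bterm x))"
        by (intro continuous_intros C1_continuous_frontier[OF phi_closure] continuous_boundary_term[OF V_C1 C1_closureD(1)[OF hu_C1] fu_C1 p_C1])
      show "continuous_on (frontier \<Omega>) (\<lambda>x. deriv h (u x) * (norm (G x))\<^sup>2 * (\<phi> x)\<^sup>2)"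
        by (rule cont_frontier) (intro continuous_intros cont)
    qed
    finally show ?thesis by (simp add: set_lebesgue_integral_def)
  qed
  have stab: "0 \<le> int_q + int_cross
      + int_\<phi>
      + int_boundary - int_reaction"
    by (rule nonneg_of_affine[OF stability_regularized])
  show ?thesis
    using geo stab energy_identity unfolding R_def[symmetric] bd by linarith
qed

end

theorem corollary1p4:
  fixes \<Omega> :: "(real^'n) set"
    and \<sigma> :: "(real^'n) measure"
    and a f h :: "real \<Rightarrow> real"
    and u \<phi> :: "real^'n \<Rightarrow> real"
    and k :: "real^'n \<Rightarrow> nat \<Rightarrow> real"
  assumes domain: "smooth_bounded_domain \<Omega>"
    and sigma: "surface_measure (frontier \<Omega>) \<sigma>"
    and f_C1: "f C1_differentiable_on UNIV"
    and h_C1: "h C1_differentiable_on UNIV"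
    and a_reg: "C11_loc_pos a"
    and a_pos: "\<And>t. t > 0 \<Longrightarrow> a t > 0"
    and a_ell: "\<And>t. t > 0 \<Longrightarrow> a t + deriv a t * t > 0"
    and u_C2: "Ck_closure 2 \<Omega> u"
    and u_sol: "stable_weak_solution \<Omega> \<sigma> a f h u"
    and curv: "\<And>x. x \<in> \<Omega> \<Longrightarrow> grad \<Omega> u x \<noteq> 0 \<Longrightarrow>
                 principal_curvatures (regular_level_set \<Omega> u x) x (k x)"
    and phi_C1: "Ck_closure 1 \<Omega> \<phi>"
  shows
    "(LINT x:(\<Omega> \<inter> {x. grad \<Omega> u x \<noteq> 0})|lborel.
        (lambda1 a (norm (grad \<Omega> u x))
           * (norm (tangential_grad \<Omega> u (\<lambda>y. norm (grad \<Omega> u y)) x))\<^sup>2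
         + a (norm (grad \<Omega> u x)) * (norm (grad \<Omega> u x))\<^sup>2 * (\<Sum>j=1..CARD('n) - 1. (k x j)\<^sup>2))
        * (\<phi> x)\<^sup>2)
     + (LINT x:frontier \<Omega>|\<sigma>.
        (f (u x) * normal_deriv \<Omega> u x
         - a (norm (grad \<Omega> u x)) * (grad \<Omega> u x \<bullet> normal_deriv_grad \<Omega> u x)
         - h (u x) * laplacian \<Omega> u x
         - deriv h (u x) * (norm (grad \<Omega> u x))\<^sup>2)
        * (\<phi> x)\<^sup>2)
     \<le> (LINT x:\<Omega>|lborel.
        (norm (grad \<Omega> u x))\<^sup>2 * ((A_matrix a (grad \<Omega> u x) *v grad \<Omega> \<phi> x) \<bullet> grad \<Omega> \<phi> x))"
proof -
  interpret stable_solution \<Omega> \<sigma> a f h u \<phi> k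
    by unfold_locales (fact assms)+
  show ?thesis by (rule geometric_inequality)
qed

end
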